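(* There is no almost positive knot $K$ with $\Delta$-unknotting number $u^{\Delta}(K)=1$.
   Context: A $\Delta$-move is a local move on knot diagrams. Inside a disk, the diagram consists of three arcs, each pair crossing exactly once, bounding a small triangle, with cyclic over/under information (arc 1 passes over arc 2, arc 2 over arc 3, arc 3 over arc 1, up to relabelling). The move replaces this by the diagram with the same endpoints obtained by pushing one arc across the crossing of the other two (so the triangle is reversed, as in a Reidemeister III move), keeping the over/under information of each pair. Diagrams may also be changed by ambient isotopy (Reidemeister moves). Any two knots are related by finitely many $\Delta$-moves (Murakami–Nakanishi). The $\Delta$-Gordian distance $d_G^{\Delta}(K,K')$ is the minimum number of $\Delta$-moves needed to deform $K$ into $K'$, and the $\Delta$-unknotting number is $u^{\Delta}(K)=d_G^{\Delta}(K,O)$, with $O$ the trivial knot. A knot is positive if it has a diagram all of whose crossings are positive. A knot is almost positive if it is not positive and has a diagram with exactly one negative crossing. *)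

theory Defs
  imports "HOL-Combinatorics.Orbits" "HOL-Library.Extended_Nat"
begin

text \<open>
  Knot diagrams are handled combinatorially: a diagram on the oriented sphere, up to isotopy of the
  sphere, is recorded by its signed Gauss word. Travelling once around the knot, each passage
  through a crossing contributes the name of the crossing, whether the strand travelled on is the
  upper one there, and whether the crossing is positive. The empty word is the circle without
  crossings. Using the sphere instead of the plane makes no difference: moving an arc over the
  point at infinity does not change the knot, and neither crossing signs nor local moves refer to
  that point. Knots are the classes of diagrams modulo Reidemeister moves.
\<close>

datatype passage = Passage (crossing: nat) (over: bool) (positive: bool)

text \<open>Each crossing is passed exactly twice, once above and once below, with the same sign.\<close>

definition gauss_word :: "passage list \<Rightarrow> bool" where
  "gauss_word w \<longleftrightarrow>
     distinct (map (\<lambda>v. (crossing v, over v)) w) \<and>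
     (\<forall>v\<in>set w. Passage (crossing v) (\<not> over v) (positive v) \<in> set w)"

definition succ_pos :: "passage list \<Rightarrow> nat \<Rightarrow> nat" where
  "succ_pos w i = (i + 1) mod length w"

definition pred_pos :: "passage list \<Rightarrow> nat \<Rightarrow> nat" where
  "pred_pos w i = (i + length w - 1) mod length w"

text \<open>The position of the other passage through the crossing met at position \<open>i\<close>.\<close>

definition partner :: "passage list \<Rightarrow> nat \<Rightarrow> nat" where
  "partner w i = (THE j. j < length w \<and> j \<noteq> i \<and> crossing (w ! j) = crossing (w ! i))"

text \<open>
  Seen from the strand passing at position \<open>i\<close>, the other strand crosses from right to left exactly
  if we are on the upper strand of a positive or on the lower strand of a negative crossing.
\<close>

definition from_right :: "passage list \<Rightarrow> nat \<Rightarrow> bool" where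
  "from_right w i \<longleftrightarrow> (over (w ! i) \<longleftrightarrow> positive (w ! i))"

text \<open>
  Edge \<open>i\<close> of the underlying 4-valent graph runs from position \<open>i\<close> to position \<open>succ_pos w i\<close>.
  The pair \<open>(i, True)\<close> stands for this edge travelled in the direction of the knot and
  \<open>(i, False)\<close> for the same edge travelled backwards. The map \<open>next_dart\<close> travels to the end of the
  edge and turns left there, i.e. it walks around the region on the left hand side.
\<close>

definition darts :: "passage list \<Rightarrow> (nat \<times> bool) set" where
  "darts w = {..<length w} \<times> UNIV"

definition next_dart :: "passage list \<Rightarrow> nat \<times> bool \<Rightarrow> nat \<times> bool" where
  "next_dart w = (\<lambda>(i, fwd).
     let j = (if fwd then succ_pos w i else i); k = partner w j
     in if fwd = from_right w j then (k, True) else (pred_pos w k, False))"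

definition faces :: "passage list \<Rightarrow> (nat \<times> bool) set set" where
  "faces w = orbit (next_dart w) ` darts w"

text \<open>
  The graph of a nonempty word is connected, with \<open>n = length w div 2\<close> vertices and \<open>2 * n\<close> edges,
  so by Euler's formula the surface obtained by glueing in the faces is the sphere exactly
  if there are \<open>n + 2\<close> faces.
\<close>

definition planar :: "passage list \<Rightarrow> bool" where
  "planar w \<longleftrightarrow> w = [] \<or> card (faces w) = length w div 2 + 2"

typedef knot_diagram = "{w. gauss_word w \<and> planar w}"
  morphisms word Diagram
proof
  show "[] \<in> {w. gauss_word w \<and> planar w}"
    by (simp add: gauss_word_def planar_def)
qed

text \<open>
  A triangle is a face with three pairwise distinct crossings as corners; it is represented by the
  set of its three edges. Pushing one of the three arcs across the crossing of the other two
  interchanges, on each of the three arcs, the order of the two crossings it passes through, and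
  keeps signs and over/under information.
\<close>

definition triangle :: "passage list \<Rightarrow> nat set \<Rightarrow> bool" where
  "triangle w T \<longleftrightarrow>
     (\<exists>F\<in>faces w. card F = 3 \<and> T = fst ` F) \<and>
     card ((\<lambda>i. crossing (w ! i)) ` T \<union> (\<lambda>i. crossing (w ! succ_pos w i)) ` T) = 3"

definition push_triangle :: "passage list \<Rightarrow> nat set \<Rightarrow> passage list" where
  "push_triangle w T =
     map (\<lambda>p. if p \<in> T then w ! succ_pos w p
              else if pred_pos w p \<in> T then w ! pred_pos w p
              else w ! p) [0..<length w]"

text \<open>
  The over/under information at the corners is cyclic (arc 1 over arc 2 over arc 3 over arc 1)
  exactly if each of the three arcs passes over at one of its corners and under at the other.
  In all other cases one arc is on top, one in the middle and one at the bottom.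
\<close>

definition cyclic_triangle :: "passage list \<Rightarrow> nat set \<Rightarrow> bool" where
  "cyclic_triangle w T \<longleftrightarrow> triangle w T \<and> (\<forall>i\<in>T. over (w ! i) \<noteq> over (w ! succ_pos w i))"

text \<open>
  Rules \<open>rotate\<close>, \<open>reverse\<close> and \<open>relabel\<close> change the starting point, the direction of travel and the
  names of the crossings, which are not part of the diagram (knots are unoriented; reversing the
  direction preserves the signs of all crossings). The other rules are the Reidemeister moves.
  All of them are only applied between planar words (see \<open>diagram_step\<close> below). For \<open>R2\<close> this
  suffices: as the two new crossings have opposite signs, the two new edges between them bound a
  bigon face of the resulting diagram.
\<close>

inductive word_step :: "passage list \<Rightarrow> passage list \<Rightarrow> bool" where
  rotate: "word_step w (rotate1 w)"
| reverse: "word_step w (rev w)"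
| relabel: "inj_on f (crossing ` set w) \<Longrightarrow>
    word_step w (map (\<lambda>v. Passage (f (crossing v)) (over v) (positive v)) w)"
| R1: "a \<notin> crossing ` set (xs @ ys) \<Longrightarrow>
    word_step (xs @ ys) (xs @ [Passage a u s, Passage a (\<not> u) s] @ ys)"
| R2_parallel: "\<lbrakk>a \<noteq> b; a \<notin> crossing ` set (xs @ ys @ zs); b \<notin> crossing ` set (xs @ ys @ zs)\<rbrakk> \<Longrightarrow>
    word_step (xs @ ys @ zs)
      (xs @ [Passage a u s, Passage b u (\<not> s)] @ ys @
       [Passage a (\<not> u) s, Passage b (\<not> u) (\<not> s)] @ zs)"
| R2_antiparallel: "\<lbrakk>a \<noteq> b; a \<notin> crossing ` set (xs @ ys @ zs); b \<notin> crossing ` set (xs @ ys @ zs)\<rbrakk> \<Longrightarrow>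
    word_step (xs @ ys @ zs)
      (xs @ [Passage a u s, Passage b u (\<not> s)] @ ys @
       [Passage b (\<not> u) (\<not> s), Passage a (\<not> u) s] @ zs)"
| R3: "\<lbrakk>triangle w T; \<not> cyclic_triangle w T\<rbrakk> \<Longrightarrow> word_step w (push_triangle w T)"

definition diagram_step :: "knot_diagram \<Rightarrow> knot_diagram \<Rightarrow> bool" where
  "diagram_step D D' \<longleftrightarrow> word_step (word D) (word D')"

quotient_type knot = knot_diagram / "equivclp diagram_step"
  morphisms rep_knot knot_of
  by (intro equivpI reflpI sympI transpI) (auto intro: equivclp_sym equivclp_trans)

definition trivial_knot :: knot where
  "trivial_knot = knot_of (Diagram [])"

definition negative_crossings :: "knot_diagram \<Rightarrow> nat set" where
  "negative_crossings D = crossing ` {v \<in> set (word D). \<not> positive v}"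

definition positive_knot :: "knot \<Rightarrow> bool" where
  "positive_knot K \<longleftrightarrow> (\<exists>D. knot_of D = K \<and> negative_crossings D = {})"

definition almost_positive_knot :: "knot \<Rightarrow> bool" where
  "almost_positive_knot K \<longleftrightarrow>
     \<not> positive_knot K \<and> (\<exists>D. knot_of D = K \<and> card (negative_crossings D) = 1)"

definition delta_move :: "knot_diagram \<Rightarrow> knot_diagram \<Rightarrow> bool" where
  "delta_move D D' \<longleftrightarrow>
     (\<exists>T. cyclic_triangle (word D) T \<and> word D' = push_triangle (word D) T)"

text \<open>One \<open>\<Delta>\<close>-move, where diagrams may be changed by isotopy before and after the move.\<close>

definition delta_related :: "knot \<Rightarrow> knot \<Rightarrow> bool" where
  "delta_related K K' \<longleftrightarrow> (\<exists>D D'. knot_of D = K \<and> knot_of D' = K' \<and> delta_move D D')"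

text \<open>
  The value is taken in the extended naturals, so that the definition does not depend on the
  theorem of Murakami and Nakanishi that it is always finite.
\<close>

definition delta_gordian_distance :: "knot \<Rightarrow> knot \<Rightarrow> enat" where
  "delta_gordian_distance K K' = Inf {enat n | n. (delta_related ^^ n) K K'}"

definition delta_unknotting_number :: "knot \<Rightarrow> enat" where
  "delta_unknotting_number K = delta_gordian_distance K trivial_knot"

end

theory Submission
  imports Defs "HOL-Library.FuncSet" "HOL-Library.Sublist"
begin

text \<open>
  The Polyak-Viro number of a Gauss word, a signed count of interleaved pairs of crossings, is a knot
  invariant and changes by exactly \<open>1\<close> under a \<open>\<Delta>\<close>-move. Counted from the over passage of the only
  negative crossing \<open>c\<close> it is an ordinary number of pairs. So if an almost positive knot had
  \<open>u\<^sup>\<Delta> = 1\<close>, exactly one pair \<open>(i, j)\<close> would be counted.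

  Take such a diagram with as few crossings as possible. It has no kink and no bigon formed by \<open>c\<close> and
  another crossing, not even one with a local knot tied into one of its sides. As the Alexander
  numbering makes the signed number of passages along each loop zero, a loop passing only over or only
  under would produce such a bigon, so there is none. It follows that the arc spanned by \<open>i\<close> and
  \<open>j\<close> lies below the rest of the knot, which has no crossings with itself, and the index identities
  for \<open>i\<close> and \<open>j\<close> leave only twelve families of words. In these the index identities can only hold if
  at most two Reidemeister moves of type three produce a bigon at \<open>c\<close>, a contradiction.
\<close>

section \<open>Labellings of the regions\<close>

text \<open>Planarity is given as a count of faces, which says nothing directly about how strands
  cross. The bridge is linear algebra: a function on the regions with values modulo \<open>m\<close>
  is determined, up to a constant, by one flow (the difference across an edge) and one jump per
  crossing. For \<open>n\<close> crossings there are \<open>m ^ (n + 1)\<close> such data, so a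
  closed labelling has at most \<open>n + 2\<close> labels, and if it has exactly
  \<open>n + 2\<close>, every choice of flow and jumps is realised. The first half makes planarity
  certifiable after a local move; the second provides winding number functions and hence the index
  identities. Counting needs finite sets, so potentials are only constructed modulo
  \<open>m\<close>, for all \<open>m\<close>.

  Local knots in the side of a bigon have to be allowed because the index identities do not see
  them: they only show that the arc between two crossings meets nothing but itself.

  Finitely many families remain because, apart from the crossings \<open>c\<close>, \<open>i\<close>
  and \<open>j\<close>, all terms in an index identity have the same sign, so that a small total
  bounds each of them.\<close>

definition bar :: "passage \<Rightarrow> passage" where
  "bar v = Passage (crossing v) (\<not> over v) (positive v)"

text \<open>A crossing change flips \<open>over\<close> and \<open>positive\<close> together and
  preserves \<open>fr\<close>. So this is the information carried by the underlying curve on the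
  sphere; planarity and the index identities depend on nothing else.\<close>

definition fr :: "passage \<Rightarrow> bool" where
  "fr v \<longleftrightarrow> (over v \<longleftrightarrow> positive v)"

lemma bar_simps [simp]:
  "crossing (bar v) = crossing v" "over (bar v) = (\<not> over v)" "positive (bar v) = positive v"
  "bar (bar v) = v" "fr (bar v) = (\<not> fr v)" "bar v \<noteq> v" "v \<noteq> bar v"
  by (cases v; auto simp: bar_def fr_def)+

lemma bar_eq_iff [simp]: "bar u = bar v \<longleftrightarrow> u = v"
  by (metis bar_simps(4))

lemma gauss_word_distinct: "gauss_word w \<Longrightarrow> distinct w"
  by (auto simp: gauss_word_def distinct_map)

lemma gauss_word_bar: "gauss_word w \<Longrightarrow> v \<in> set w \<Longrightarrow> bar v \<in> set w"
  by (auto simp: gauss_word_def bar_def)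

lemma gauss_word_same_crossing:
  assumes "gauss_word w" "u \<in> set w" "v \<in> set w" "crossing u = crossing v"
  shows "u = v \<or> u = bar v"
proof -
  have inj: "inj_on (\<lambda>v. (crossing v, over v)) (set w)"
    using assms(1) by (auto simp: gauss_word_def distinct_map)
  show ?thesis
  proof (cases "over u = over v")
    case True
    then show ?thesis using inj assms by (auto dest: inj_onD)
  next
    case False
    have "bar v \<in> set w" using assms gauss_word_bar by blast
    then have "u = bar v"
      using inj_onD[OF inj, of u "bar v"] assms False by auto
    then show ?thesis ..
  qed
qed

text \<open>In terms of \<open>bar\<close>, the property depends only on distinctness and the set of
  letters, so reordering preserves it and insertions can be checked letter by letter.\<close>

lemma gauss_word_iff:
  "gauss_word w \<longleftrightarrow> distinct w \<and> (\<forall>v\<in>set w. bar v \<in> set w) \<and>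
     (\<forall>u\<in>set w. \<forall>v\<in>set w. crossing u = crossing v \<longrightarrow> u = v \<or> u = bar v)"
  (is "_ \<longleftrightarrow> ?R")
proof
  assume "gauss_word w"
  then show ?R
    using gauss_word_distinct gauss_word_bar gauss_word_same_crossing by blast
next
  assume ?R
  then have "inj_on (\<lambda>v. (crossing v, over v)) (set w)"
    by (intro inj_onI) (metis bar_simps(2) prod.inject)
  with \<open>?R\<close> show "gauss_word w"
    by (auto simp: gauss_word_def distinct_map bar_def)
qed

lemma partner_eqI:
  assumes w: "gauss_word w" and i: "i < length w" and j: "j < length w" "w ! j = bar (w ! i)"
  shows "partner w i = j"
  unfolding partner_def
proof (rule the_equality)
  show "j < length w \<and> j \<noteq> i \<and> crossing (w ! j) = crossing (w ! i)"
    using j by (metis bar_simps(1) bar_simps(6))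
next
  fix k assume k: "k < length w \<and> k \<noteq> i \<and> crossing (w ! k) = crossing (w ! i)"
  then have "w ! k = w ! i \<or> w ! k = bar (w ! i)"
    using gauss_word_same_crossing[OF w] i by (meson nth_mem)
  moreover have "w ! k \<noteq> w ! i"
    using k i gauss_word_distinct[OF w] by (simp add: nth_eq_iff_index_eq)
  ultimately show "k = j"
    using k j gauss_word_distinct[OF w] by (metis nth_eq_iff_index_eq)
qed

lemma partner:
  assumes w: "gauss_word w" and i: "i < length w"
  shows "partner w i < length w" "w ! partner w i = bar (w ! i)"
proof -
  obtain j where "j < length w" "w ! j = bar (w ! i)"
    using gauss_word_bar[OF w nth_mem[OF i]] by (auto simp: in_set_conv_nth)
  then show "partner w i < length w" "w ! partner w i = bar (w ! i)"
    using partner_eqI[OF w i] by auto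
qed

lemma partner_partner: "gauss_word w \<Longrightarrow> i < length w \<Longrightarrow> partner w (partner w i) = i"
  by (intro partner_eqI) (auto simp: partner)

lemma succ_pos_less: "i < length w \<Longrightarrow> succ_pos w i < length w"
  by (simp add: succ_pos_def mod_less_divisor[OF order.strict_trans1[OF zero_le]])

lemma pred_pos_less: "i < length w \<Longrightarrow> pred_pos w i < length w"
  by (simp add: pred_pos_def mod_less_divisor[OF order.strict_trans1[OF zero_le]])

lemma succ_pos_eq: "i < length w \<Longrightarrow> succ_pos w i = (if Suc i = length w then 0 else Suc i)"
  by (auto simp: succ_pos_def)

lemma pred_pos_eq: "i < length w \<Longrightarrow> pred_pos w i = (if i = 0 then length w - 1 else i - 1)"
  by (cases i) (simp_all add: pred_pos_def)

lemma succ_pred_pos [simp]: "i < length w \<Longrightarrow> succ_pos w (pred_pos w i) = i"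
  using pred_pos_less[of i w] by (auto simp: succ_pos_eq pred_pos_eq)

lemma pred_succ_pos [simp]: "i < length w \<Longrightarrow> pred_pos w (succ_pos w i) = i"
  using succ_pos_less[of i w] by (auto simp: succ_pos_eq pred_pos_eq)

lemma from_right_fr: "from_right w i = fr (w ! i)"
  by (simp add: from_right_def fr_def)

lemma next_dart_in: "gauss_word w \<Longrightarrow> d \<in> darts w \<Longrightarrow> next_dart w d \<in> darts w"
  by (auto simp: next_dart_def darts_def Let_def partner succ_pos_less pred_pos_less split: prod.splits)

definition dart_end :: "passage list \<Rightarrow> nat \<times> bool \<Rightarrow> nat" where
  "dart_end w d = (if snd d then succ_pos w (fst d) else fst d)"

lemma next_dart_alt:
  "next_dart w d = (let k = partner w (dart_end w d) in
     if snd d = fr (w ! dart_end w d) then (k, True) else (pred_pos w k, False))"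
  by (auto simp: next_dart_def dart_end_def Let_def from_right_fr split: prod.splits)

text \<open>A dart is recovered from its successor: the starting passage of the successor has as
  partner the passage where the dart ended, and \<open>fr\<close> there tells in which direction it
  was travelled.\<close>

lemma inj_next_dart:
  assumes w: "gauss_word w"
  shows "inj_on (next_dart w) (darts w)"
proof (rule inj_onI)
  fix d d' assume d: "d \<in> darts w" "d' \<in> darts w" and eq: "next_dart w d = next_dart w d'"
  have ends: "dart_end w d < length w" "dart_end w d' < length w"
    using d by (auto simp: dart_end_def darts_def succ_pos_less)
  let ?k = "partner w (dart_end w d)" and ?k' = "partner w (dart_end w d')"
  have k: "?k < length w" "?k' < length w"
    using partner(1)[OF w] ends by auto
  have kk: "?k = ?k'" and dir: "(snd d = fr (w ! dart_end w d)) = (snd d' = fr (w ! dart_end w d'))"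
    using eq arg_cong[where f = "succ_pos w", of "pred_pos w ?k" "pred_pos w ?k'"]
    unfolding next_dart_alt Let_def succ_pred_pos[OF k(1)] succ_pred_pos[OF k(2)]
    by (metis prod.inject)+
  from kk have "dart_end w d = dart_end w d'"
    using partner_partner[OF w] ends by metis
  with dir have "snd d = snd d'" by auto
  with \<open>dart_end w d = dart_end w d'\<close> d show "d = d'"
    by (cases d; cases d') (auto simp: dart_end_def darts_def split: if_splits, metis pred_succ_pos)
qed

lemma finite_darts [simp]: "finite (darts w)"
  by (simp add: darts_def)

text \<open>\<open>orbit\<close> contains the points reached after at least one step, so this says
  that the walk around a region closes up. Extended by the identity outside the finite set of darts,
  \<open>next_dart\<close> becomes a permutation.\<close>

lemma self_in_orbit_next_dart:
  assumes w: "gauss_word w" and d: "d \<in> darts w"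
  shows "d \<in> orbit (next_dart w) d"
proof -
  define g where "g = (\<lambda>d. if d \<in> darts w then next_dart w d else d)"
  have "g permutes darts w"
  proof (rule bij_imp_permutes)
    have "next_dart w ` darts w = darts w"
      by (intro endo_inj_surj) (auto simp: next_dart_in w inj_next_dart)
    then have "bij_betw (next_dart w) (darts w) (darts w)"
      using inj_next_dart[OF w] by (auto simp: bij_betw_def)
    then show "bij_betw g (darts w) (darts w)"
      by (subst bij_betw_cong[where g = "next_dart w"]) (auto simp: g_def)
  qed (auto simp: g_def)
  then have "permutation g"
    unfolding permutation_permutes using finite_darts by blast
  then have "d \<in> orbit g d"
    by (rule permutation_self_in_orbit)
  also have "orbit g d = orbit (next_dart w) d"
    by (rule orbit_cong0[OF d]) (auto simp: g_def next_dart_in w)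
  finally show ?thesis .
qed

lemma orbit_next_dart:
  "gauss_word w \<Longrightarrow> d \<in> darts w \<Longrightarrow> orbit (next_dart w) (next_dart w d) = orbit (next_dart w) d"
  by (rule self_in_orbit_step) (rule self_in_orbit_next_dart)

lemma finite_faces [simp]: "finite (faces w)"
  by (simp add: faces_def)

text \<open>
  The four corners at a crossing are labelled by compass directions, where the passage \<open>v\<close> with
  \<open>fr v\<close> heads north and hence its partner heads west. A chain of labels along a word records the
  labels to the left and to the right of the edges; a labelling with a closed chain is a function
  on the regions of the diagram.
\<close>

definition inc :: "(nat \<Rightarrow> bool \<Rightarrow> bool \<Rightarrow> 'b) \<Rightarrow> passage \<Rightarrow> 'b \<times> 'b" where
  "inc K v = (if fr v then (K (crossing v) False False, K (crossing v) False True)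
              else (K (crossing v) False True, K (crossing v) True True))"

definition out :: "(nat \<Rightarrow> bool \<Rightarrow> bool \<Rightarrow> 'b) \<Rightarrow> passage \<Rightarrow> 'b \<times> 'b" where
  "out K v = (if fr v then (K (crossing v) True False, K (crossing v) True True)
              else (K (crossing v) False False, K (crossing v) True False))"

fun chain :: "(nat \<Rightarrow> bool \<Rightarrow> bool \<Rightarrow> 'b) \<Rightarrow> 'b \<times> 'b \<Rightarrow> passage list \<Rightarrow> 'b \<times> 'b \<Rightarrow> bool" where
  "chain K s [] t \<longleftrightarrow> s = t"
| "chain K s (v # w) t \<longleftrightarrow> s = inc K v \<and> chain K (out K v) w t"

definition labels :: "(nat \<Rightarrow> bool \<Rightarrow> bool \<Rightarrow> 'b) \<Rightarrow> passage list \<Rightarrow> 'b set" where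
  "labels K w = (\<Union>v\<in>set w. range (case_prod (K (crossing v))))"

lemma chain_append: "chain K s (u @ v) t \<longleftrightarrow> (\<exists>m. chain K s u m \<and> chain K m v t)"
  by (induction u arbitrary: s) auto

lemma chain_nth_aux:
  "chain K s (v # w) t \<longleftrightarrow> s = inc K v \<and> out K (last (v # w)) = t \<and>
      (\<forall>i<length w. out K ((v # w) ! i) = inc K (w ! i))"
proof (induction w arbitrary: s v)
  case (Cons u w)
  have "chain K s (v # u # w) t \<longleftrightarrow> s = inc K v \<and> chain K (out K v) (u # w) t" by simp
  also have "\<dots> \<longleftrightarrow> s = inc K v \<and> out K v = inc K u \<and> out K (last (u # w)) = t \<and>
      (\<forall>i<length w. out K ((u # w) ! i) = inc K (w ! i))"
    unfolding Cons.IH ..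
  finally show ?case by (auto simp: All_less_Suc2)
qed auto

lemma chain_cyclic_nth:
  assumes "w \<noteq> []"
  shows "(\<exists>s. chain K s w s) \<longleftrightarrow> (\<forall>i<length w. out K (w ! i) = inc K (w ! succ_pos w i))"
proof -
  obtain v u where w: "w = v # u" using assms by (cases w) auto
  have "(\<exists>s. chain K s w s) \<longleftrightarrow> out K (w ! length u) = inc K v \<and>
      (\<forall>i<length u. out K (w ! i) = inc K (u ! i))"
    unfolding w chain_nth_aux by (auto simp: last_conv_nth)
  also have "\<dots> \<longleftrightarrow> (\<forall>i<Suc (length u). out K (w ! i) = inc K (w ! succ_pos w i))"
    by (auto simp: w succ_pos_eq All_less_Suc)
  finally show ?thesis by (simp add: w)
qed

lemma finite_labels [simp]: "finite (labels K w)"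
  by (simp add: labels_def)

lemma labels_append [simp]: "labels K (u @ v) = labels K u \<union> labels K v"
  by (auto simp: labels_def)

text \<open>The labels at a crossing are read off from the passage heading north: its outgoing and
  incoming edges separate the two northern and the two southern corners, and the left side of an
  edge is the western one.\<close>

definition region_labels :: "passage list \<Rightarrow> (nat \<times> bool \<Rightarrow> 'b) \<Rightarrow> nat \<Rightarrow> bool \<Rightarrow> bool \<Rightarrow> 'b" where
  "region_labels w f a n e =
     (let j = (THE j. j < length w \<and> crossing (w ! j) = a \<and> fr (w ! j))
      in f (if n then j else pred_pos w j, \<not> e))"

lemma region_labels_fr:
  assumes w: "gauss_word w" and i: "i < length w" "fr (w ! i)"
  shows "region_labels w f (crossing (w ! i)) n e = f (if n then i else pred_pos w i, \<not> e)"
proof -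
  have "(THE j. j < length w \<and> crossing (w ! j) = crossing (w ! i) \<and> fr (w ! j)) = i"
  proof (rule the_equality)
    fix j assume j: "j < length w \<and> crossing (w ! j) = crossing (w ! i) \<and> fr (w ! j)"
    then have "w ! j = w ! i"
      using gauss_word_same_crossing[OF w, of "w ! j" "w ! i"] i by auto
    then show "j = i"
      using j i gauss_word_distinct[OF w] by (simp add: nth_eq_iff_index_eq)
  qed (use i in auto)
  then show ?thesis by (simp add: region_labels_def)
qed

lemma region_labels_out_inc:
  assumes w: "gauss_word w" and f: "\<And>d. d \<in> darts w \<Longrightarrow> f (next_dart w d) = f d"
    and i: "i < length w"
  shows "out (region_labels w f) (w ! i) = (f (i, True), f (i, False))"
    "inc (region_labels w f) (w ! i) = (f (pred_pos w i, True), f (pred_pos w i, False))"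
proof (atomize (full), cases "fr (w ! i)")
  case True
  then show "out (region_labels w f) (w ! i) = (f (i, True), f (i, False)) \<and>
    inc (region_labels w f) (w ! i) = (f (pred_pos w i, True), f (pred_pos w i, False))"
    by (simp_all add: out_def inc_def region_labels_fr w i)
next
  case nf: False
  let ?k = "partner w i"
  have k: "?k < length w" "w ! ?k = bar (w ! i)" "partner w ?k = i"
    using partner[OF w i] partner_partner[OF w i] by auto
  have p: "pred_pos w i < length w" "pred_pos w ?k < length w"
    using i k pred_pos_less by auto
  have dm: "\<And>j b. j < length w \<Longrightarrow> (j, b) \<in> darts w" by (simp add: darts_def)
  \<comment> \<open>One equation for each of the four corners at the crossing: the dart arriving
    along one side of the corner turns left into the dart leaving along the other.\<close>
  have 1: "next_dart w (pred_pos w ?k, True) = (i, True)" "next_dart w (i, False) = (?k, True)"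
    "next_dart w (pred_pos w i, True) = (pred_pos w ?k, False)"
    "next_dart w (?k, False) = (pred_pos w i, False)"
    using nf k i by (auto simp: next_dart_alt dart_end_def Let_def)
  have 2: "f (i, True) = f (pred_pos w ?k, True)" "f (i, False) = f (?k, True)"
    "f (pred_pos w i, True) = f (pred_pos w ?k, False)" "f (pred_pos w i, False) = f (?k, False)"
    using f[OF dm, of "pred_pos w ?k" True] f[OF dm, of i False] f[OF dm, of "pred_pos w i" True]
      f[OF dm, of ?k False] p k i unfolding 1 by auto
  have kc: "region_labels w f (crossing (w ! i)) n e = f (if n then ?k else pred_pos w ?k, \<not> e)" for n e
    using region_labels_fr[OF w k(1), of f] nf k(2) by simp
  show "out (region_labels w f) (w ! i) = (f (i, True), f (i, False)) \<and>
    inc (region_labels w f) (w ! i) = (f (pred_pos w i, True), f (pred_pos w i, False))"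
    using nf 2 by (simp_all add: out_def inc_def kc)
qed

lemma labels_region_labels:
  assumes w: "gauss_word w" and f: "\<And>d. d \<in> darts w \<Longrightarrow> f (next_dart w d) = f d"
  shows "labels (region_labels w f) w = f ` darts w"
proof
  show "labels (region_labels w f) w \<subseteq> f ` darts w"
  proof
    fix x assume "x \<in> labels (region_labels w f) w"
    then obtain v n e where v: "v \<in> set w" and x: "x = region_labels w f (crossing v) n e"
      by (auto simp: labels_def)
    obtain u where "u \<in> set w" "crossing u = crossing v" "fr u"
      using v gauss_word_bar[OF w v] by (metis bar_simps(1,5))
    then obtain i where "i < length w" "fr (w ! i)" "crossing (w ! i) = crossing v"
      by (metis in_set_conv_nth)
    then show "x \<in> f ` darts w"
      using region_labels_fr[OF w, of i f n e] pred_pos_less[of i w] unfolding x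
      by (auto simp: darts_def)
  qed
next
  show "f ` darts w \<subseteq> labels (region_labels w f) w"
  proof
    fix x assume "x \<in> f ` darts w"
    then obtain i b where i: "i < length w" and x: "x = f (i, b)"
      by (auto simp: darts_def)
    have "x = (if b then fst else snd) (out (region_labels w f) (w ! i))"
      using region_labels_out_inc(1)[where f = f, OF w f i] x by simp
    then have "x \<in> range (case_prod (region_labels w f (crossing (w ! i))))"
      by (auto simp: out_def split: if_splits)
    then show "x \<in> labels (region_labels w f) w"
      using i by (auto simp: labels_def)
  qed
qed

lemma chain_region_labels:
  assumes w: "gauss_word w" "w \<noteq> []" and f: "\<And>d. d \<in> darts w \<Longrightarrow> f (next_dart w d) = f d"
  shows "\<exists>s. chain (region_labels w f) s w s"
  unfolding chain_cyclic_nth[OF w(2)]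
  by (auto simp: region_labels_out_inc[where f = f, OF w(1) f] succ_pos_less)

text \<open>The function \<open>f\<close> reads off the label on the left of a dart. Turning left at
  the end of a dart stays within one corner of the crossing, and a corner has only one
  label.\<close>

lemma chain_imp_invariant:
  assumes w: "gauss_word w" "w \<noteq> []" and c: "chain K s w s" and d: "d \<in> darts w"
  defines "f \<equiv> (\<lambda>(i, b). (if b then fst else snd) (out K (w ! i)))"
  shows "f (next_dart w d) = f d"
proof -
  have eq: "\<And>i. i < length w \<Longrightarrow> out K (w ! i) = inc K (w ! succ_pos w i)"
    using c chain_cyclic_nth[OF w(2), of K] by blast
  have fd: "f d = (if snd d = fr (w ! dart_end w d) then fst (out K (bar (w ! dart_end w d)))
     else snd (inc K (bar (w ! dart_end w d))))"
  proof (cases d)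
    case (Pair i b)
    then show ?thesis
      using d eq[of i] by (cases b) (auto simp: f_def dart_end_def darts_def, auto simp: inc_def out_def)
  qed
  have e: "dart_end w d < length w" using d by (auto simp: darts_def dart_end_def succ_pos_less)
  have k: "partner w (dart_end w d) < length w" "w ! partner w (dart_end w d) = bar (w ! dart_end w d)"
    using partner[OF w(1) e] by auto
  have "f (next_dart w d) = (if snd d = fr (w ! dart_end w d) then fst (out K (bar (w ! dart_end w d)))
     else snd (inc K (bar (w ! dart_end w d))))"
    using eq[of "pred_pos w (partner w (dart_end w d))"] k pred_pos_less[OF k(1)]
    by (auto simp: next_dart_alt Let_def f_def)
  with fd show ?thesis by simp
qed

lemma labels_chain:
  assumes w: "gauss_word w" "w \<noteq> []" and c: "chain K s w s"
  defines "f \<equiv> (\<lambda>(i, b). (if b then fst else snd) (out K (w ! i)))"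
  shows "labels K w \<subseteq> f ` darts w"
proof
  fix x assume "x \<in> labels K w"
  then obtain v n e where v: "v \<in> set w" and x: "x = K (crossing v) n e"
    by (auto simp: labels_def)
  have eq: "\<And>i. i < length w \<Longrightarrow> out K (w ! i) = inc K (w ! succ_pos w i)"
    using c chain_cyclic_nth[OF w(2), of K] by blast
  obtain u where "u \<in> set w" "crossing u = crossing v" "fr u"
    using v gauss_word_bar[OF w(1) v] by (metis bar_simps(1,5))
  then obtain i where i: "i < length w" "fr (w ! i)" "crossing (w ! i) = crossing v"
    by (metis in_set_conv_nth)
  have "x = f (if n then i else pred_pos w i, \<not> e)"
    using i eq[of "pred_pos w i"] pred_pos_less[OF i(1)] x
    by (auto simp: f_def out_def inc_def)
  then show "x \<in> f ` darts w"
    using i pred_pos_less[OF i(1)] by (auto simp: darts_def)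
qed

text \<open>A closed chain is constant along each face, so choosing a dart in every face maps the
  faces onto the labels.\<close>

lemma card_labels_le_faces:
  assumes w: "gauss_word w" "w \<noteq> []" and c: "chain K s w s"
  shows "card (labels K w) \<le> card (faces w)"
proof -
  define f where "f = (\<lambda>(i, b). (if b then fst else snd) (out K (w ! i)))"
  have inv: "f (next_dart w d) = f d" if "d \<in> darts w" for d
    using chain_imp_invariant[OF w c that] by (simp add: f_def)
  have const: "d' \<in> darts w \<and> f d' = f d" if "d \<in> darts w" "d' \<in> orbit (next_dart w) d" for d d'
    using that(2) by induction (auto simp: inv next_dart_in w that(1))
  have "labels K w \<subseteq> f ` darts w"
    using labels_chain[OF w c] by (simp add: f_def)
  also have "f ` darts w \<subseteq> (\<lambda>F. f (SOME d. d \<in> F)) ` faces w"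
  proof
    fix x assume "x \<in> f ` darts w"
    then obtain d where d: "d \<in> darts w" "x = f d" by auto
    have "(SOME d'. d' \<in> orbit (next_dart w) d) \<in> orbit (next_dart w) d"
      using self_in_orbit_next_dart[OF w(1) d(1)] by (rule someI)
    with const[OF d(1)] have "x = f (SOME d'. d' \<in> orbit (next_dart w) d)" using d by simp
    with d show "x \<in> (\<lambda>F. f (SOME d. d \<in> F)) ` faces w"
      unfolding faces_def by blast
  qed
  finally show ?thesis
    by (meson card_image_le card_mono finite_faces finite_imageI order_trans)
qed

text \<open>The bound of \<open>card_labels_le_faces\<close> is attained by labelling every region
  with itself, numbered to obtain natural numbers.\<close>

lemma ex_chain_faces:
  assumes w: "gauss_word w" "w \<noteq> []"
  obtains K :: "nat \<Rightarrow> bool \<Rightarrow> bool \<Rightarrow> nat" and s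
  where "chain K s w s" "card (labels K w) = card (faces w)"
proof -
  obtain g :: "(nat \<times> bool) set \<Rightarrow> nat" where g: "inj_on g (faces w)"
    using finite_imp_inj_to_nat_seg[OF finite_faces] by blast
  define f where "f d = g (orbit (next_dart w) d)" for d
  have f: "f (next_dart w d) = f d" if "d \<in> darts w" for d
    using that by (simp add: f_def orbit_next_dart w)
  have "f ` darts w = g ` faces w" by (auto simp: f_def faces_def)
  then have "card (labels (region_labels w f) w) = card (faces w)"
    using labels_region_labels[where f = f, OF w(1) f] card_image[OF g] by simp
  with chain_region_labels[where f = f, OF w f] that show thesis by blast
qed

section \<open>Flows across edges and jumps at crossings\<close>

definition eps :: "passage \<Rightarrow> int" where
  "eps v = (if fr v then 1 else - 1)"

lemma eps_bar [simp]: "eps (bar v) = - eps v"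
  by (simp add: eps_def)

definition flow :: "int \<times> int \<Rightarrow> int" where
  "flow s = fst s - snd s"

text \<open>The mixed second difference of the four corners: the flow on the northern edge minus the
  flow on the southern edge. For the strand heading west the same expression appears with the
  opposite sign, whence \<open>eps\<close> in \<open>flow_out\<close>.\<close>

definition jump :: "(nat \<Rightarrow> bool \<Rightarrow> bool \<Rightarrow> int) \<Rightarrow> nat \<Rightarrow> int" where
  "jump H a = H a True False - H a True True - H a False False + H a False True"

lemma flow_out: "flow (out H v) = flow (inc H v) + eps v * jump H (crossing v)"
  by (simp add: flow_def out_def inc_def eps_def jump_def)

lemma chain_comp: "chain K s w t \<Longrightarrow> chain (\<lambda>a n e. h (K a n e)) (map_prod h h s) w (map_prod h h t)"
proof (induction w arbitrary: s)
  case (Cons v w)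
  have *: "inc (\<lambda>a n e. h (K a n e)) v = map_prod h h (inc K v)" "out (\<lambda>a n e. h (K a n e)) v = map_prod h h (out K v)"
    by (auto simp: inc_def out_def)
  show ?case using Cons by (simp add: *)
qed simp

lemma card_crossings:
  assumes w: "gauss_word w"
  shows "length w = 2 * card (crossing ` set w)"
proof -
  have *: "card {v\<in>set w. over v = b} = card (crossing ` set w)" for b
  proof (rule bij_betw_same_card[of crossing], unfold bij_betw_def, intro conjI)
    show "inj_on crossing {v \<in> set w. over v = b}"
      by (auto intro!: inj_onI dest: gauss_word_same_crossing[OF w])
    show "crossing ` {v \<in> set w. over v = b} = crossing ` set w"
    proof (intro equalityI subsetI)
      fix a assume "a \<in> crossing ` set w"
      then obtain v where v: "v \<in> set w" "a = crossing v" by auto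
      then have "(if over v = b then v else bar v) \<in> {v \<in> set w. over v = b}"
        using gauss_word_bar[OF w] by auto
      moreover have "a = crossing (if over v = b then v else bar v)" using v by auto
      ultimately show "a \<in> crossing ` {v \<in> set w. over v = b}" by (rule rev_image_eqI)
    qed auto
  qed
  have "{v\<in>set w. over v = True} \<union> {v\<in>set w. over v = False} = set w" by auto
  moreover have "card ({v\<in>set w. over v = True} \<union> {v\<in>set w. over v = False}) =
      card {v\<in>set w. over v = True} + card {v\<in>set w. over v = False}"
    by (rule card_Un_disjoint) auto
  ultimately show ?thesis
    using distinct_card[OF gauss_word_distinct[OF w]] *[of True] *[of False] by (metis mult_2)
qed

lemma chain_flow_dvd:
  assumes "chain H s w t" "m dvd flow s" "\<And>v. v \<in> set w \<Longrightarrow> m dvd jump H (crossing v)"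
  shows "\<forall>v\<in>set w. m dvd flow (inc H v) \<and> m dvd flow (out H v)"
  using assms
proof (induction w arbitrary: s)
  case (Cons v w)
  have "m dvd flow (out H v)" using Cons.prems by (simp add: flow_out)
  with Cons.IH[of "out H v"] Cons.prems show ?case by auto
qed simp

lemma chain_fst_dvd:
  fixes m :: int
  assumes "chain H s w t" "\<And>v. v \<in> set w \<Longrightarrow> m dvd fst (out H v) - fst (inc H v)"
  shows "\<forall>v\<in>set w. m dvd fst (inc H v) - fst s \<and> m dvd fst (out H v) - fst s"
  using assms
proof (induction w arbitrary: s)
  case (Cons v w)
  have IH: "\<forall>u\<in>set w. m dvd fst (inc H u) - fst (out H v) \<and> m dvd fst (out H u) - fst (out H v)"
    using Cons by simp
  have v: "m dvd fst (out H v) - fst (inc H v)" "s = inc H v" using Cons.prems by auto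
  have "m dvd x - fst s" if "m dvd x - fst (out H v)" for x
    using dvd_add[OF that v(1)] v(2) by (simp add: algebra_simps)
  with IH v show ?case by auto
qed simp

text \<open>Without jumps, a flow that vanishes once vanishes along the whole knot. Then labels on
  the two sides of every edge agree modulo \<open>m\<close>, and passing a crossing changes the left
  label only by the flow across the other strand.\<close>

lemma chain_zero_dvd:
  assumes w: "gauss_word w" and c: "chain H s w s" and s: "m dvd flow s"
    and j: "\<And>v. v \<in> set w \<Longrightarrow> m dvd jump H (crossing v)" and v: "v \<in> set w"
  shows "m dvd H (crossing v) n e - fst s"
proof -
  have f: "m dvd flow (inc H u)" "m dvd flow (out H u)" if "u \<in> set w" for u
    using chain_flow_dvd[OF c s j] that by auto
  have d: "m dvd fst (out H u) - fst (inc H u)" if u: "u \<in> set w" for u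
  proof (cases "fr u")
    case True
    have "m dvd - flow (out H (bar u))" using f(2) gauss_word_bar[OF w u] by simp
    then show ?thesis using True by (simp add: flow_def out_def inc_def)
  next
    case False
    have "m dvd flow (inc H (bar u))" using f(1) gauss_word_bar[OF w u] by simp
    then show ?thesis using False by (simp add: flow_def out_def inc_def)
  qed
  have *: "m dvd fst (inc H u) - fst s" "m dvd fst (out H u) - fst s" if "u \<in> set w" for u
    using chain_fst_dvd[OF c d] that by auto
  have **: "m dvd snd (inc H u) - fst s" "m dvd snd (out H u) - fst s" if "u \<in> set w" for u
    using dvd_diff[OF *(1)[OF that] f(1)[OF that]] dvd_diff[OF *(2)[OF that] f(2)[OF that]]
    by (simp_all add: flow_def)
  obtain u where u: "u \<in> set w" "fr u" "crossing u = crossing v"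
    using v gauss_word_bar[OF w v] by (metis bar_simps(1,5))
  show ?thesis
    using *[OF u(1)] **[OF u(1)] u(2,3) by (cases n; cases e) (auto simp: inc_def out_def)
qed

text \<open>Functions on the labels are normalised to be zero at \<open>l\<close>, which removes the
  freedom of adding constants. \<open>None\<close> indexes the initial flow and
  \<open>Some a\<close> the jump at the crossing \<open>a\<close>.\<close>

lemma flow_determines_labels:
  fixes K :: "nat \<Rightarrow> bool \<Rightarrow> bool \<Rightarrow> 'b" and m :: int
  assumes w: "gauss_word w" and c: "chain K s w s" and l: "l \<in> labels K w" and m: "m > 0"
  defines "C \<equiv> insert None (Some ` crossing ` set w)"
  defines "H \<equiv> \<lambda>h a n e. (h(l := 0)) (K a n e)"
  defines "G \<equiv> \<lambda>h. restrict (case_option (flow (map_prod (h(l := 0)) (h(l := 0)) s) mod m) (\<lambda>a. jump (H h) a mod m)) C"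
  shows "inj_on G (PiE (labels K w - {l}) (\<lambda>_. {0..<m}))"
    and "G ` PiE (labels K w - {l}) (\<lambda>_. {0..<m}) \<subseteq> PiE C (\<lambda>_. {0..<m})"
proof -
  show "inj_on G (PiE (labels K w - {l}) (\<lambda>_. {0..<m}))"
  proof (rule inj_onI)
    fix h h' :: "'b \<Rightarrow> int"
    assume h: "h \<in> PiE (labels K w - {l}) (\<lambda>_. {0..<m})" "h' \<in> PiE (labels K w - {l}) (\<lambda>_. {0..<m})"
      and eq: "G h = G h'"
    \<comment> \<open>By linearity the difference of the two functions has zero flow and zero jumps
      modulo \<open>m\<close>, hence is constant; its value at \<open>l\<close> is zero.\<close>
    define g where "g x = (h(l := 0)) x - (h'(l := 0)) x" for x
    define H' where "H' a n e = g (K a n e)" for a n e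
    have c': "chain H' (map_prod g g s) w (map_prod g g s)"
      unfolding H'_def using chain_comp[OF c] .
    have e1: "flow (map_prod (h(l := 0)) (h(l := 0)) s) mod m = flow (map_prod (h'(l := 0)) (h'(l := 0)) s) mod m"
      using fun_cong[OF eq, of None] by (simp add: G_def C_def)
    then have d1: "m dvd flow (map_prod g g s)"
      by (simp add: mod_eq_dvd_iff flow_def g_def algebra_simps split: if_splits)
    have d2: "m dvd jump H' (crossing v)" if "v \<in> set w" for v
    proof -
      have "jump (H h) (crossing v) mod m = jump (H h') (crossing v) mod m"
        using fun_cong[OF eq, of "Some (crossing v)"] that by (simp add: G_def C_def)
      then have "m dvd jump (H h) (crossing v) - jump (H h') (crossing v)"
        by (simp add: mod_eq_dvd_iff)
      also have "jump (H h) (crossing v) - jump (H h') (crossing v) = jump H' (crossing v)"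
        by (simp add: jump_def H'_def g_def H_def)
      finally show ?thesis .
    qed
    have all: "m dvd g x - fst (map_prod g g s)" if "x \<in> labels K w" for x
      using that chain_zero_dvd[OF w c' d1 d2] by (auto simp: labels_def H'_def)
    have "m dvd g x" if "x \<in> labels K w" for x
      using dvd_diff[OF all[OF that] all[OF l]] by (simp add: g_def)
    then have "h x = h' x" if "x \<in> labels K w - {l}" for x
    proof -
      have "m dvd h x - h' x" using \<open>\<And>x. x \<in> labels K w \<Longrightarrow> m dvd g x\<close>[of x] that by (simp add: g_def)
      moreover have "h x \<in> {0..<m}" "h' x \<in> {0..<m}" using h that by blast+
      ultimately show ?thesis by (simp add: mod_eq_dvd_iff[symmetric])
    qed
    then show "h = h'" by (rule PiE_ext[OF h])
  qed
  show "G ` PiE (labels K w - {l}) (\<lambda>_. {0..<m}) \<subseteq> PiE C (\<lambda>_. {0..<m})"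
  proof (rule image_subsetI)
    fix h
    show "G h \<in> PiE C (\<lambda>_. {0..<m})"
      unfolding G_def restrict_PiE_iff using m by (auto split: option.split)
  qed
qed

lemma card_flow_index:
  assumes "gauss_word w"
  shows "card (insert None (Some ` crossing ` set w)) = length w div 2 + 1"
proof -
  have 1: "card (Some ` crossing ` set w) = card (crossing ` set w)"
    by (rule card_image) simp
  have "None \<notin> Some ` crossing ` set w" by blast
  then have "card (insert None (Some ` crossing ` set w)) = Suc (card (crossing ` set w))"
    unfolding 1[symmetric] by (intro card_insert_disjoint finite_imageI List.finite_set)
  then show ?thesis
    using card_crossings[OF assms] by linarith
qed

text \<open>For \<open>m = 2\<close> the injection compares \<open>2 ^ (labels - 1)\<close> with
  \<open>2 ^ (crossings + 1)\<close>. This is the inequality in Euler's formula that holds on every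
  closed surface.\<close>

lemma card_labels_le:
  assumes w: "gauss_word w" "w \<noteq> []" and c: "chain K s w s"
  shows "card (labels K w) \<le> length w div 2 + 2"
proof -
  obtain v where "v \<in> set w" using w(2) by (cases w) auto
  then obtain l where l: "l \<in> labels K w" by (auto simp: labels_def)
  let ?P = "PiE (labels K w - {l}) (\<lambda>_. {0..<2::int})"
  let ?Q = "PiE (insert None (Some ` crossing ` set w)) (\<lambda>_. {0..<2::int})"
  have "card ?P \<le> card ?Q"
    using flow_determines_labels[OF w(1) c l, of 2] by (intro card_inj_on_le) (auto intro: finite_PiE)
  moreover have "card ?P = 2 ^ (card (labels K w) - 1)" using l by (simp add: card_PiE)
  moreover have "card ?Q = 2 ^ (length w div 2 + 1)"
    using card_flow_index[OF w(1)] by (subst card_PiE) auto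
  ultimately have "(2::nat) ^ (card (labels K w) - 1) \<le> 2 ^ (length w div 2 + 1)"
    by (simp only:)
  then have "card (labels K w) - 1 \<le> length w div 2 + 1"
    by (rule power_le_imp_le_exp[rotated]) simp
  then show ?thesis by simp
qed

text \<open>A closed chain with sufficiently many labels certifies planarity; this is how moves are shown to
  preserve it.\<close>

lemma planar_iff:
  assumes w: "gauss_word w" "w \<noteq> []"
  shows "planar w \<longleftrightarrow> (\<exists>(K :: nat \<Rightarrow> bool \<Rightarrow> bool \<Rightarrow> nat) s. chain K s w s \<and> length w div 2 + 2 \<le> card (labels K w))"
proof
  assume "planar w"
  then show "\<exists>(K :: nat \<Rightarrow> bool \<Rightarrow> bool \<Rightarrow> nat) s. chain K s w s \<and> length w div 2 + 2 \<le> card (labels K w)"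
    using w ex_chain_faces[OF w] by (metis order_refl planar_def)
next
  assume "\<exists>(K :: nat \<Rightarrow> bool \<Rightarrow> bool \<Rightarrow> nat) s. chain K s w s \<and> length w div 2 + 2 \<le> card (labels K w)"
  then have "length w div 2 + 2 \<le> card (faces w)"
    using card_labels_le_faces[OF w] by (meson order_trans)
  moreover have "card (faces w) \<le> length w div 2 + 2"
    using ex_chain_faces[OF w] card_labels_le[OF w] by metis
  ultimately show "planar w" by (simp add: planar_def)
qed

lemma planarI:
  fixes K :: "nat \<Rightarrow> bool \<Rightarrow> bool \<Rightarrow> nat"
  assumes "gauss_word w" "chain K s w s" "length w div 2 + 2 \<le> card (labels K w)"
  shows "planar w"
proof (cases "w = []")
  case False
  show ?thesis
    unfolding planar_iff[OF assms(1) False] by (intro exI conjI) (rule assms(2), rule assms(3))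
qed (simp add: planar_def)

lemma planarE:
  assumes "gauss_word w" "planar w" "w \<noteq> []"
  obtains K :: "nat \<Rightarrow> bool \<Rightarrow> bool \<Rightarrow> nat" and s
  where "chain K s w s" "card (labels K w) = length w div 2 + 2"
proof -
  obtain K :: "nat \<Rightarrow> bool \<Rightarrow> bool \<Rightarrow> nat" and s
    where K: "chain K s w s" "length w div 2 + 2 \<le> card (labels K w)"
    using assms(2) unfolding planar_iff[OF assms(1,3)] by (elim exE conjE)
  then have "card (labels K w) = length w div 2 + 2"
    using card_labels_le[OF assms(1,3) K(1)] by simp
  with K(1) show thesis by (rule that)
qed

text \<open>In the planar case the injection of \<open>flow_determines_labels\<close> goes between
  finite sets of equal size and is therefore onto. Topologically, this is the vanishing of the first
  cohomology of the sphere.\<close>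

lemma ex_flow:
  fixes m :: int
  assumes w: "gauss_word w" "planar w" "w \<noteq> []" and m: "m > 0"
  obtains H :: "nat \<Rightarrow> bool \<Rightarrow> bool \<Rightarrow> int" and s
  where "chain H s w s" "flow s mod m = f mod m"
    "\<And>a. a \<in> crossing ` set w \<Longrightarrow> jump H a mod m = j a mod m"
proof -
  obtain K :: "nat \<Rightarrow> bool \<Rightarrow> bool \<Rightarrow> nat" and s
    where K: "chain K s w s" "card (labels K w) = length w div 2 + 2"
    using planarE[OF w] .
  obtain v where "v \<in> set w" using w(3) by (cases w) auto
  then obtain l where l: "l \<in> labels K w" by (auto simp: labels_def)
  let ?P = "PiE (labels K w - {l}) (\<lambda>_. {0..<m})"
  let ?C = "insert None (Some ` crossing ` set w)"
  let ?Q = "PiE ?C (\<lambda>_. {0..<m})"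
  let ?G = "\<lambda>h. restrict (case_option (flow (map_prod (h(l := 0)) (h(l := 0)) s) mod m)
     (\<lambda>a. jump (\<lambda>a n e. (h(l := 0)) (K a n e)) a mod m)) ?C"
  have inj: "inj_on ?G ?P" and sub: "?G ` ?P \<subseteq> ?Q"
    using flow_determines_labels[OF w(1) K(1) l m] by auto
  have fin: "finite ?Q" by (intro finite_PiE) auto
  have "card ?P = nat m ^ (length w div 2 + 1)" using l K(2) by (simp add: card_PiE)
  moreover have "card ?Q = nat m ^ (length w div 2 + 1)"
    using card_flow_index[OF w(1)] by (subst card_PiE) auto
  ultimately have "?G ` ?P = ?Q"
    by (intro card_subset_eq[OF fin sub]) (simp only: card_image[OF inj])
  moreover have "restrict (case_option (f mod m) (\<lambda>a. j a mod m)) ?C \<in> ?Q"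
    unfolding restrict_PiE_iff using m by (auto split: option.split)
  ultimately have "restrict (case_option (f mod m) (\<lambda>a. j a mod m)) ?C \<in> ?G ` ?P"
    by (simp only:)
  then obtain h where h: "restrict (case_option (f mod m) (\<lambda>a. j a mod m)) ?C = ?G h"
    by (rule imageE)
  let ?H = "\<lambda>a n e. (h(l := 0)) (K a n e)"
  show thesis
  proof
    show "chain ?H (map_prod (h(l := 0)) (h(l := 0)) s) w (map_prod (h(l := 0)) (h(l := 0)) s)"
      by (rule chain_comp[OF K(1)])
    show "flow (map_prod (h(l := 0)) (h(l := 0)) s) mod m = f mod m"
      using fun_cong[OF h[symmetric], of None] by simp
    show "jump ?H a mod m = j a mod m" if "a \<in> crossing ` set w" for a
      using fun_cong[OF h[symmetric], of "Some a"] that by simp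
  qed
qed

section \<open>Index identities\<close>

definition knot_word :: "passage list \<Rightarrow> bool" where
  "knot_word w \<longleftrightarrow> gauss_word w \<and> planar w"

lemma knot_wordD:
  assumes "knot_word w"
  shows "gauss_word w" "planar w" "distinct w"
  using assms gauss_word_distinct[of w] by (simp_all add: knot_word_def)

text \<open>The algebraic number of times the strand \<open>U\<close> crosses strands with passages in \<open>A\<close>.\<close>

definition lk :: "passage list \<Rightarrow> passage set \<Rightarrow> int" where
  "lk U A = (\<Sum>x\<leftarrow>U. if bar x \<in> A then eps x else 0)"

lemma lk_Nil [simp]: "lk [] A = 0" and lk_append [simp]: "lk (U @ V) A = lk U A + lk V A"
  and lk_Cons: "lk (x # U) A = (if bar x \<in> A then eps x else 0) + lk U A"
  by (simp_all add: lk_def)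

text \<open>Potentials are available modulo every positive \<open>m\<close> only; this turns the
  resulting congruences into identities of integers.\<close>

lemma eq_0_if_all_dvd: "(\<And>m::int. m > 0 \<Longrightarrow> m dvd x) \<Longrightarrow> x = 0"
  using zdvd_imp_le[of "\<bar>x\<bar> + 1" "\<bar>x\<bar>"] by fastforce

lemma chain_flow_const:
  fixes m :: int
  assumes "chain H s w t" "m dvd flow s - c" "\<And>v. v \<in> set w \<Longrightarrow> m dvd jump H (crossing v)"
  shows "m dvd flow t - c \<and> (\<forall>v\<in>set w. m dvd flow (inc H v) - c \<and> m dvd flow (out H v) - c)"
  using assms
proof (induction w arbitrary: s)
  case (Cons v w)
  have "flow (out H v) - c = (flow (inc H v) - c) + eps v * jump H (crossing v)"
    by (simp add: flow_out)
  moreover have "m dvd (flow (inc H v) - c) + eps v * jump H (crossing v)"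
    using Cons.prems by (intro dvd_add dvd_mult) auto
  ultimately have "m dvd flow (out H v) - c"
    by (simp only: flow_out)
  with Cons.IH[of "out H v"] Cons.prems show ?case by auto
qed simp

text \<open>A function on the regions whose values on the two sides of an edge differ by \<open>1\<close> on the loop \<open>S\<close>
  at the crossing of \<open>v\<close>, and agree elsewhere (modulo \<open>m\<close>).\<close>

lemma loop_potential:
  fixes m :: int
  assumes w: "knot_word w" "w = v # S @ bar v # R" and m: "m > 0"
  shows "\<exists>H. (\<exists>s. chain H s w s) \<and>
    (\<forall>x\<in>set S. m dvd flow (inc H x) - 1 \<and> m dvd flow (out H x) - 1) \<and>
    (\<forall>x\<in>set R. m dvd flow (inc H x) \<and> m dvd flow (out H x)) \<and> m dvd flow (inc H v)"
proof -
  have g: "gauss_word w" "planar w" "w \<noteq> []" using w by (auto simp: knot_word_def)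
  \<comment> \<open>The potential is the winding number around the loop \<open>S\<close>, closed at
    its crossing: \<open>eps v * eps v = 1\<close> raises the flow to one at \<open>v\<close>, and
    the opposite sign of \<open>bar v\<close> brings it back to zero.\<close>
  obtain H s where H: "chain H s w s" "flow s mod m = 0 mod m"
    "\<And>a. a \<in> crossing ` set w \<Longrightarrow> jump H a mod m = (if a = crossing v then eps v else 0) mod m"
    using ex_flow[OF g m, of 0 "\<lambda>a. if a = crossing v then eps v else 0"] by blast
  have d: "distinct w" using gauss_word_distinct g(1) by blast
  have other: "crossing x \<noteq> crossing v" if "x \<in> set S \<union> set R" for x
    using gauss_word_same_crossing[OF g(1), of x v] that d w(2) by auto
  have j0: "m dvd jump H (crossing x)" if "x \<in> set S \<union> set R" for x
    using H(3)[of "crossing x"] other[OF that] that w(2) by (auto simp: mod_eq_0_iff_dvd)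
  have jv: "m dvd jump H (crossing v) - eps v"
    using H(3)[of "crossing v"] w(2) by (simp add: mod_eq_dvd_iff)
  have s0: "m dvd flow s" using H(2) by (simp add: mod_eq_0_iff_dvd)
  obtain t where c: "s = inc H v" "chain H (out H v) S t" "t = inc H (bar v)" "chain H (out H (bar v)) R s"
    using H(1) unfolding w(2) by (auto simp: chain_append)
  have e2: "eps v * eps v = 1" by (simp add: eps_def)
  have 1: "flow (out H v) - 1 = flow s + eps v * (jump H (crossing v) - eps v)"
    using c(1) e2 by (simp add: flow_out algebra_simps)
  have "m dvd flow (out H v) - 1" unfolding 1 by (intro dvd_add dvd_mult s0 jv)
  note S = chain_flow_const[OF c(2) this j0]
  then have t1: "m dvd flow t - 1" by auto
  have 2: "flow (out H (bar v)) - 0 = (flow t - 1) - eps v * (jump H (crossing v) - eps v)"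
    using c(3) e2 by (simp add: flow_out algebra_simps)
  have "m dvd flow (out H (bar v)) - 0" unfolding 2 by (intro dvd_diff dvd_mult t1 jv)
  note R = chain_flow_const[OF c(4) this j0]
  show ?thesis
  proof (intro exI[of _ H] conjI)
    show "\<exists>s. chain H s w s" using H(1) by (rule exI)
  qed (use S R s0 c(1) in auto)
qed

definition side :: "bool \<Rightarrow> 'b \<times> 'b \<Rightarrow> 'b" where
  "side b s = (if b then snd s else fst s)"

text \<open>A loop that leaves a crossing with \<open>u\<close> returns to it from the side
  \<open>fr u\<close> (\<open>True\<close> being the right), so there its first and its last edge
  bound the same corner.\<close>

lemma side_corner: "side (fr u) (out H u) = side (fr u) (inc H (bar u))"
  by (simp add: side_def out_def inc_def)

text \<open>Passing \<open>x\<close> means crossing the other strand, so the label changes by the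
  flow of that strand. On the side \<open>fr x\<close>, from which the other strand arrives, its
  incoming edge is the one crossed; on the opposite side it is the outgoing edge.\<close>

lemma side_step:
  "side b (out H x) - side b (inc H x) =
    - eps x * (if b = fr x then flow (inc H (bar x)) else flow (out H (bar x)))"
  by (auto simp: side_def out_def inc_def flow_def eps_def)

lemma chain_side:
  fixes m :: int
  assumes "chain H s U t"
    and "\<And>x. x \<in> set U \<Longrightarrow> m dvd flow (inc H (bar x)) - of_bool (bar x \<in> A) \<and>
       m dvd flow (out H (bar x)) - of_bool (bar x \<in> A)"
  shows "m dvd side b t - side b s + lk U A"
  using assms
proof (induction U arbitrary: s)
  case (Cons x U)
  let ?f = "if b = fr x then flow (inc H (bar x)) else flow (out H (bar x))"
  have IH: "m dvd side b t - side b (out H x) + lk U A" using Cons by simp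
  have "m dvd ?f - of_bool (bar x \<in> A)" using Cons.prems(2)[of x] by simp
  then have "m dvd - eps x * (?f - of_bool (bar x \<in> A))" by (rule dvd_mult)
  with IH have "m dvd side b t - side b (out H x) + lk U A + - eps x * (?f - of_bool (bar x \<in> A))"
    by (rule dvd_add)
  also have "\<dots> = side b t - side b s + lk (x # U) A"
    using Cons.prems(1) side_step[of b H x] by (simp add: lk_Cons algebra_simps)
  finally show ?case .
qed simp

text \<open>The rest \<open>R\<close> of the knot is a loop as well, from \<open>bar v\<close> back
  to \<open>v\<close>. It starts and ends in the same corner, and each of its crossings with
  \<open>S\<close> changes the winding number around \<open>S\<close> by \<open>eps\<close>, so the
  changes add up to zero.\<close>

lemma loop_index:
  assumes w: "knot_word (v # S @ bar v # R)"
  shows "lk R (set S) = 0"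
proof (rule eq_0_if_all_dvd)
  fix m :: int assume "m > 0"
  let ?w = "v # S @ bar v # R"
  have g: "gauss_word ?w" "distinct ?w" by (rule knot_wordD[OF w])+
  obtain H where H: "\<exists>s. chain H s ?w s"
    "\<And>x. x \<in> set S \<Longrightarrow> m dvd flow (inc H x) - 1 \<and> m dvd flow (out H x) - 1"
    "\<And>x. x \<in> set R \<Longrightarrow> m dvd flow (inc H x) \<and> m dvd flow (out H x)"
    "m dvd flow (inc H v)"
    using loop_potential[OF w refl \<open>m > 0\<close>] by meson
  have c: "chain H (out H (bar v)) R (inc H v)" using H(1) by (auto simp: chain_append)
  have "m dvd side (fr (bar v)) (inc H v) - side (fr (bar v)) (out H (bar v)) + lk R (set S)"
  proof (rule chain_side[OF c])
    fix x assume x: "x \<in> set R"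
    have "bar x \<in> set ?w" using gauss_word_bar[OF g(1), of x] x by simp
    moreover have "bar x \<noteq> v" "bar x \<noteq> bar v" using g(2) x by auto
    ultimately consider "bar x \<in> set S" | "bar x \<in> set R" "bar x \<notin> set S" using g(2) by auto
    then show "m dvd flow (inc H (bar x)) - of_bool (bar x \<in> set S) \<and>
       m dvd flow (out H (bar x)) - of_bool (bar x \<in> set S)"
      by cases (use H in auto)
  qed
  then show "m dvd lk R (set S)" using side_corner[of "bar v" H] by simp
qed

text \<open>Two closed curves on the sphere without a common corner point have algebraic
  intersection number zero; again the winding number around one is followed along the other.\<close>

lemma disjoint_loops_index:
  assumes w: "knot_word (v # S @ bar v # R1 @ u # S' @ bar u # R2)"
  shows "lk S' (set S) = 0"
proof (rule eq_0_if_all_dvd)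
  fix m :: int assume "m > 0"
  let ?R = "R1 @ u # S' @ bar u # R2"
  let ?w = "v # S @ bar v # ?R"
  have g: "gauss_word ?w" "distinct ?w" by (rule knot_wordD[OF w])+
  obtain H where H: "\<exists>s. chain H s ?w s"
    "\<And>x. x \<in> set S \<Longrightarrow> m dvd flow (inc H x) - 1 \<and> m dvd flow (out H x) - 1"
    "\<And>x. x \<in> set ?R \<Longrightarrow> m dvd flow (inc H x) \<and> m dvd flow (out H x)"
    "m dvd flow (inc H v)"
    using loop_potential[OF w refl \<open>m > 0\<close>] by meson
  have c: "chain H (out H u) S' (inc H (bar u))" using H(1) by (auto simp: chain_append)
  have "m dvd side (fr u) (inc H (bar u)) - side (fr u) (out H u) + lk S' (set S)"
  proof (rule chain_side[OF c])
    fix x assume x: "x \<in> set S'"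
    have "bar x \<in> set ?w" using gauss_word_bar[OF g(1), of x] x by simp
    moreover have "bar x \<noteq> v" "bar x \<noteq> bar v" using g(2) x by auto
    ultimately consider "bar x \<in> set S" | "bar x \<in> set ?R" "bar x \<notin> set S" using g(2) by auto
    then show "m dvd flow (inc H (bar x)) - of_bool (bar x \<in> set S) \<and>
       m dvd flow (out H (bar x)) - of_bool (bar x \<in> set S)"
      by cases (use H in auto)
  qed
  then show "m dvd lk S' (set S)" using side_corner[of u H] by simp
qed

text \<open>The two loops share the arc \<open>Q\<close> and cross each other at \<open>v\<close>.
  The condition on \<open>fr\<close> ensures that beside the second loop, on the side where it
  closes up at \<open>u\<close>, passing \<open>bar v\<close> does not change the winding
  number.\<close>

lemma crossed_loops_index:
  assumes w: "knot_word (v # P @ u # Q @ bar v # R @ bar u # T)" and uv: "fr u \<noteq> fr v"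
  shows "lk (Q @ R) (set (P @ Q)) = 0"
proof (rule eq_0_if_all_dvd)
  fix m :: int assume "m > 0"
  let ?S = "P @ u # Q" and ?R = "R @ bar u # T"
  have w': "knot_word (v # ?S @ bar v # ?R)" using w by simp
  let ?w = "v # ?S @ bar v # ?R"
  have g: "gauss_word ?w" "distinct ?w" by (rule knot_wordD[OF w'])+
  obtain H where H: "\<exists>s. chain H s ?w s"
    "\<And>x. x \<in> set ?S \<Longrightarrow> m dvd flow (inc H x) - 1 \<and> m dvd flow (out H x) - 1"
    "\<And>x. x \<in> set ?R \<Longrightarrow> m dvd flow (inc H x) \<and> m dvd flow (out H x)"
    "m dvd flow (inc H v)"
    using loop_potential[OF w' refl \<open>m > 0\<close>] by meson
  have c: "chain H (out H u) Q (inc H (bar v))" "chain H (out H (bar v)) R (inc H (bar u))"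
    using H(1) by (auto simp: chain_append)
  have *: "m dvd flow (inc H (bar x)) - of_bool (bar x \<in> set ?S) \<and>
       m dvd flow (out H (bar x)) - of_bool (bar x \<in> set ?S)" if x: "x \<in> set (Q @ R)" for x
  proof -
    have "bar x \<in> set ?w" using gauss_word_bar[OF g(1), of x] x by auto
    moreover have "bar x \<noteq> v" "bar x \<noteq> bar v" using g(2) x by auto
    ultimately consider "bar x \<in> set ?S" | "bar x \<in> set ?R" "bar x \<notin> set ?S" using g(2) by auto
    then show ?thesis by cases (use H in auto)
  qed
  have 1: "m dvd side (fr u) (inc H (bar v)) - side (fr u) (out H u) + lk Q (set ?S)"
    by (rule chain_side[OF c(1)]) (use * in auto)
  have 2: "m dvd side (fr u) (inc H (bar u)) - side (fr u) (out H (bar v)) + lk R (set ?S)"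
    by (rule chain_side[OF c(2)]) (use * in auto)
  \<comment> \<open>As \<open>fr u = fr (bar v)\<close>, the edge crossed here is the one leading to
    \<open>v\<close>, which lies outside the first loop and has flow zero.\<close>
  have "side (fr u) (out H (bar v)) - side (fr u) (inc H (bar v)) = eps v * flow (inc H v)"
    using side_step[of "fr u" H "bar v"] uv by simp
  then have "m dvd side (fr u) (out H (bar v)) - side (fr u) (inc H (bar v))"
    using H(4) by simp
  from dvd_add[OF dvd_add[OF 1 2] this] have "m dvd lk Q (set ?S) + lk R (set ?S)"
    using side_corner[of u H] by (simp add: algebra_simps)
  \<comment> \<open>The letter \<open>u\<close> may be dropped from the set: its partner lies in
    neither \<open>Q\<close> nor \<open>R\<close>.\<close>
  also have "lk Q (set ?S) = lk Q (set (P @ Q))"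
    unfolding lk_def by (rule arg_cong[where f = sum_list], rule map_cong) (use g(2) in auto)
  also have "lk R (set ?S) = lk R (set (P @ Q))"
    unfolding lk_def by (rule arg_cong[where f = sum_list], rule map_cong) (use g(2) in auto)
  finally show "m dvd lk (Q @ R) (set (P @ Q))" by simp
qed

section \<open>Reidemeister moves on words\<close>

definition same_knot :: "passage list \<Rightarrow> passage list \<Rightarrow> bool" where
  "same_knot w w' \<longleftrightarrow> knot_word w \<and> knot_word w' \<and> knot_of (Diagram w) = knot_of (Diagram w')"

lemma word_Diagram: "knot_word w \<Longrightarrow> word (Diagram w) = w"
  by (simp add: Diagram_inverse knot_word_def)

lemma knot_word_word [simp]: "knot_word (word D)"
  using word[of D] by (simp add: knot_word_def)

lemma same_knot_refl: "knot_word w \<Longrightarrow> same_knot w w"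
  by (simp add: same_knot_def)

lemma same_knot_sym: "same_knot w w' \<Longrightarrow> same_knot w' w"
  by (simp add: same_knot_def)

lemma same_knot_trans [trans]: "same_knot u v \<Longrightarrow> same_knot v w \<Longrightarrow> same_knot u w"
  by (simp add: same_knot_def)

lemma same_knot_step:
  assumes "knot_word w" "knot_word w'" "word_step w w'"
  shows "same_knot w w'"
proof -
  have "diagram_step (Diagram w) (Diagram w')"
    using assms by (simp add: diagram_step_def word_Diagram)
  then have "equivclp diagram_step (Diagram w) (Diagram w')"
    by (rule r_into_equivclp)
  then have "knot_of (Diagram w) = knot_of (Diagram w')"
    by (simp add: knot.abs_eq_iff)
  with assms show ?thesis by (simp add: same_knot_def)
qed

lemma gauss_word_perm: "gauss_word w \<Longrightarrow> distinct w' \<Longrightarrow> set w' = set w \<Longrightarrow> gauss_word w'"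
  by (simp add: gauss_word_iff)

lemma labels_cong_set: "set w = set w' \<Longrightarrow> labels K w = labels K w'"
  by (simp add: labels_def)

lemma knot_wordI:
  fixes K :: "nat \<Rightarrow> bool \<Rightarrow> bool \<Rightarrow> nat"
  assumes "gauss_word w" "chain K s w s" "length w div 2 + 2 \<le> card (labels K w)"
  shows "knot_word w"
  using planarI[OF assms] assms(1) by (simp add: knot_word_def)

lemma knot_word_chain:
  assumes w: "knot_word w" "w \<noteq> []"
  shows "\<exists>(K :: nat \<Rightarrow> bool \<Rightarrow> bool \<Rightarrow> nat) s. chain K s w s \<and> card (labels K w) = length w div 2 + 2"
  by (rule planarE[OF knot_wordD(1,2)[OF w(1)] w(2)], intro exI conjI)

lemma knot_word_rotate1:
  assumes w: "knot_word w"
  shows "knot_word (rotate1 w)"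
proof (cases w)
  case (Cons v u)
  then have ne: "w \<noteq> []" by simp
  obtain K :: "nat \<Rightarrow> bool \<Rightarrow> bool \<Rightarrow> nat" and s where K: "chain K s w s" "card (labels K w) = length w div 2 + 2"
    using knot_word_chain[OF w ne] by (elim exE conjE)
  show ?thesis
  proof (rule knot_wordI)
    show "gauss_word (rotate1 w)"
      using knot_wordD[OF w] by (simp add: gauss_word_perm[of w])
    show "chain K (out K v) (rotate1 w) (out K v)"
      unfolding Cons rotate1.simps chain_append
      using K(1) by (intro exI[of _ "inc K v"]) (auto simp: Cons)
    show "length (rotate1 w) div 2 + 2 \<le> card (labels K (rotate1 w))"
      using K(2) labels_cong_set[of "rotate1 w" w K] by simp
  qed
qed (use w in simp)

lemma same_knot_rotate: "knot_word w \<Longrightarrow> same_knot w (rotate n w)"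
proof (induction n)
  case (Suc n)
  then have "same_knot (rotate n w) (rotate1 (rotate n w))"
    by (intro same_knot_step knot_word_rotate1 word_step.rotate) (simp_all add: same_knot_def)
  with Suc show ?case by (auto intro: same_knot_trans)
qed (simp add: same_knot_refl)

lemma same_knot_append: "knot_word (u @ v) \<Longrightarrow> same_knot (u @ v) (v @ u)"
  using same_knot_rotate[of "u @ v" "length u"] by (simp add: rotate_append)

lemma knot_word_append: "knot_word (u @ v) \<Longrightarrow> knot_word (v @ u)"
  using same_knot_append by (auto simp: same_knot_def)

lemma chain_appendI: "chain K s u m \<Longrightarrow> chain K m v t \<Longrightarrow> chain K s (u @ v) t"
  unfolding chain_append by (intro exI conjI)

lemma labels_Cons: "labels K (v # w) = range (case_prod (K (crossing v))) \<union> labels K w"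
  by (simp add: labels_def)

lemma labels_Nil [simp]: "labels K [] = {}"
  by (simp add: labels_def)

lemma chain_ends_labels:
  assumes "chain K s w t" "w \<noteq> []"
  shows "{fst s, snd s, fst t, snd t} \<subseteq> labels K w"
  using assms
proof (induction w arbitrary: s)
  case (Cons v w)
  have *: "{fst (inc K v), snd (inc K v), fst (out K v), snd (out K v)} \<subseteq> range (case_prod (K (crossing v)))"
    by (auto simp: inc_def out_def)
  show ?case
  proof (cases "w = []")
    case True
    then show ?thesis using Cons.prems * by (simp add: labels_Cons)
  next
    case False
    have "{fst (out K v), snd (out K v), fst t, snd t} \<subseteq> labels K w"
      using Cons.IH[of "out K v"] Cons.prems False by simp
    then show ?thesis using Cons.prems * unfolding labels_Cons by auto
  qed
qed simp

lemma range_corners: "range (case_prod f) = {f False False, f False True, f True False, f True True}"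
  by (auto simp: UNIV_bool image_iff) (metis (full_types))

text \<open>Undoing a kink removes one crossing and at most one label, the one inside the kink, so
  the old labelling still certifies planarity.\<close>

lemma knot_word_R1:
  assumes w: "knot_word (xs @ [p, bar p] @ ys)"
  shows "knot_word (xs @ ys)"
proof (cases "xs @ ys = []")
  case True
  then show ?thesis by (simp add: knot_word_def gauss_word_def planar_def)
next
  case False
  let ?w = "xs @ [p, bar p] @ ys"
  note g = knot_wordD[OF w]
  have ne: "?w \<noteq> []" by simp
  obtain K :: "nat \<Rightarrow> bool \<Rightarrow> bool \<Rightarrow> nat" and s where K: "chain K s ?w s" "card (labels K ?w) = length ?w div 2 + 2"
    using knot_word_chain[OF w ne] by (elim exE conjE)
  obtain m where c: "chain K s xs m" "m = inc K p" "out K p = inc K (bar p)" "chain K (out K (bar p)) ys s"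
    using K(1) by (auto simp: chain_append)
  have eq: "out K (bar p) = inc K p"
    using c(3) by (auto simp: out_def inc_def split: if_splits)
  have m: "fst m \<in> labels K (xs @ ys)" "snd m \<in> labels K (xs @ ys)"
    using chain_ends_labels[OF c(1)] chain_ends_labels[OF c(4)] False eq c(2) by auto
  \<comment> \<open>The region enclosed by the kink; the other three corners of the crossing
    reappear beside the strand that remains.\<close>
  define b where "b = (if fr p then K (crossing p) True True else K (crossing p) False False)"
  define R where "R = range (case_prod (K (crossing p)))"
  have R: "R \<subseteq> {fst m, snd m, b}"
    using c(2,3) unfolding R_def b_def range_corners by (auto simp: out_def inc_def split: if_splits)
  have "labels K ?w = R \<union> labels K (xs @ ys)"
    by (simp add: labels_Cons R_def Un_ac)
  also have "\<dots> \<subseteq> insert b (labels K (xs @ ys))"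
    using R m by auto
  finally have "labels K ?w \<subseteq> insert b (labels K (xs @ ys))" .
  then have "card (labels K ?w) \<le> card (insert b (labels K (xs @ ys)))"
    by (intro card_mono) auto
  then have "card (labels K ?w) \<le> Suc (card (labels K (xs @ ys)))"
    by (simp add: card_insert_if split: if_splits)
  then show ?thesis
  proof (intro knot_wordI)
    show "gauss_word (xs @ ys)"
      using g(1) unfolding gauss_word_iff by auto
    show "chain K s (xs @ ys) s" using c(2,4) eq by (intro chain_appendI[OF c(1)]) simp
  qed (use K(2) in auto)
qed

lemma same_knot_R1:
  assumes w: "knot_word (xs @ [p, bar p] @ ys)"
  shows "same_knot (xs @ [p, bar p] @ ys) (xs @ ys)"
proof -
  note g = knot_wordD[OF w]
  have "crossing p \<noteq> crossing x" if "x \<in> set (xs @ ys)" for x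
    using gauss_word_same_crossing[OF g(1), of x p] that g(3) by auto
  then have "crossing p \<notin> crossing ` set (xs @ ys)" by blast
  from word_step.R1[OF this, of "over p" "positive p"]
  have "word_step (xs @ ys) (xs @ [p, bar p] @ ys)" by (simp add: bar_def)
  with w knot_word_R1[OF w] show ?thesis by (blast intro: same_knot_step same_knot_sym)
qed

text \<open>Two crossings disappear and so do at most two labels: the bigon does, and the regions
  beyond its two tips become one.\<close>

lemma knot_word_R2:
  assumes w: "knot_word (xs @ [p, q] @ ys @ [p', q'] @ zs)"
    and pq: "fr p \<noteq> fr q" and b: "p' = bar p \<and> q' = bar q \<or> p' = bar q \<and> q' = bar p"
  shows "knot_word (xs @ ys @ zs)"
proof (cases "xs @ ys @ zs = []")
  case True
  then show ?thesis by (simp add: knot_word_def gauss_word_def planar_def)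
next
  case False
  let ?w = "xs @ [p, q] @ ys @ [p', q'] @ zs" and ?u = "xs @ ys @ zs"
  note g = knot_wordD[OF w]
  have ne: "?w \<noteq> []" by simp
  obtain K :: "nat \<Rightarrow> bool \<Rightarrow> bool \<Rightarrow> nat" and s where K: "chain K s ?w s" "card (labels K ?w) = length ?w div 2 + 2"
    using knot_word_chain[OF w ne] by (elim exE conjE)
  have c: "chain K s xs (inc K p)" "out K p = inc K q" "chain K (out K q) ys (inc K p')"
    "out K p' = inc K q'" "chain K (out K q') zs s"
    using K(1) by (auto simp: chain_append)
  have p'_iff: "p' = bar p \<longleftrightarrow> q' = bar q" "p' \<noteq> bar p \<longleftrightarrow> p' = bar q \<and> q' = bar p"
    using b pq by (metis bar_simps(4))+
  \<comment> \<open>\<open>A\<close> and \<open>B\<close> are the regions beyond the tips at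
    \<open>q\<close> and at \<open>p\<close>, lying between the two strands before and after they
    overlap. Which side that is depends on \<open>fr p\<close> and on whether the strands are
    parallel. The map \<open>h\<close> identifies the two labels.\<close>
  define A where "A = (if (p' = bar p) = fr p then snd (out K q) else fst (out K q))"
  define B where "B = (if (p' = bar p) = fr p then snd (inc K p) else fst (inc K p))"
  define h where "h x = (if x = A then B else x)" for x
  have hAB: "h A = B" "h B = B" by (auto simp: h_def)
  have h: "map_prod h h (inc K p) = map_prod h h (out K q) \<and> map_prod h h (inc K p') = map_prod h h (out K q')"
  proof (cases "p' = bar p"; cases "fr p")
    assume *: "p' = bar p" "fr p"
    then show ?thesis
      using c(2,4) pq p'_iff hAB unfolding A_def B_def by (simp add: out_def inc_def)
  next
    assume *: "p' = bar p" "\<not> fr p"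
    then show ?thesis
      using c(2,4) pq p'_iff hAB unfolding A_def B_def by (simp add: out_def inc_def)
  next
    assume *: "p' \<noteq> bar p" "fr p"
    then show ?thesis
      using c(2,4) pq p'_iff hAB unfolding A_def B_def by (simp add: out_def inc_def)
  next
    assume *: "p' \<noteq> bar p" "\<not> fr p"
    then show ?thesis
      using c(2,4) pq p'_iff hAB unfolding A_def B_def by (simp add: out_def inc_def)
  qed
  let ?K = "\<lambda>a n e. h (K a n e)"
  let ?h = "map_prod h h"
  have ch: "chain ?K (?h s) xs (?h (inc K p))" "chain ?K (?h (out K q)) ys (?h (inc K p'))"
    "chain ?K (?h (out K q')) zs (?h s)"
    using chain_comp[OF c(1)] chain_comp[OF c(3)] chain_comp[OF c(5)] by auto
  have lab: "labels ?K u = h ` labels K u" for u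
    by (auto simp: labels_def image_iff)
  have "{fst (?h (inc K p)), snd (?h (inc K p)), fst (?h (inc K p')), snd (?h (inc K p'))} \<subseteq> labels ?K ?u"
  proof (cases "ys = []")
    case True
    then have "?h (out K q) = ?h (inc K p')" using c(3) by simp
    then show ?thesis
      using chain_ends_labels[OF ch(1)] chain_ends_labels[OF ch(3)] False True h by auto
  next
    case False
    then show ?thesis using chain_ends_labels[OF ch(2)] h by auto
  qed
  then have m: "fst (?h (inc K p)) \<in> labels ?K ?u" "snd (?h (inc K p)) \<in> labels ?K ?u"
    "fst (?h (inc K p')) \<in> labels ?K ?u" "snd (?h (inc K p')) \<in> labels ?K ?u" by auto
  define \<beta> where "\<beta> = (if p' = bar p then K (crossing p) True False else
          if fr p then K (crossing p) True True else K (crossing p) False False)"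
  define R where "R = range (case_prod (K (crossing p))) \<union> range (case_prod (K (crossing q)))"
  have R: "R \<subseteq> {fst (inc K p), snd (inc K p), fst (inc K p'), snd (inc K p'),
      fst (out K q), snd (out K q), fst (out K q'), snd (out K q'), \<beta>}"
  proof (cases "p' = bar p"; cases "fr p")
    assume *: "p' = bar p" "fr p"
    then show ?thesis
      using c(2,4) pq p'_iff unfolding range_corners \<beta>_def R_def by (simp add: out_def inc_def)
  next
    assume *: "p' = bar p" "\<not> fr p"
    then show ?thesis
      using c(2,4) pq p'_iff unfolding range_corners \<beta>_def R_def by (simp add: out_def inc_def)
  next
    assume *: "p' \<noteq> bar p" "fr p"
    then show ?thesis
      using c(2,4) pq p'_iff unfolding range_corners \<beta>_def R_def by (simp add: out_def inc_def)
  next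
    assume *: "p' \<noteq> bar p" "\<not> fr p"
    then show ?thesis
      using c(2,4) pq p'_iff unfolding range_corners \<beta>_def R_def by (simp add: out_def inc_def)
  qed
  have hR: "h ` R \<subseteq> insert (h \<beta>) (labels ?K ?u)"
  proof
    fix y assume "y \<in> h ` R"
    then obtain x where x: "x \<in> R" "y = h x" by blast
    with R consider "x \<in> {fst (inc K p), snd (inc K p), fst (inc K p'), snd (inc K p')}"
      | "x = fst (out K q)" | "x = snd (out K q)" | "x = fst (out K q')" | "x = snd (out K q')" | "x = \<beta>"
      by blast
    then show "y \<in> insert (h \<beta>) (labels ?K ?u)"
    proof cases
      case 1
      then show ?thesis using m x(2) by auto
    next
      case 2
      then have "y = fst (?h (inc K p))" using h x(2) by simp
      then show ?thesis using m by simp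
    next
      case 3
      then have "y = snd (?h (inc K p))" using h x(2) by simp
      then show ?thesis using m by simp
    next
      case 4
      then have "y = fst (?h (inc K p'))" using h x(2) by simp
      then show ?thesis using m by simp
    next
      case 5
      then have "y = snd (?h (inc K p'))" using h x(2) by simp
      then show ?thesis using m by simp
    next
      case 6
      then show ?thesis using x(2) by simp
    qed
  qed
  have "labels K [p, q] = R" "labels K [p', q'] = R"
    using b by (auto simp only: labels_Cons labels_Nil R_def bar_simps Un_empty_right Un_commute)
  then have "labels K ?w \<subseteq> R \<union> labels K ?u"
    by (simp only: labels_append) blast
  then have "h ` labels K ?w \<subseteq> h ` R \<union> h ` labels K ?u" by (metis image_Un image_mono)
  also have "\<dots> \<subseteq> insert (h \<beta>) (labels ?K ?u)"
    using hR unfolding lab by (meson Un_least subset_insertI)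
  finally have sub: "h ` labels K ?w \<subseteq> insert (h \<beta>) (labels ?K ?u)" .
  \<comment> \<open>Only \<open>A\<close>, merged into \<open>B\<close>, and the bigon can be
    missing from the new labelling.\<close>
  have "labels K ?w \<subseteq> insert A (h ` labels K ?w)"
    by (auto simp: h_def)
  also have "\<dots> \<subseteq> insert A (insert (h \<beta>) (labels ?K ?u))" using sub by blast
  finally have "card (labels K ?w) \<le> card (insert A (insert (h \<beta>) (labels ?K ?u)))"
    by (intro card_mono) auto
  also have "\<dots> \<le> card (labels ?K ?u) + 2"
    by (simp add: card_insert_if)
  finally have card: "card (labels K ?w) \<le> card (labels ?K ?u) + 2" .
  have ps: "set ?w = {p, q, bar p, bar q} \<union> set ?u"
    using b by auto
  show ?thesis
  proof (rule knot_wordI)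
    have "bar x \<in> set ?u" if x: "x \<in> set ?u" for x
    proof -
      have "bar x \<in> set ?w" using gauss_word_bar[OF g(1)] x by auto
      moreover have "x \<notin> {p, q, bar p, bar q}" using x b g(3) by auto
      then have "bar x \<notin> {p, q, bar p, bar q}" by (metis bar_simps(4) insert_iff empty_iff)
      ultimately show ?thesis using ps(1) by blast
    qed
    then show "gauss_word ?u"
      using g(1) unfolding gauss_word_iff by auto
    show "chain ?K (?h s) ?u (?h s)" using ch(2,3) h by (intro chain_appendI[OF ch(1)] chain_appendI[of _ _ ys "?h (inc K p')"]) auto
    show "length ?u div 2 + 2 \<le> card (labels ?K ?u)" using card K(2) by simp
  qed
qed

lemma same_knot_R2:
  assumes w: "knot_word (xs @ [p, q] @ ys @ [p', q'] @ zs)"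
    and pq: "over p = over q" "positive p \<noteq> positive q"
    and b: "p' = bar p \<and> q' = bar q \<or> p' = bar q \<and> q' = bar p"
  shows "same_knot (xs @ [p, q] @ ys @ [p', q'] @ zs) (xs @ ys @ zs)"
proof -
  note g = knot_wordD[OF w]
  have ne: "crossing p \<noteq> crossing q"
    using b pq g(3) gauss_word_same_crossing[OF g(1), of p q] by auto
  have "crossing p \<noteq> crossing x \<and> crossing q \<noteq> crossing x" if "x \<in> set (xs @ ys @ zs)" for x
    using gauss_word_same_crossing[OF g(1), of x p] gauss_word_same_crossing[OF g(1), of x q] that g(3) b by auto
  then have nin: "crossing p \<notin> crossing ` set (xs @ ys @ zs)" "crossing q \<notin> crossing ` set (xs @ ys @ zs)"
    by blast+
  have pp: "Passage (crossing p) (over p) (positive p) = p" "Passage (crossing q) (over p) (\<not> positive p) = q"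
    "Passage (crossing p) (\<not> over p) (positive p) = bar p" "Passage (crossing q) (\<not> over p) (\<not> positive p) = bar q"
    using pq by (cases p; cases q; auto simp: bar_def)+
  have "word_step (xs @ ys @ zs) (xs @ [p, q] @ ys @ [p', q'] @ zs)"
    using word_step.R2_parallel[OF ne nin, of "over p" "positive p"]
      word_step.R2_antiparallel[OF ne nin, of "over p" "positive p"] b unfolding pp by auto
  moreover have "fr p \<noteq> fr q" using pq by (auto simp: fr_def)
  ultimately show ?thesis
    using w knot_word_R2[OF w _ b] by (blast intro: same_knot_step same_knot_sym)
qed

text \<open>Three arcs around a triangle which lies on the left when they are travelled in this order,
  each arc forward or backward.\<close>

definition tri :: "passage \<times> passage \<Rightarrow> passage \<times> passage \<Rightarrow> passage \<times> passage \<Rightarrow> bool" where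
  "tri A B C \<longleftrightarrow> (\<exists>d1 d2 d3 x y z.
     A = (if d1 then (y, x) else (x, y)) \<and> B = (if d2 then (bar x, z) else (z, bar x)) \<and>
     C = (if d3 then (bar z, bar y) else (bar y, bar z)) \<and>
     (d1 = fr x) = d2 \<and> (d2 = fr z) = d3 \<and> (d3 = fr (bar y)) = d1 \<and>
     crossing x \<noteq> crossing y \<and> crossing y \<noteq> crossing z \<and> crossing x \<noteq> crossing z)"

text \<open>The first and second arc meet at the crossing of \<open>x\<close>, the second and third
  at that of \<open>z\<close>, the third and first at that of \<open>y\<close>; the booleans tell
  which arcs are travelled forward.\<close>

lemma triD:
  assumes "tri (a1, b1) (a2, b2) (a3, b3)"
  shows "\<exists>d1 d2 d3 x y z. a1 = (if d1 then y else x) \<and> b1 = (if d1 then x else y) \<and>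
     a2 = (if d2 then bar x else z) \<and> b2 = (if d2 then z else bar x) \<and>
     a3 = (if d3 then bar z else bar y) \<and> b3 = (if d3 then bar y else bar z) \<and>
     fr x = (d1 = d2) \<and> fr z = (d2 = d3) \<and> fr y = (d3 \<noteq> d1) \<and>
     crossing x \<noteq> crossing y \<and> crossing y \<noteq> crossing z \<and> crossing x \<noteq> crossing z"
proof -
  obtain d1 d2 d3 x y z where
    "(a1, b1) = (if d1 then (y, x) else (x, y))" "(a2, b2) = (if d2 then (bar x, z) else (z, bar x))"
    "(a3, b3) = (if d3 then (bar z, bar y) else (bar y, bar z))"
    "(d1 = fr x) = d2" "(d2 = fr z) = d3" "(d3 = fr (bar y)) = d1"
    "crossing x \<noteq> crossing y" "crossing y \<noteq> crossing z" "crossing x \<noteq> crossing z"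
    using assms unfolding tri_def by (elim exE conjE) (rule that)
  then show ?thesis
    by (intro exI[of _ d1] exI[of _ d2] exI[of _ d3] exI[of _ x] exI[of _ y] exI[of _ z])
      (cases d1; cases d2; cases d3; simp)
qed

lemma tri_letters:
  assumes "tri (a1, b1) (a2, b2) (a3, b3)"
  shows "{bar a1, bar b1, bar a2, bar b2, bar a3, bar b3} = {a1, b1, a2, b2, a3, b3}"
proof -
  obtain d1 d2 d3 :: bool and x y z where
    "a1 = (if d1 then y else x)" "b1 = (if d1 then x else y)"
    "a2 = (if d2 then bar x else z)" "b2 = (if d2 then z else bar x)"
    "a3 = (if d3 then bar z else bar y)" "b3 = (if d3 then bar y else bar z)"
    using triD[OF assms] by (elim exE conjE) (rule that)
  then have eqs: "{a1, b1} = {x, y}" "{a2, b2} = {bar x, z}" "{a3, b3} = {bar y, bar z}"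
    "{bar a1, bar b1} = {bar x, bar y}" "{bar a2, bar b2} = {x, bar z}" "{bar a3, bar b3} = {y, z}"
    by (simp_all add: insert_commute)
  have "{bar a1, bar b1, bar a2, bar b2, bar a3, bar b3} = {bar a1, bar b1} \<union> {bar a2, bar b2} \<union> {bar a3, bar b3}"
    by (simp only: insert_is_Un[symmetric] Un_insert_left Un_empty_left)
  also have "\<dots> = {x, y} \<union> {bar x, z} \<union> {bar y, bar z}"
    unfolding eqs by (simp add: insert_commute)
  also have "\<dots> = {a1, b1, a2, b2, a3, b3}"
    unfolding eqs[symmetric] by (simp only: insert_is_Un[symmetric] Un_insert_left Un_empty_left)
  finally show ?thesis .
qed

text \<open>Seven regions touch a triangle: itself, three across its edges and three across its
  corners. After the move the same seven labels are arranged around the reversed triangle and all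
  labels at the outer ends of the arcs are unchanged.\<close>

lemma R3_labels:
  assumes t: "tri (a1, b1) (a2, b2) (a3, b3)"
    and e: "out K a1 = inc K b1" "out K a2 = inc K b2" "out K a3 = inc K b3"
  shows "\<exists>K'. (\<forall>c. c \<notin> {crossing a1, crossing b1, crossing a2, crossing b2} \<longrightarrow> K' c = K c) \<and>
    (\<forall>(a, b) \<in> {(a1, b1), (a2, b2), (a3, b3)}. inc K' b = inc K a \<and> out K' b = inc K' a \<and> out K' a = out K b) \<and>
    labels K [a1, b1, a2, b2, a3, b3] \<subseteq> labels K' [a1, b1, a2, b2, a3, b3]"
proof -
  obtain d1 d2 d3 x y z where A: "a1 = (if d1 then y else x)" "b1 = (if d1 then x else y)"
    "a2 = (if d2 then bar x else z)" "b2 = (if d2 then z else bar x)"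
    "a3 = (if d3 then bar z else bar y)" "b3 = (if d3 then bar y else bar z)"
    and f: "fr x = (d1 = d2)" "fr z = (d2 = d3)" "fr y = (d3 \<noteq> d1)"
    and ne: "crossing x \<noteq> crossing y" "crossing y \<noteq> crossing z" "crossing x \<noteq> crossing z"
    using triD[OF t] by (elim exE conjE) (rule that)
  \<comment> \<open>\<open>t\<close> is the triangle, \<open>Vx\<close>, \<open>Vy\<close>,
    \<open>Vz\<close> lie across its corners, and \<open>E1\<close>, \<open>E2\<close>,
    \<open>E3\<close> across its edges. The move carries the crossing of two arcs to the far side of
    the third. So in \<open>K'\<close> the triangle occupies the opposite corner of each crossing,
    and the corner where it was gets the label across the edge on the third arc.\<close>
  define t where "t = K (crossing x) (\<not> d1) (\<not> d2)"
  define Vx where "Vx = K (crossing x) d1 d2"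
  define Vy where "Vy = K (crossing y) d3 d1"
  define Vz where "Vz = K (crossing z) d2 d3"
  define E1 where "E1 = (if d1 = d2 then K (crossing x) (\<not> d1) d2 else K (crossing x) d1 (\<not> d2))"
  define E2 where "E2 = (if d2 = d3 then K (crossing z) (\<not> d2) d3 else K (crossing z) d2 (\<not> d3))"
  define E3 where "E3 = (if d3 = d1 then K (crossing y) (\<not> d3) d1 else K (crossing y) d3 (\<not> d1))"
  define K' where "K' c n e =
     (if c = crossing x then
        if n \<noteq> d1 \<and> e \<noteq> d2 then E3 else if n = d1 \<and> e = d2 then t
        else if (n \<noteq> d1) = (d1 = d2) then Vy else Vz
      else if c = crossing z then
        if n \<noteq> d2 \<and> e \<noteq> d3 then E1 else if n = d2 \<and> e = d3 then t
        else if (n \<noteq> d2) = (d2 = d3) then Vx else Vy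
      else if c = crossing y then
        if n \<noteq> d3 \<and> e \<noteq> d1 then E2 else if n = d3 \<and> e = d1 then t
        else if (n \<noteq> d3) = (d3 = d1) then Vz else Vx
      else K c n e)" for c n e
  let ?cx = "crossing x" and ?cy = "crossing y" and ?cz = "crossing z"
  have y1: "K ?cy (\<not> d3) (\<not> d1) = t" "(if d3 = d1 then K ?cy d3 (\<not> d1) else K ?cy (\<not> d3) d1) = E1"
    using e(1) f A unfolding t_def E1_def
    by (cases d1; cases d2; cases d3; simp add: inc_def out_def)+
  have z1: "K ?cz (\<not> d2) (\<not> d3) = t" "(if d1 = d2 then K ?cx d1 (\<not> d2) else K ?cx (\<not> d1) d2) = E2"
    using e(2) f A unfolding t_def E2_def
    by (cases d1; cases d2; cases d3; simp add: inc_def out_def)+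
  have z2: "(if d2 = d3 then K ?cz d2 (\<not> d3) else K ?cz (\<not> d2) d3) = E3"
    using e(3) f A unfolding E3_def
    by (cases d1; cases d2; cases d3; simp add: inc_def out_def)
  note vals = y1 z1 z2 t_def[symmetric] Vx_def[symmetric] Vy_def[symmetric] Vz_def[symmetric]
    E1_def[symmetric] E2_def[symmetric] E3_def[symmetric]
  have 1: "K' c = K c" if "c \<notin> {crossing a1, crossing b1, crossing a2, crossing b2}" for c
  proof -
    have "c \<noteq> ?cx" "c \<noteq> ?cy" "c \<noteq> ?cz" using that A by (cases d1; cases d2; simp)+
    then show ?thesis by (intro ext) (simp add: K'_def)
  qed
  have 2: "inc K' b1 = inc K a1 \<and> out K' b1 = inc K' a1 \<and> out K' a1 = out K b1"
    "inc K' b2 = inc K a2 \<and> out K' b2 = inc K' a2 \<and> out K' a2 = out K b2"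
    "inc K' b3 = inc K a3 \<and> out K' b3 = inc K' a3 \<and> out K' a3 = out K b3"
    using ne f vals A
    by (cases d1; cases d2; cases d3; simp add: K'_def inc_def out_def)+
  have "labels K [a1, b1, a2, b2, a3, b3] \<subseteq> {t, Vx, Vy, Vz, E1, E2, E3}"
    using ne f vals A unfolding labels_Cons range_corners labels_Nil
    by (cases d1; cases d2; cases d3; simp add: inc_def out_def)
  also have "\<dots> \<subseteq> labels K' [a1, b1, a2, b2, a3, b3]"
    using ne f vals A unfolding labels_Cons range_corners labels_Nil
    by (cases d1; cases d2; cases d3; simp add: K'_def inc_def out_def)
  finally have 3: "labels K [a1, b1, a2, b2, a3, b3] \<subseteq> labels K' [a1, b1, a2, b2, a3, b3]" .
  show ?thesis
    by (intro exI[of _ K'] conjI allI impI ballI) (use 1 2 3 in auto)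
qed

lemma chain_cong:
  "(\<And>v. v \<in> set w \<Longrightarrow> K' (crossing v) = K (crossing v)) \<Longrightarrow> chain K' s w t = chain K s w t"
proof (induction w arbitrary: s)
  case (Cons v w)
  have "inc K' v = inc K v" "out K' v = out K v" using Cons.prems[of v] by (simp_all add: inc_def out_def)
  with Cons show ?case by simp
qed simp

lemma labels_cong:
  "(\<And>v. v \<in> set w \<Longrightarrow> K' (crossing v) = K (crossing v)) \<Longrightarrow> labels K' w = labels K w"
  by (simp add: labels_def)

text \<open>\<open>R3_labels\<close> keeps the labels at both ends of each arc, so the chains along
  \<open>P\<close>, \<open>Q\<close> and \<open>R\<close> remain valid, and no label is
  lost.\<close>

lemma knot_word_R3:
  assumes w: "knot_word ([a1, b1] @ P @ [a2, b2] @ Q @ [a3, b3] @ R)"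
    and t: "tri (a1, b1) (a2, b2) (a3, b3) \<or> tri (a1, b1) (a3, b3) (a2, b2)"
  shows "knot_word ([b1, a1] @ P @ [b2, a2] @ Q @ [b3, a3] @ R)"
proof -
  let ?w = "[a1, b1] @ P @ [a2, b2] @ Q @ [a3, b3] @ R" and ?w' = "[b1, a1] @ P @ [b2, a2] @ Q @ [b3, a3] @ R"
  let ?T = "{a1, b1, a2, b2, a3, b3}"
  note g = knot_wordD[OF w]
  have ne: "?w \<noteq> []" by simp
  obtain K :: "nat \<Rightarrow> bool \<Rightarrow> bool \<Rightarrow> nat" and s where K: "chain K s ?w s" "card (labels K ?w) = length ?w div 2 + 2"
    using knot_word_chain[OF w ne] by (elim exE conjE)
  have c: "s = inc K a1" "out K a1 = inc K b1" "chain K (out K b1) P (inc K a2)" "out K a2 = inc K b2"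
    "chain K (out K b2) Q (inc K a3)" "out K a3 = inc K b3" "chain K (out K b3) R s"
    using K(1) by (auto simp: chain_append)
  have bars: "{bar a1, bar b1, bar a2, bar b2, bar a3, bar b3} = ?T"
  proof (rule disjE[OF t])
    assume "tri (a1, b1) (a3, b3) (a2, b2)"
    from tri_letters[OF this] show ?thesis by (simp only: insert_commute)
  qed (rule tri_letters)
  obtain K' where K': "\<And>c. c \<notin> crossing ` ?T \<Longrightarrow> K' c = K c"
    "inc K' b1 = inc K a1" "out K' b1 = inc K' a1" "out K' a1 = out K b1"
    "inc K' b2 = inc K a2" "out K' b2 = inc K' a2" "out K' a2 = out K b2"
    "inc K' b3 = inc K a3" "out K' b3 = inc K' a3" "out K' a3 = out K b3"
    "labels K [a1, b1, a2, b2, a3, b3] \<subseteq> labels K' [a1, b1, a2, b2, a3, b3]"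
  proof (rule disjE[OF t])
    assume "tri (a1, b1) (a2, b2) (a3, b3)"
    from R3_labels[OF this c(2,4,6)] show thesis
      by (elim exE conjE) (rule that, auto)
  next
    assume "tri (a1, b1) (a3, b3) (a2, b2)"
    from R3_labels[OF this c(2,6,4)] show thesis
      by (elim exE conjE) (rule that, auto simp: labels_Cons Un_ac)
  qed
  have oth: "crossing v \<notin> crossing ` ?T" if v: "v \<in> set (P @ Q @ R)" for v
  proof
    assume "crossing v \<in> crossing ` ?T"
    then obtain u where u: "u \<in> ?T" "crossing v = crossing u" by blast
    then have "u \<in> set ?w" "v \<in> set ?w" using v by auto
    then have "v \<in> {u, bar u}" using gauss_word_same_crossing[OF g(1)] u(2) by blast
    moreover have "bar u \<in> ?T" using u(1) bars by blast
    ultimately have "v \<in> ?T" using u(1) by blast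
    then show False using g(3) v by auto
  qed
  have cong: "K' (crossing v) = K (crossing v)" if "v \<in> set (P @ Q @ R)" for v
    using K'(1) oth that by blast
  have cP: "chain K' (out K b1) P (inc K a2)" "chain K' (out K b2) Q (inc K a3)" "chain K' (out K b3) R s"
    using c(3,5,7) chain_cong[of P K' K] chain_cong[of Q K' K] chain_cong[of R K' K] cong by simp_all
  have cT: "chain K' s [b1, a1] (out K b1)" "chain K' (inc K a2) [b2, a2] (out K b2)"
    "chain K' (inc K a3) [b3, a3] (out K b3)"
    using c(1) K'(2-10) by simp_all
  have "chain K' s ?w' s"
    by (rule chain_appendI[OF cT(1) chain_appendI[OF cP(1) chain_appendI[OF cT(2)
      chain_appendI[OF cP(2) chain_appendI[OF cT(3) cP(3)]]]]])
  moreover have "labels K ?w \<subseteq> labels K' ?w'"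
  proof -
    have "labels K ?w = labels K [a1, b1, a2, b2, a3, b3] \<union> labels K (P @ Q @ R)"
      by (simp add: labels_Cons Un_ac)
    also have "labels K (P @ Q @ R) = labels K' (P @ Q @ R)"
      by (rule labels_cong[symmetric]) (rule cong)
    also have "labels K [a1, b1, a2, b2, a3, b3] \<union> labels K' (P @ Q @ R) \<subseteq>
        labels K' [a1, b1, a2, b2, a3, b3] \<union> labels K' (P @ Q @ R)"
      by (rule Un_mono[OF K'(11) subset_refl])
    also have "\<dots> = labels K' ?w'"
      by (simp add: labels_Cons Un_ac)
    finally show ?thesis .
  qed
  then have "card (labels K ?w) \<le> card (labels K' ?w')" by (intro card_mono) auto
  moreover have "gauss_word ?w'"
    using g(3) by (intro gauss_word_perm[OF g(1)]) auto
  ultimately show ?thesis using K(2) by (intro knot_wordI) auto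
qed

section \<open>Triangular faces as segments of the word\<close>

lemma next_dart_arc:
  assumes w: "gauss_word w" and p: "Suc p < length w" "Suc p' < length w"
    and x: "w ! (if d then Suc p else p) = x" "w ! (if d' then p' else Suc p') = bar x" "(d = fr x) = d'"
  shows "next_dart w (p, d) = (p', d')"
proof -
  have e: "dart_end w (p, d) = (if d then Suc p else p)"
    using p by (simp add: dart_end_def succ_pos_eq)
  have "partner w (dart_end w (p, d)) = (if d' then p' else Suc p')"
    unfolding e by (rule partner_eqI[OF w]) (use p x(1,2) in auto)
  then show ?thesis
    using x p unfolding next_dart_alt Let_def e by (auto simp: pred_pos_eq)
qed

text \<open>The condition in \<open>tri\<close> on each corner is the one under which
  \<open>next_dart\<close> turns from one arc to the next, so the three darts form a full
  orbit.\<close>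

lemma triangleI:
  assumes w: "gauss_word w" and p: "Suc p1 < length w" "Suc p2 < length w" "Suc p3 < length w"
    and t: "tri (w ! p1, w ! Suc p1) (w ! p2, w ! Suc p2) (w ! p3, w ! Suc p3)"
  shows "triangle w {p1, p2, p3}"
proof -
  obtain d1 d2 d3 x y z where A: "w ! p1 = (if d1 then y else x)" "w ! Suc p1 = (if d1 then x else y)"
    "w ! p2 = (if d2 then bar x else z)" "w ! Suc p2 = (if d2 then z else bar x)"
    "w ! p3 = (if d3 then bar z else bar y)" "w ! Suc p3 = (if d3 then bar y else bar z)"
    and f: "fr x = (d1 = d2)" "fr z = (d2 = d3)" "fr y = (d3 \<noteq> d1)"
    and ne: "crossing x \<noteq> crossing y" "crossing y \<noteq> crossing z" "crossing x \<noteq> crossing z"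
    using triD[OF t] by (elim exE conjE) (rule that)
  let ?f = "next_dart w"
  have n: "?f (p1, d1) = (p2, d2)" "?f (p2, d2) = (p3, d3)" "?f (p3, d3) = (p1, d1)"
    using A f by (auto intro!: next_dart_arc[OF w p(1,2), of _ x] next_dart_arc[OF w p(2,3), of _ z]
        next_dart_arc[OF w p(3,1), of _ "bar y"])
  have ps: "p1 \<noteq> p2" "p2 \<noteq> p3" "p1 \<noteq> p3"
    using A ne by (cases d1; cases d2; cases d3; metis bar_simps(1))+
  have "orbit ?f (p1, d1) = {(p1, d1), (p2, d2), (p3, d3)}" (is "_ = ?F")
  proof
    show "orbit ?f (p1, d1) \<subseteq> ?F"
    proof
      fix e assume "e \<in> orbit ?f (p1, d1)"
      then show "e \<in> ?F" by induction (use n in auto)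
    qed
    have "?f (p1, d1) \<in> orbit ?f (p1, d1)" "?f (?f (p1, d1)) \<in> orbit ?f (p1, d1)"
      "?f (?f (?f (p1, d1))) \<in> orbit ?f (p1, d1)"
      by (intro orbit.intros)+
    then show "?F \<subseteq> orbit ?f (p1, d1)" unfolding n by blast
  qed
  moreover have "(p1, d1) \<in> darts w" using p by (simp add: darts_def)
  ultimately have "?F \<in> faces w" unfolding faces_def by (metis imageI)
  moreover have "card ?F = 3" "{p1, p2, p3} = fst ` ?F" using ps by auto
  moreover have "(\<lambda>i. crossing (w ! i)) ` {p1, p2, p3} \<union> (\<lambda>i. crossing (w ! succ_pos w i)) ` {p1, p2, p3}
     = {crossing x, crossing y, crossing z}"
    using A p by (cases d1; cases d2; cases d3; auto simp: succ_pos_eq)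
  moreover have "card {crossing x, crossing y, crossing z} = 3" using ne by simp
  ultimately show ?thesis unfolding triangle_def by metis
qed

lemma map_upt_eq: "(\<And>i. i < length P \<Longrightarrow> f (k + i) = P ! i) \<Longrightarrow> map f [k..<k + length P] = P"
  by (rule nth_equalityI) auto

lemma push_triangle_list:
  assumes w_def: "w = [a1, b1] @ P @ [a2, b2] @ Q @ [a3, b3] @ R"
  shows "push_triangle w {0, 2 + length P, 4 + length P + length Q} =
     [b1, a1] @ P @ [b2, a2] @ Q @ [b3, a3] @ R"
proof -
  let ?T = "{0, 2 + length P, 4 + length P + length Q}"
  let ?f = "\<lambda>p. if p \<in> ?T then w ! succ_pos w p else if pred_pos w p \<in> ?T then w ! pred_pos w p else w ! p"
  have len: "length w = 6 + length P + length Q + length R" by (simp add: w_def)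
  have s: "succ_pos w p = Suc p" if "Suc p < length w" for p using that by (simp add: succ_pos_eq)
  have r: "pred_pos w p = p - 1" if "p < length w" "p > 0" for p using that by (simp add: pred_pos_eq)
  have cut: "[i..<k] = [i..<j] @ [j..<k]" if "i \<le> j" "j \<le> k" for i j k :: nat
    using upt_add_eq_append[of i j "k - j"] that by simp
  let ?p = "length P" and ?q = "length Q"
  have "[0..<length w] = [0..<0 + length [b1, a1]] @ [2..<2 + ?p] @
     [2 + ?p..<2 + ?p + length [b2, a2]] @ [4 + ?p..<4 + ?p + ?q] @
     [4 + ?p + ?q..<4 + ?p + ?q + length [b3, a3]] @
     [6 + ?p + ?q..<6 + ?p + ?q + length R]"
    using cut[of 0 2 "length w"] cut[of 2 "2 + ?p" "length w"] cut[of "2 + ?p" "4 + ?p" "length w"]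
      cut[of "4 + ?p" "4 + ?p + ?q" "length w"] cut[of "4 + ?p + ?q" "6 + ?p + ?q" "length w"]
    unfolding len by (simp del: upt_Suc upt_rec_numeral add: eval_nat_numeral)
  then have "push_triangle w ?T = map ?f \<dots>" by (simp only: push_triangle_def)
  also have "\<dots> = [b1, a1] @ P @ [b2, a2] @ Q @ [b3, a3] @ R"
    unfolding map_append
    by (intro arg_cong2[where f = append] map_upt_eq)
      (auto simp: s r len, auto simp: w_def nth_append nth_Cons' less_Suc_eq)
  finally show ?thesis .
qed

lemma next_dart_start:
  assumes w: "gauss_word w" and p: "p < length w" and n: "next_dart w (p, d) = (p', d')"
  shows "p' < length w" "w ! (if d' then p' else succ_pos w p') = bar (w ! (if d then succ_pos w p else p))"
    "(d = fr (w ! (if d then succ_pos w p else p))) = d'"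
proof -
  let ?e = "if d then succ_pos w p else p"
  have e: "dart_end w (p, d) = ?e" by (simp add: dart_end_def)
  have el: "?e < length w" using p by (simp add: succ_pos_less)
  note k = partner[OF w el]
  have "p' = (if d = fr (w ! ?e) then partner w ?e else pred_pos w (partner w ?e))" "d' = (d = fr (w ! ?e))"
    using n unfolding next_dart_alt Let_def e snd_conv by (auto split: if_splits)
  then show "p' < length w" "w ! (if d' then p' else succ_pos w p') = bar (w ! ?e)" "(d = fr (w ! ?e)) = d'"
    using k pred_pos_less[OF k(1)] by auto
qed

text \<open>As \<open>next_dart\<close> is injective on darts, the third step cannot lead back to
  the second or third point; it has to close the orbit at the first.\<close>

lemma orbit_card_3:
  assumes w: "gauss_word w" and d: "d \<in> darts w" and c: "card (orbit (next_dart w) d) = 3"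
  shows "next_dart w (next_dart w (next_dart w d)) = d"
    "orbit (next_dart w) d = {d, next_dart w d, next_dart w (next_dart w d)}"
    "distinct [d, next_dart w d, next_dart w (next_dart w d)]"
proof -
  let ?f = "next_dart w" and ?F = "orbit (next_dart w) d"
  have inF: "d \<in> ?F" "?f d \<in> ?F" "?f (?f d) \<in> ?F" "?f (?f (?f d)) \<in> ?F"
    by (rule self_in_orbit_next_dart[OF w d]) (intro orbit.intros)+
  have dart: "?f d \<in> darts w" "?f (?f d) \<in> darts w"
    using next_dart_in[OF w] d by auto
  note inj = inj_onD[OF inj_next_dart[OF w]]
  have n1: "?f d \<noteq> d"
  proof
    assume "?f d = d"
    then have "?F = {d}" by (simp add: orbit_eq_singleton_iff)
    with c show False by simp
  qed
  have n2: "?f (?f d) \<noteq> d"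
  proof
    assume e: "?f (?f d) = d"
    have "?F \<subseteq> {d, ?f d}"
    proof
      fix x assume "x \<in> ?F"
      then show "x \<in> {d, ?f d}" by induction (use e in auto)
    qed
    then have "card ?F \<le> card {d, ?f d}" by (intro card_mono) auto
    also have "\<dots> \<le> 2" by (simp add: card_insert_if)
    finally show False using c by simp
  qed
  have n3: "?f (?f d) \<noteq> ?f d" using n1 inj[OF _ dart(1) d] by blast
  show "distinct [d, ?f d, ?f (?f d)]" using n1 n2 n3 by auto
  have fin: "finite ?F" using c by (metis card.infinite zero_neq_numeral)
  have "card {d, ?f d, ?f (?f d)} = 3" using n1 n2 n3 by auto
  then show F: "?F = {d, ?f d, ?f (?f d)}"
    using card_subset_eq[OF fin, of "{d, ?f d, ?f (?f d)}"] inF c by auto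
  have "?f (?f (?f d)) \<noteq> ?f d" using n2 inj[OF _ dart(2) d] by blast
  moreover have "?f (?f (?f d)) \<noteq> ?f (?f d)" using n3 inj[OF _ dart(2) dart(1)] by blast
  ultimately show "?f (?f (?f d)) = d" using inF(4) F by auto
qed

lemma triangle_darts:
  assumes w: "gauss_word w" and T: "triangle w T"
  shows "\<exists>p1 p2 p3. T = {p1, p2, p3} \<and> p1 < length w \<and> p2 < length w \<and> p3 < length w \<and>
    tri (w ! p1, w ! succ_pos w p1) (w ! p2, w ! succ_pos w p2) (w ! p3, w ! succ_pos w p3)"
proof -
  obtain F where F: "F \<in> faces w" "card F = 3" "T = fst ` F"
    and cr: "card ((\<lambda>i. crossing (w ! i)) ` T \<union> (\<lambda>i. crossing (w ! succ_pos w i)) ` T) = 3"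
    using T unfolding triangle_def by blast
  then obtain d where d: "d \<in> darts w" "F = orbit (next_dart w) d" by (auto simp: faces_def)
  obtain p1 d1 where e1: "d = (p1, d1)" by (cases d)
  obtain p2 d2 where e2: "next_dart w (p1, d1) = (p2, d2)" by (cases "next_dart w (p1, d1)")
  obtain p3 d3 where e3: "next_dart w (p2, d2) = (p3, d3)" by (cases "next_dart w (p2, d2)")
  have e4: "next_dart w (p3, d3) = (p1, d1)" and FF: "F = {(p1, d1), (p2, d2), (p3, d3)}"
    using orbit_card_3(1,2)[OF w d(1)] F(2) d(2) by (simp_all add: e1 e2 e3)
  have p1: "p1 < length w" using d(1) e1 by (simp add: darts_def)
  define x where "x = w ! (if d1 then succ_pos w p1 else p1)"
  define z where "z = w ! (if d2 then succ_pos w p2 else p2)"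
  define y where "y = bar (w ! (if d3 then succ_pos w p3 else p3))"
  note s1 = next_dart_start[OF w p1 e2]
  note s2 = next_dart_start[OF w s1(1) e3]
  note s3 = next_dart_start[OF w s2(1) e4]
  have A: "(w ! p1, w ! succ_pos w p1) = (if d1 then (y, x) else (x, y))"
    "(w ! p2, w ! succ_pos w p2) = (if d2 then (bar x, z) else (z, bar x))"
    "(w ! p3, w ! succ_pos w p3) = (if d3 then (bar z, bar y) else (bar y, bar z))"
    using s1(2) s2(2) s3(2) by (auto simp: x_def y_def z_def)
  have fr: "(d1 = fr x) = d2" "(d2 = fr z) = d3" "(d3 = fr (bar y)) = d1"
    using s1(3) s2(3) s3(3) by (auto simp: x_def y_def z_def)
  have T': "T = {p1, p2, p3}" using F(3) FF by auto
  have "crossing (w ! p1) \<in> {crossing x, crossing y, crossing z}" "crossing (w ! p2) \<in> {crossing x, crossing y, crossing z}"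
    "crossing (w ! p3) \<in> {crossing x, crossing y, crossing z}"
    "crossing (w ! succ_pos w p1) \<in> {crossing x, crossing y, crossing z}"
    "crossing (w ! succ_pos w p2) \<in> {crossing x, crossing y, crossing z}"
    "crossing (w ! succ_pos w p3) \<in> {crossing x, crossing y, crossing z}"
    using A by (simp_all split: if_splits)
  then have "(\<lambda>i. crossing (w ! i)) ` T \<union> (\<lambda>i. crossing (w ! succ_pos w i)) ` T \<subseteq> {crossing x, crossing y, crossing z}"
    unfolding T' by simp
  then have "3 \<le> card {crossing x, crossing y, crossing z}"
    unfolding cr[symmetric] by (intro card_mono) auto
  then have ne: "crossing x \<noteq> crossing y" "crossing y \<noteq> crossing z" "crossing x \<noteq> crossing z"
    by (auto simp: card_insert_if split: if_splits)
  have "tri (w ! p1, w ! succ_pos w p1) (w ! p2, w ! succ_pos w p2) (w ! p3, w ! succ_pos w p3)"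
    unfolding tri_def using A fr ne by blast
  with T' p1 s1(1) s2(1) show ?thesis by blast
qed

lemma rotate_push_triangle:
  assumes n: "w \<noteq> []"
  shows "rotate k (push_triangle w T) = push_triangle (rotate k w) {t. t < length w \<and> (t + k) mod length w \<in> T}"
    (is "_ = push_triangle ?w ?T")
proof (rule nth_equalityI)
  show "length (rotate k (push_triangle w T)) = length (push_triangle ?w ?T)"
    by (simp add: push_triangle_def)
next
  fix i assume "i < length (rotate k (push_triangle w T))"
  then have i: "i < length w" by (simp add: push_triangle_def)
  let ?n = "length w" let ?j = "(k + i) mod length w"
  have j: "?j < ?n" using n by simp
  have rot: "?w ! m = w ! ((k + m) mod ?n)" if "m < ?n" for m using that by (simp add: nth_rotate)
  have 1: "succ_pos ?w i < ?n" "pred_pos ?w i < ?n"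
    using succ_pos_less[of i ?w] pred_pos_less[of i ?w] i by auto
  have 2: "(k + succ_pos ?w i) mod ?n = succ_pos w ?j"
    by (simp add: succ_pos_def mod_simps algebra_simps)
  have 3: "(k + pred_pos ?w i) mod ?n = pred_pos w ?j"
  proof -
    obtain m where "length w = Suc m" using n by (cases "length w") auto
    then show ?thesis by (simp add: pred_pos_def mod_simps algebra_simps del: mod_Suc)
  qed
  have mem: "t \<in> ?T \<longleftrightarrow> (k + t) mod ?n \<in> T" if "t < ?n" for t using that by (simp add: add.commute)
  have "push_triangle ?w ?T ! i = push_triangle w T ! ?j"
    using i j 1 by (simp add: push_triangle_def rot mem 2 3 del: mem_Collect_eq)
  moreover have "rotate k (push_triangle w T) ! i = push_triangle w T ! ?j"
    using i by (simp add: nth_rotate push_triangle_def)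
  ultimately show "rotate k (push_triangle w T) ! i = push_triangle ?w ?T ! i" by simp
qed

lemma list_split3:
  assumes "2 \<le> q" "q + 1 < q'" "q' + 1 < length w"
  shows "\<exists>P Q R. w = [w ! 0, w ! 1] @ P @ [w ! q, w ! Suc q] @ Q @ [w ! q', w ! Suc q'] @ R \<and>
    length P = q - 2 \<and> length Q = q' - q - 2"
proof -
  have pair: "drop i w = [w ! i, w ! Suc i] @ drop (i + 2) w" if "i + 1 < length w" for i
    using that Cons_nth_drop_Suc[of i w] Cons_nth_drop_Suc[of "Suc i" w] by simp
  have mid: "drop i w = take (j - i) (drop i w) @ drop j w" if "i \<le> j" for i j
    using that by (metis append_take_drop_id drop_drop le_add_diff_inverse2)
  have "w = [w ! 0, w ! 1] @ drop 2 w" using pair[of 0] assms by (simp add: numeral_eq_Suc)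
  also have "drop 2 w = take (q - 2) (drop 2 w) @ drop q w" using mid assms by blast
  also have "drop q w = [w ! q, w ! Suc q] @ drop (q + 2) w" using pair assms by simp
  also have "drop (q + 2) w = take (q' - (q + 2)) (drop (q + 2) w) @ drop q' w" using mid assms by auto
  also have "drop q' w = [w ! q', w ! Suc q'] @ drop (q' + 2) w" using pair assms by simp
  finally show ?thesis
    using assms by (intro exI[of _ "take (q - 2) (drop 2 w)"] exI[of _ "take (q' - (q + 2)) (drop (q + 2) w)"]
      exI[of _ "drop (q' + 2) w"]) auto
qed

lemma tri_distinct:
  assumes "tri (a1, b1) (a2, b2) (a3, b3)"
  shows "distinct [a1, b1, a2, b2, a3, b3]"
    "distinct [crossing a1, crossing b1]" "distinct [crossing a2, crossing b2]" "distinct [crossing a3, crossing b3]"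
proof -
  obtain d1 d2 d3 :: bool and x y z where A: "a1 = (if d1 then y else x)" "b1 = (if d1 then x else y)"
    "a2 = (if d2 then bar x else z)" "b2 = (if d2 then z else bar x)"
    "a3 = (if d3 then bar z else bar y)" "b3 = (if d3 then bar y else bar z)"
    and ne: "crossing x \<noteq> crossing y" "crossing y \<noteq> crossing z" "crossing x \<noteq> crossing z"
    using triD[OF assms] by (elim exE conjE) (rule that)
  have "x \<noteq> y" "x \<noteq> z" "y \<noteq> z" "x \<noteq> bar y" "x \<noteq> bar z" "y \<noteq> bar z" "y \<noteq> bar x" "z \<noteq> bar x" "z \<noteq> bar y"
    using ne by (metis bar_simps(1))+
  note nes = this this[symmetric]
  show "distinct [a1, b1, a2, b2, a3, b3]"
    unfolding A using nes by (cases d1; cases d2; cases d3; simp)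
  show "distinct [crossing a1, crossing b1]" "distinct [crossing a2, crossing b2]" "distinct [crossing a3, crossing b3]"
    unfolding A using ne ne[symmetric] by (cases d1; cases d2; cases d3; simp)+
qed

text \<open>Rotating the word to one of the three edges ensures that no edge wraps around the end.
  The other two edges may follow in either order, whence the disjunction of two instances of
  \<open>tri\<close>.\<close>

lemma triangle_list:
  assumes w: "gauss_word w" and T: "triangle w T"
  shows "\<exists>k a1 b1 a2 b2 a3 b3 P Q R. rotate k w = [a1, b1] @ P @ [a2, b2] @ Q @ [a3, b3] @ R \<and>
    rotate k (push_triangle w T) = [b1, a1] @ P @ [b2, a2] @ Q @ [b3, a3] @ R \<and>
    (tri (a1, b1) (a2, b2) (a3, b3) \<or> tri (a1, b1) (a3, b3) (a2, b2)) \<and>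
    (cyclic_triangle w T \<longleftrightarrow> over a1 \<noteq> over b1 \<and> over a2 \<noteq> over b2 \<and> over a3 \<noteq> over b3)"
proof -
  obtain p1 p2 p3 where T': "T = {p1, p2, p3}" and p: "p1 < length w" "p2 < length w" "p3 < length w"
    and t: "tri (w ! p1, w ! succ_pos w p1) (w ! p2, w ! succ_pos w p2) (w ! p3, w ! succ_pos w p3)"
    using triangle_darts[OF w T] by blast
  let ?n = "length w" and ?w = "rotate p1 w"
  \<comment> \<open>The position in the rotated word of the letter that was at position
    \<open>p\<close>.\<close>
  define q where "q p = (p + (?n - p1)) mod ?n" for p
  have n: "w \<noteq> []" using p by auto
  have q: "q p < ?n" for p using n by (simp add: q_def)
  have qm: "(p1 + q p) mod ?n = p" if "p < ?n" for p
    using that p(1) by (simp add: q_def mod_simps)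
  have q': "t = q p" if "t < ?n" "(t + p1) mod ?n = p" for t p
  proof -
    have "q p = (t + p1 + (?n - p1)) mod ?n"
      unfolding q_def that(2)[symmetric] by (rule mod_add_left_eq)
    also have "t + p1 + (?n - p1) = t + ?n" using p(1) by simp
    finally show ?thesis using that(1) by simp
  qed
  have rot: "?w ! m = w ! ((p1 + m) mod ?n)" if "m < ?n" for m using that by (simp add: nth_rotate)
  have wq: "?w ! q p = w ! p" if "p < ?n" for p using rot[OF q] qm[OF that] by simp
  have wqs: "?w ! succ_pos w (q p) = w ! succ_pos w p" if "p < ?n" for p
  proof -
    have "(p1 + succ_pos w (q p)) mod ?n = ((p1 + q p) mod ?n + 1) mod ?n"
      by (simp add: succ_pos_def mod_simps)
    then show ?thesis using rot[OF succ_pos_less[OF q]] qm[OF that] by (simp add: succ_pos_def)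
  qed
  have q1: "q p1 = 0" using p(1) by (simp add: q_def)
  define A B where "A = w ! p1" and "B = w ! succ_pos w p1"
  define A2 B2 where "A2 = w ! p2" and "B2 = w ! succ_pos w p2"
  define A3 B3 where "A3 = w ! p3" and "B3 = w ! succ_pos w p3"
  note d = tri_distinct(1)[OF t, folded A_def B_def A2_def B2_def A3_def B3_def]
  have l: "?n \<ge> 2"
    using p d by (cases "?n = 1") (auto simp: A_def B_def succ_pos_def)
  have s0: "succ_pos w (q p1) = 1" using l by (simp add: q1 succ_pos_def)
  have w0: "?w ! 0 = A" "?w ! 1 = B"
    using wq[OF p(1)] wqs[OF p(1)] unfolding s0 unfolding q1 by (simp_all add: A_def B_def)
  have w2: "?w ! q p2 = A2" "?w ! succ_pos w (q p2) = B2" "?w ! q p3 = A3" "?w ! succ_pos w (q p3) = B3"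
    using wq wqs p by (simp_all add: A2_def B2_def A3_def B3_def)
  have q2: "2 \<le> q p2" "Suc (q p2) < ?n"
  proof -
    have "q p2 \<noteq> 0" "q p2 \<noteq> 1" using w0 w2 d by (metis distinct_length_2_or_more)+
    then show "2 \<le> q p2" by simp
    show "Suc (q p2) < ?n"
    proof (rule ccontr)
      assume "\<not> Suc (q p2) < ?n"
      then have "succ_pos w (q p2) = 0" using q[of p2] by (simp add: succ_pos_eq)
      then show False using w0 w2 d by (auto simp del: One_nat_def)
    qed
  qed
  have q3: "2 \<le> q p3" "Suc (q p3) < ?n"
  proof -
    have "q p3 \<noteq> 0" "q p3 \<noteq> 1" using w0 w2 d by (metis distinct_length_2_or_more)+
    then show "2 \<le> q p3" by simp
    show "Suc (q p3) < ?n"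
    proof (rule ccontr)
      assume "\<not> Suc (q p3) < ?n"
      then have "succ_pos w (q p3) = 0" using q[of p3] by (simp add: succ_pos_eq)
      then show False using w0 w2 d by (auto simp del: One_nat_def)
    qed
  qed
  have s: "succ_pos w (q p2) = Suc (q p2)" "succ_pos w (q p3) = Suc (q p3)"
    using q2 q3 by (simp_all add: succ_pos_eq)
  \<comment> \<open>The six letters on the triangle are distinct, so the edges have no endpoint in
    common and one of the two remaining edges ends before the other begins.\<close>
  have "q p2 \<noteq> q p3" "Suc (q p2) \<noteq> q p3" "q p2 \<noteq> Suc (q p3)"
    using w2 d unfolding s by auto
  then have order: "q p2 + 1 < q p3 \<or> q p3 + 1 < q p2" by linarith
  have "{t. t < ?n \<and> (t + p1) mod ?n \<in> T} = {0, q p2, q p3}"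
    using q' q q1 qm p n by (auto simp: T' add.commute)
  then have push: "rotate p1 (push_triangle w T) = push_triangle ?w {0, q p2, q p3}"
    using rotate_push_triangle[OF n, of p1 T] by simp
  have cyc: "cyclic_triangle w T \<longleftrightarrow> over A \<noteq> over B \<and> over A2 \<noteq> over B2 \<and> over A3 \<noteq> over B3"
    using T unfolding cyclic_triangle_def T' by (simp add: A_def B_def A2_def B2_def A3_def B3_def)
  note t' = t[folded A_def B_def A2_def B2_def A3_def B3_def]
  show ?thesis
    using order
  proof
    assume "q p2 + 1 < q p3"
    from list_split3[OF q2(1) this, of ?w] q3(2)
    obtain P Q R where PQR: "?w = [A, B] @ P @ [A2, B2] @ Q @ [A3, B3] @ R"
      "length P = q p2 - 2" "length Q = q p3 - q p2 - 2"
      using w0 w2 s by auto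
    have "{0, q p2, q p3} = {0, 2 + length P, 4 + length P + length Q}"
      using PQR(2,3) q2 \<open>q p2 + 1 < q p3\<close> by auto
    with push_triangle_list[OF PQR(1)] push PQR(1) t' cyc show ?thesis by metis
  next
    assume "q p3 + 1 < q p2"
    from list_split3[OF q3(1) this, of ?w] q2(2)
    obtain P Q R where PQR: "?w = [A, B] @ P @ [A3, B3] @ Q @ [A2, B2] @ R"
      "length P = q p3 - 2" "length Q = q p2 - q p3 - 2"
      using w0 w2 s by auto
    have "{0, q p2, q p3} = {0, 2 + length P, 4 + length P + length Q}"
      using PQR(2,3) q3 \<open>q p3 + 1 < q p2\<close> by auto
    with push_triangle_list[OF PQR(1)] push PQR(1) t' cyc show ?thesis by metis
  qed
qed

lemma same_knot_R3:
  assumes w: "knot_word ([a1, b1] @ P @ [a2, b2] @ Q @ [a3, b3] @ R)"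
    and t: "tri (a1, b1) (a2, b2) (a3, b3) \<or> tri (a1, b1) (a3, b3) (a2, b2)"
    and nc: "over a1 = over b1 \<or> over a2 = over b2 \<or> over a3 = over b3"
  shows "same_knot ([a1, b1] @ P @ [a2, b2] @ Q @ [a3, b3] @ R) ([b1, a1] @ P @ [b2, a2] @ Q @ [b3, a3] @ R)"
proof -
  let ?w = "[a1, b1] @ P @ [a2, b2] @ Q @ [a3, b3] @ R"
  let ?p = "2 + length P" and ?q = "4 + length P + length Q"
  note g = knot_wordD[OF w]
  have nth: "?w ! 0 = a1" "?w ! Suc 0 = b1" "?w ! ?p = a2" "?w ! Suc ?p = b2" "?w ! ?q = a3" "?w ! Suc ?q = b3"
    by (simp_all add: nth_append)
  have len: "Suc 0 < length ?w" "Suc ?p < length ?w" "Suc ?q < length ?w" by simp_all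
  have tr: "triangle ?w {0, ?p, ?q}"
    using t
  proof
    assume "tri (a1, b1) (a2, b2) (a3, b3)"
    then show ?thesis by (intro triangleI[OF g(1) len]) (simp only: nth)
  next
    assume "tri (a1, b1) (a3, b3) (a2, b2)"
    then have "triangle ?w {0, ?q, ?p}" by (intro triangleI[OF g(1) len(1,3,2)]) (simp only: nth)
    then show ?thesis by (simp only: insert_commute)
  qed
  have "\<not> cyclic_triangle ?w {0, ?p, ?q}"
  proof
    assume "cyclic_triangle ?w {0, ?p, ?q}"
    then have c: "\<forall>i\<in>{0, ?p, ?q}. over (?w ! i) \<noteq> over (?w ! succ_pos ?w i)"
      unfolding cyclic_triangle_def by (rule conjunct2)
    have "succ_pos ?w 0 = Suc 0" "succ_pos ?w ?p = Suc ?p" "succ_pos ?w ?q = Suc ?q"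
      by (simp_all add: succ_pos_eq)
    with c[THEN bspec, of 0] c[THEN bspec, of ?p] c[THEN bspec, of ?q] nc show False
      by (simp only: nth) simp
  qed
  from word_step.R3[OF tr this]
  have "word_step ?w ([b1, a1] @ P @ [b2, a2] @ Q @ [b3, a3] @ R)"
    unfolding push_triangle_list[OF refl] .
  with w knot_word_R3[OF w t] show ?thesis by (rule same_knot_step)
qed

section \<open>The Polyak-Viro invariant\<close>

definition sg :: "passage \<Rightarrow> int" where
  "sg v = (if positive v then 1 else - 1)"

text \<open>Pairs of interleaved chords met in the order under, over, over, under from the base
  point, which is the start of the word. This is the based arrow diagram in the formula of Polyak
  and Viro.\<close>

definition apairs :: "passage list \<Rightarrow> (passage \<times> passage) set" where
  "apairs w = {(x, y). \<not> over x \<and> over y \<and> subseq [x, y, bar x, bar y] w}"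

text \<open>The second coefficient of the Conway polynomial, given by its Gauss diagram
  formula.\<close>

definition a2 :: "passage list \<Rightarrow> int" where
  "a2 w = (\<Sum>(x, y)\<in>apairs w. sg x * sg y)"

lemma subseq_set: "subseq u v \<Longrightarrow> set u \<subseteq> set v"
  by (metis set_nths_subset subseq_conv_nths)

lemma apairs_subset: "apairs w \<subseteq> set w \<times> set w"
  by (auto simp: apairs_def dest!: subseq_set)

lemma finite_apairs [simp]: "finite (apairs w)"
  by (rule finite_subset[OF apairs_subset]) simp

lemma sg_bar [simp]: "sg (bar v) = sg v"
  by (simp add: sg_def)

lemma apairs_Cons:
  "v \<notin> set u \<Longrightarrow> apairs (v # u) = apairs u \<union> {(x, y). x = v \<and> \<not> over v \<and> over y \<and> subseq [y, bar v, bar y] u}"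
proof -
  assume "v \<notin> set u"
  then have "\<not> subseq [v, y, bar v, bar y] u" for y
    by (auto dest: subseq_set)
  then show ?thesis by (auto simp: apairs_def subseq_Cons2_iff split: if_splits)
qed

lemma subseq_rev: "subseq (rev xs) (rev ys) \<longleftrightarrow> subseq xs ys"
proof -
  have "subseq xs ys \<Longrightarrow> subseq (rev xs) (rev ys)" for xs ys :: "'a list"
    by (induction rule: list_emb.induct) (auto intro: subseq_rev_drop_many list_emb_append_mono)
  from this[of xs ys] this[of "rev xs" "rev ys"] show ?thesis by auto
qed

lemma subseq_snoc: "subseq (xs @ [a]) (ys @ [b]) \<longleftrightarrow> (if a = b then subseq xs ys else subseq (xs @ [a]) ys)"
proof -
  have "subseq (xs @ [a]) (ys @ [b]) \<longleftrightarrow> subseq (a # rev xs) (b # rev ys)"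
    using subseq_rev[of "xs @ [a]" "ys @ [b]"] by simp
  also have "\<dots> \<longleftrightarrow> (if a = b then subseq (rev xs) (rev ys) else subseq (a # rev xs) (rev ys))"
    by (simp add: subseq_Cons2_iff)
  also have "subseq (rev xs) (rev ys) = subseq xs ys" by (rule subseq_rev)
  also have "subseq (a # rev xs) (rev ys) = subseq (xs @ [a]) ys"
    using subseq_rev[of "xs @ [a]" ys] by simp
  finally show ?thesis .
qed

lemma apairs_snoc:
  "v \<notin> set u \<Longrightarrow> apairs (u @ [v]) = apairs u \<union> {(x, y). y = bar v \<and> \<not> over v \<and> \<not> over x \<and> subseq [x, bar v, bar x] u}"
proof -
  assume v: "v \<notin> set u"
  have "subseq [x, y, bar x, bar y] (u @ [v]) \<longleftrightarrow>
    (if y = bar v then subseq [x, bar v, bar x] u else subseq [x, y, bar x, bar y] u)" for x y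
    using subseq_snoc[of "[x, y, bar x]" "bar y" u v] by (auto simp: bar_eq_iff[symmetric, of y] simp del: bar_eq_iff)
  moreover have "\<not> subseq [x, bar v, bar x, v] u" for x
    using v by (auto dest: subseq_set)
  ultimately show ?thesis by (auto simp: apairs_def split: if_splits)
qed

lemma subseq_remove: "b \<notin> set L \<Longrightarrow> subseq L (S @ b # R) \<longleftrightarrow> subseq L (S @ R)"
proof (induction S arbitrary: L)
  case Nil
  then show ?case by (cases L) (auto simp: subseq_Cons2_iff)
next
  case (Cons s S)
  then show ?case by (cases L) (auto simp: subseq_Cons2_iff)
qed

lemma subseq_mid:
  assumes "distinct (S @ b # R)"
  shows "subseq [y, b, z] (S @ b # R) \<longleftrightarrow> y \<in> set S \<and> z \<in> set R"
  using assms
proof (induction S)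
  case Nil
  then show ?case by (auto simp: subseq_Cons2_iff subseq_singleton_left dest: subseq_set)
next
  case (Cons s S)
  have "subseq [b, z] (S' @ b # R) \<longleftrightarrow> z \<in> set R" if "b \<notin> set S'" for S'
    using that by (induction S') (auto simp: subseq_Cons2_iff subseq_singleton_left)
  with Cons show ?case by (auto simp: subseq_Cons2_iff)
qed

section \<open>Independence of the base point\<close>

definition balanced :: "passage list \<Rightarrow> bool" where
  "balanced w \<longleftrightarrow> gauss_word w \<and> (\<forall>k v S R. rotate k w = v # S @ bar v # R \<longrightarrow> lk S (set R) = 0)"

text \<open>Index identities are all that moving the base point requires of planarity. They hold
  after every rotation; here \<open>loop_index\<close> is applied to the complementary loop, which
  starts with \<open>bar v\<close>.\<close>

lemma knot_word_balanced: "knot_word w \<Longrightarrow> balanced w"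
proof -
  assume w: "knot_word w"
  have "lk S (set R) = 0" if r: "rotate k w = v # S @ bar v # R" for k v S R
  proof -
    have "knot_word (v # S @ bar v # R)"
      using same_knot_rotate[OF w, of k] r by (simp add: same_knot_def)
    then have "knot_word (bar v # R @ bar (bar v) # S)"
      using knot_word_append[of "v # S" "bar v # R"] by simp
    then show ?thesis by (rule loop_index)
  qed
  then show ?thesis using knot_wordD(1)[OF w] by (simp add: balanced_def)
qed

lemma balanced_rotate: "balanced w \<Longrightarrow> balanced (rotate n w)"
  unfolding balanced_def using gauss_word_perm[of w "rotate n w"]
  by (simp add: rotate_rotate) (metis gauss_word_distinct)

lemma lk_sum:
  assumes "distinct U"
  shows "lk U A = (\<Sum>x\<in>{x\<in>set U. bar x \<in> A}. eps x)"
proof -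
  have "lk U A = (\<Sum>x\<in>set U. if bar x \<in> A then eps x else 0)"
    unfolding lk_def using assms by (simp add: sum_list_distinct_conv_sum_set)
  then show ?thesis by (simp add: sum.inter_filter)
qed

lemma a2_Cons_over: "over v \<Longrightarrow> v \<notin> set u \<Longrightarrow> a2 (v # u) = a2 u"
  by (simp add: a2_def apairs_Cons)

lemma a2_snoc_over: "over v \<Longrightarrow> v \<notin> set u \<Longrightarrow> a2 (u @ [v]) = a2 u"
  by (simp add: a2_def apairs_snoc)

text \<open>Counted quadruples begin and end with an under passage, so moving the base point past an
  over passage changes nothing. Moving it past an under passage \<open>v\<close> loses the pairs
  \<open>(v, y)\<close> and gains the pairs \<open>(x, bar v)\<close>; the index identity balances
  the two sums.\<close>

lemma a2_rotate1:
  assumes b: "balanced w"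
  shows "a2 (rotate1 w) = a2 w"
proof (cases w)
  case (Cons v u)
  have g: "gauss_word w" "distinct w" using b gauss_word_distinct by (auto simp: balanced_def)
  have v: "v \<notin> set u" using g Cons by simp
  show ?thesis
  proof (cases "over v")
    case True
    then show ?thesis using v Cons by (simp add: a2_Cons_over a2_snoc_over)
  next
    case False
    have "bar v \<in> set u" using gauss_word_bar[OF g(1), of v] Cons by simp
    then obtain S R where u: "u = S @ bar v # R" by (auto simp: in_set_conv_decomp)
    have lk0: "lk S (set R) = 0"
      using b Cons u unfolding balanced_def by (metis id_apply rotate0)
    have d: "distinct (S @ bar v # R)" using g(2) Cons u by simp
    let ?A = "{y \<in> set S. bar y \<in> set R \<and> over y}" and ?B = "{y \<in> set S. bar y \<in> set R \<and> \<not> over y}"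
    have 1: "{(x, y). x = v \<and> \<not> over v \<and> over y \<and> subseq [y, bar v, bar y] u} = Pair v ` ?A"
      unfolding u subseq_mid[OF d] using False by auto
    have 2: "{(x, y). y = bar v \<and> \<not> over v \<and> \<not> over x \<and> subseq [x, bar v, bar x] u} = (\<lambda>x. (x, bar v)) ` ?B"
      unfolding u subseq_mid[OF d] using False by auto
    have au: "apairs u \<subseteq> set u \<times> set u" by (rule apairs_subset)
    have "apairs u \<inter> Pair v ` ?A = {}" using au v by auto
    then have c1: "a2 w = a2 u + (\<Sum>y\<in>?A. sg v * sg y)"
      unfolding a2_def Cons apairs_Cons[OF v] 1
      by (subst sum.union_disjoint) (auto simp: sum.reindex inj_on_def)
    have "\<not> subseq [x, bar v, bar x, v] u" for x using v by (auto dest: subseq_set)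
    then have "apairs u \<inter> (\<lambda>x. (x, bar v)) ` ?B = {}" by (auto simp: apairs_def)
    then have c2: "a2 (rotate1 w) = a2 u + (\<Sum>y\<in>?B. sg y * sg v)"
      unfolding a2_def Cons rotate1.simps apairs_snoc[OF v] 2
      by (subst sum.union_disjoint) (auto simp: sum.reindex inj_on_def)
    \<comment> \<open>Among the crossings between the two loops at \<open>v\<close>, those passed
      over in \<open>S\<close> were counted before and those passed under are counted afterwards. As
      \<open>eps\<close> is plus or minus \<open>sg\<close> accordingly, the index is the difference
      of the two sums.\<close>
    have "{x \<in> set S. bar x \<in> set R} = ?A \<union> ?B" by auto
    then have "lk S (set R) = (\<Sum>x\<in>?A \<union> ?B. eps x)" using lk_sum d by simp
    also have "\<dots> = (\<Sum>x\<in>?A. eps x) + (\<Sum>x\<in>?B. eps x)"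
      by (rule sum.union_disjoint) auto
    also have "(\<Sum>x\<in>?A. eps x) = (\<Sum>x\<in>?A. sg x)"
      by (rule sum.cong) (auto simp: eps_def sg_def fr_def)
    also have "(\<Sum>x\<in>?B. eps x) = (\<Sum>x\<in>?B. - sg x)"
      by (rule sum.cong) (auto simp: eps_def sg_def fr_def)
    finally have "(\<Sum>x\<in>?A. sg x) = (\<Sum>x\<in>?B. sg x)" using lk0 by (simp add: sum_negf)
    then show ?thesis unfolding c1 c2
      by (simp add: sum_distrib_left[symmetric] sum_distrib_right[symmetric])
  qed
qed simp

lemma a2_rotate: "balanced w \<Longrightarrow> a2 (rotate n w) = a2 w"
  by (induction n) (simp_all add: a2_rotate1 balanced_rotate)

lemma a2_append: "balanced (u @ v) \<Longrightarrow> a2 (v @ u) = a2 (u @ v)"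
  using a2_rotate[of "u @ v" "length u"] by (simp add: rotate_append)

text \<open>The order under, over, over, under is a palindrome; the pair is replaced by the one
  consisting of the other two passages.\<close>

lemma a2_rev: "a2 (rev w) = a2 w"
proof -
  have "subseq [x, y, bar x, bar y] (rev w) = subseq [bar y, bar x, y, x] w" for x y
    using subseq_rev[of "[bar y, bar x, y, x]" w] by simp
  then have "bij_betw (\<lambda>(x, y). (bar y, bar x)) (apairs w) (apairs (rev w))"
    by (intro bij_betw_byWitness[where f' = "\<lambda>(x, y). (bar y, bar x)"]) (auto simp: apairs_def)
  from sum.reindex_bij_betw[OF this, of "\<lambda>(x, y). sg x * sg y"] show ?thesis
    by (simp add: a2_def case_prod_unfold mult.commute)
qed

lemma a2_map:
  assumes w: "gauss_word w" and f: "inj_on f (crossing ` set w)"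
  shows "a2 (map (\<lambda>v. Passage (f (crossing v)) (over v) (positive v)) w) = a2 w"
proof -
  let ?g = "\<lambda>v. Passage (f (crossing v)) (over v) (positive v)"
  have gb: "?g (bar v) = bar (?g v)" for v by (simp add: bar_def)
  have inj: "inj_on ?g (set w)"
    using f by (auto intro!: inj_onI passage.expand dest: inj_onD)
  have "apairs (map ?g w) = map_prod ?g ?g ` apairs w"
  proof
    show "map_prod ?g ?g ` apairs w \<subseteq> apairs (map ?g w)"
      by (auto simp: apairs_def bar_def dest!: subseq_map[of _ w ?g])
    show "apairs (map ?g w) \<subseteq> map_prod ?g ?g ` apairs w"
    proof
      fix p assume "p \<in> apairs (map ?g w)"
      then obtain X Y where p: "p = (X, Y)" "\<not> over X" "over Y" "subseq [X, Y, bar X, bar Y] (map ?g w)"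
        by (auto simp: apairs_def)
      from p(4) obtain N where "[X, Y, bar X, bar Y] = nths (map ?g w) N"
        unfolding subseq_conv_nths by blast
      then have N: "[X, Y, bar X, bar Y] = map ?g (nths w N)" by (simp only: nths_map)
      then obtain x y x' y' where L: "nths w N = [x, y, x', y']" "X = ?g x" "Y = ?g y" "bar X = ?g x'" "bar Y = ?g y'"
        by (auto simp: Cons_eq_map_conv)
      have sub: "subseq [x, y, x', y'] w" unfolding subseq_conv_nths using L(1) by (intro exI[of _ N]) simp
      then have m: "x \<in> set w" "y \<in> set w" "x' \<in> set w" "y' \<in> set w"
        using subseq_set[OF sub] by auto
      have "?g x' = ?g (bar x)" "?g y' = ?g (bar y)"
        using L(2-5) unfolding gb by (simp_all only:)
      then have "x' = bar x" "y' = bar y"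
        using inj_onD[OF inj] m gauss_word_bar[OF w] by blast+
      moreover have "\<not> over x" "over y" using p(2,3) L(2,3) by simp_all
      ultimately have "(x, y) \<in> apairs w" using sub by (simp add: apairs_def)
      moreover have "p = map_prod ?g ?g (x, y)" using p(1) L(2,3) by (simp only: map_prod_simp)
      ultimately show "p \<in> map_prod ?g ?g ` apairs w" by (rule rev_image_eqI)
    qed
  qed
  moreover have "inj_on (map_prod ?g ?g) (apairs w)"
    by (rule inj_on_subset[OF map_prod_inj_on[OF inj inj] apairs_subset])
  ultimately show ?thesis
    unfolding a2_def by (simp only: sum.reindex o_def case_prod_unfold fst_map_prod snd_map_prod sg_def passage.sel)
qed

section \<open>Effect of local moves on the invariant\<close>

lemma apairs_remove:
  assumes "p \<notin> set (S @ R)" "\<not> over q" "q = bar p"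
  shows "apairs (S @ q # R) = apairs (S @ R)"
proof -
  have "subseq [x, y, bar x, bar y] (S @ q # R) \<longleftrightarrow> subseq [x, y, bar x, bar y] (S @ R)"
    if "\<not> over x" "over y" for x y
  proof (cases "q \<in> {x, bar y}")
    case False
    then show ?thesis using that assms by (intro subseq_remove) auto
  next
    case True
    then have "p = bar x \<or> p = y" using assms by auto
    moreover have "p \<notin> set (S @ q # R)" using assms by auto
    ultimately show ?thesis using assms(1) by (auto dest!: subseq_set)
  qed
  then show ?thesis by (auto simp: apairs_def)
qed

text \<open>A crossing whose over passage starts the word belongs to no counted pair: as
  \<open>x\<close> it would have to be met under first, as \<open>y\<close> it would need a letter
  before it. This makes the first two Reidemeister moves easy and removes the negative crossing from
  the count.\<close>

lemma a2_over_first: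
  assumes "distinct (p # S @ bar p # R)" "over p"
  shows "a2 (p # S @ bar p # R) = a2 (S @ R)"
  using assms a2_Cons_over[of p "S @ bar p # R"] apairs_remove[of p S R "bar p"] by (simp add: a2_def)

text \<open>The base point is moved right before the over passage of the kink.\<close>

lemma a2_R1:
  assumes w: "knot_word (xs @ [p, bar p] @ ys)"
  shows "a2 (xs @ [p, bar p] @ ys) = a2 (xs @ ys)"
proof -
  have b: "balanced (xs @ [p, bar p] @ ys)" "balanced (xs @ ys)"
    using knot_word_balanced w knot_word_R1[OF w] by auto
  have d: "distinct (xs @ [p, bar p] @ ys)" by (rule knot_wordD[OF w])
  have "a2 (xs @ [p, bar p] @ ys) = a2 (ys @ xs)"
  proof (cases "over p")
    case True
    have "a2 (xs @ [p, bar p] @ ys) = a2 (p # [] @ bar p # (ys @ xs))"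
      using a2_append[OF b(1)] by simp
    also have "\<dots> = a2 (ys @ xs)" using True d by (subst a2_over_first) auto
    finally show ?thesis .
  next
    case False
    have "a2 (xs @ [p, bar p] @ ys) = a2 (bar p # (ys @ xs) @ bar (bar p) # [])"
      using a2_append[of "xs @ [p]" "bar p # ys"] b(1) by simp
    also have "\<dots> = a2 (ys @ xs)" using False d by (subst a2_over_first) auto
    finally show ?thesis .
  qed
  then show ?thesis using a2_append[OF b(2)] by simp
qed

text \<open>The two over passages of the bigon are adjacent, so the base point can be moved right
  before both of them, where neither crossing counts.\<close>

lemma a2_R2:
  assumes w: "knot_word (xs @ [p, q] @ ys @ [p', q'] @ zs)" and v: "knot_word (xs @ ys @ zs)"
    and pq: "over p = over q" and b: "p' = bar p \<and> q' = bar q \<or> p' = bar q \<and> q' = bar p"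
  shows "a2 (xs @ [p, q] @ ys @ [p', q'] @ zs) = a2 (xs @ ys @ zs)"
proof -
  have bal: "balanced (xs @ [p, q] @ ys @ [p', q'] @ zs)" "balanced (xs @ ys @ zs)"
    using knot_word_balanced w v by auto
  have first: "a2 ([u, v] @ us @ [u', v'] @ vs) = a2 (us @ vs)"
    if d: "distinct ([u, v] @ us @ [u', v'] @ vs)" and o: "over u" "over v"
      and b: "u' = bar u \<and> v' = bar v \<or> u' = bar v \<and> v' = bar u" for u v u' v' us vs
  proof (rule disjE[OF b])
    assume "u' = bar u \<and> v' = bar v"
    then have "a2 ([u, v] @ us @ [u', v'] @ vs) = a2 (u # (v # us) @ bar u # ([bar v] @ vs))" by simp
    also have "\<dots> = a2 (v # us @ bar v # vs)"
      using a2_over_first[of u "v # us" "[bar v] @ vs"] d o \<open>u' = bar u \<and> v' = bar v\<close> by simp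
    also have "\<dots> = a2 (us @ vs)"
      using a2_over_first[of v us vs] d o \<open>u' = bar u \<and> v' = bar v\<close> by simp
    finally show ?thesis .
  next
    assume "u' = bar v \<and> v' = bar u"
    then have "a2 ([u, v] @ us @ [u', v'] @ vs) = a2 (u # (v # us @ [bar v]) @ bar u # vs)" by simp
    also have "\<dots> = a2 (v # us @ bar v # vs)"
      using a2_over_first[of u "v # us @ [bar v]" vs] d o \<open>u' = bar v \<and> v' = bar u\<close> by simp
    also have "\<dots> = a2 (us @ vs)"
      using a2_over_first[of v us vs] d o \<open>u' = bar v \<and> v' = bar u\<close> by simp
    finally show ?thesis .
  qed
  have d: "distinct (xs @ [p, q] @ ys @ [p', q'] @ zs)" by (rule knot_wordD[OF w])
  show ?thesis
  proof (cases "over p")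
    case True
    have "a2 (xs @ [p, q] @ ys @ [p', q'] @ zs) = a2 ([p, q] @ ys @ [p', q'] @ zs @ xs)"
      using a2_append[OF bal(1)] by simp
    also have "\<dots> = a2 (ys @ zs @ xs)" by (rule first) (use d True pq b in auto)
    finally show ?thesis using a2_append[of xs "ys @ zs"] bal(2) by simp
  next
    case False
    have "a2 (xs @ [p, q] @ ys @ [p', q'] @ zs) = a2 ([p', q'] @ (zs @ xs) @ [p, q] @ ys)"
      using a2_append[of "xs @ [p, q] @ ys" "[p', q'] @ zs"] bal(1) by simp
    also have "\<dots> = a2 ((zs @ xs) @ ys)" by (rule first) (use d False pq b in auto)
    finally show ?thesis using a2_append[of "xs @ ys" zs] bal(2) by simp
  qed
qed

lemma subseq_filter_iff: "set L \<subseteq> A \<Longrightarrow> subseq L w \<longleftrightarrow> subseq L (filter (\<lambda>v. v \<in> A) w)"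
proof
  assume "set L \<subseteq> A"
  then have "filter (\<lambda>v. v \<in> A) L = L" by (auto simp: filter_id_conv)
  moreover assume "subseq L w"
  ultimately show "subseq L (filter (\<lambda>v. v \<in> A) w)" by (metis subseq_filter)
qed (metis subseq_filter_left subseq_order.order_trans)

lemma subseq_swap:
  assumes "a \<notin> set L \<or> b \<notin> set L"
  shows "subseq L (xs @ [a, b] @ ys) \<longleftrightarrow> subseq L (xs @ [b, a] @ ys)"
  using assms
proof
  assume "a \<notin> set L"
  then show ?thesis using subseq_remove[of a L xs "b # ys"] subseq_remove[of a L "xs @ [b]" ys] by simp
next
  assume "b \<notin> set L"
  then show ?thesis using subseq_remove[of b L xs "a # ys"] subseq_remove[of b L "xs @ [a]" ys] by simp
qed

text \<open>Each exchange concerns two letters of different crossings of the triangle. Only a pair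
  made of both these crossings can notice it, so the change is that of the word reduced to the six
  letters of the triangle.\<close>

lemma a2_swap:
  assumes w: "gauss_word ([a1, b1] @ P @ [a2', b2] @ Q @ [a3, b3] @ R)"
    and bars: "{bar a1, bar b1, bar a2', bar b2, bar a3, bar b3} = {a1, b1, a2', b2, a3, b3}"
    and ne: "crossing a1 \<noteq> crossing b1" "crossing a2' \<noteq> crossing b2" "crossing a3 \<noteq> crossing b3"
  shows "a2 ([a1, b1] @ P @ [a2', b2] @ Q @ [a3, b3] @ R) - a2 ([b1, a1] @ P @ [b2, a2'] @ Q @ [b3, a3] @ R) =
    a2 [a1, b1, a2', b2, a3, b3] - a2 [b1, a1, b2, a2', b3, a3]"
proof -
  let ?w = "[a1, b1] @ P @ [a2', b2] @ Q @ [a3, b3] @ R" and ?w' = "[b1, a1] @ P @ [b2, a2'] @ Q @ [b3, a3] @ R"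
  let ?A = "{a1, b1, a2', b2, a3, b3}"
  have d: "distinct ?w" using gauss_word_distinct[OF w] .
  have barA: "bar v \<in> ?A \<longleftrightarrow> v \<in> ?A" for v
  proof -
    have A: "bar ` ?A = ?A" using bars by (simp only: image_insert image_empty)
    have "bar u \<in> ?A" if "u \<in> ?A" for u using imageI[OF that, of bar] unfolding A .
    from this[of v] this[of "bar v"] show ?thesis unfolding bar_simps(4) by (rule iffI[rotated])
  qed
  have split: "a2 u = a2 (filter (\<lambda>v. v \<in> ?A) u) + (\<Sum>(x, y)\<in>apairs u - ?A \<times> ?A. sg x * sg y)" for u
  proof -
    have "apairs (filter (\<lambda>v. v \<in> ?A) u) = apairs u \<inter> ?A \<times> ?A"
    proof (intro equalityI subsetI)
      fix p assume p: "p \<in> apairs (filter (\<lambda>v. v \<in> ?A) u)"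
      then have "p \<in> set (filter (\<lambda>v. v \<in> ?A) u) \<times> set (filter (\<lambda>v. v \<in> ?A) u)"
        by (rule subsetD[OF apairs_subset])
      then have "p \<in> ?A \<times> ?A" unfolding set_filter by blast
      moreover have "p \<in> apairs u"
        using p subseq_order.order_trans[OF _ subseq_filter_left] unfolding apairs_def by blast
      ultimately show "p \<in> apairs u \<inter> ?A \<times> ?A" by blast
    next
      fix p assume p: "p \<in> apairs u \<inter> ?A \<times> ?A"
      then obtain x y where xy: "p = (x, y)" "x \<in> ?A" "y \<in> ?A" "\<not> over x" "over y" "subseq [x, y, bar x, bar y] u"
        unfolding apairs_def by blast
      have "set [x, y, bar x, bar y] \<subseteq> ?A"
        unfolding set_simps by (intro insert_subsetI empty_subsetI xy(2,3) iffD2[OF barA])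
      from subseq_filter_iff[OF this, of u] xy show "p \<in> apairs (filter (\<lambda>v. v \<in> ?A) u)"
        by (simp add: apairs_def)
    qed
    then show ?thesis
      unfolding a2_def by (simp add: sum.Int_Diff[of "apairs u" _ "?A \<times> ?A"])
  qed
  have f: "filter (\<lambda>v. v \<in> ?A) ?w = [a1, b1, a2', b2, a3, b3]" "filter (\<lambda>v. v \<in> ?A) ?w' = [b1, a1, b2, a2', b3, a3]"
  proof -
    have "filter (\<lambda>v. v \<in> ?A) P = []" "filter (\<lambda>v. v \<in> ?A) Q = []" "filter (\<lambda>v. v \<in> ?A) R = []"
      using d by (auto simp: filter_empty_conv)
    then show "filter (\<lambda>v. v \<in> ?A) ?w = [a1, b1, a2', b2, a3, b3]" "filter (\<lambda>v. v \<in> ?A) ?w' = [b1, a1, b2, a2', b3, a3]"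
      by simp_all
  qed
  have "subseq [x, y, bar x, bar y] ?w \<longleftrightarrow> subseq [x, y, bar x, bar y] ?w'" if "(x, y) \<notin> ?A \<times> ?A" for x y
  proof -
    have pr: "a \<notin> set [x, y, bar x, bar y] \<or> b \<notin> set [x, y, bar x, bar y]"
      if ab: "a \<in> ?A" "b \<in> ?A" "crossing a \<noteq> crossing b" for a b
    proof (rule ccontr)
      assume "\<not> ?thesis"
      then have m: "a \<in> set [x, y, bar x, bar y]" "b \<in> set [x, y, bar x, bar y]" by blast+
      consider "a = x \<or> a = bar x" "b = y \<or> b = bar y" | "a = y \<or> a = bar y" "b = x \<or> b = bar x"
        using m ab(3) by fastforce
      then have "x \<in> ?A \<and> y \<in> ?A" using ab(1,2) barA[of x] barA[of y] by cases metis+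
      with \<open>(x, y) \<notin> ?A \<times> ?A\<close> show False by blast
    qed
    let ?L = "[x, y, bar x, bar y]"
    have "subseq ?L ?w \<longleftrightarrow> subseq ?L ([b1, a1] @ P @ [a2', b2] @ Q @ [a3, b3] @ R)"
      using subseq_swap[OF pr[of a1 b1], of "[]"] ne by simp
    also have "\<dots> \<longleftrightarrow> subseq ?L ([b1, a1] @ P @ [b2, a2'] @ Q @ [a3, b3] @ R)"
      using subseq_swap[OF pr[of a2' b2], of "[b1, a1] @ P"] ne by simp
    also have "\<dots> \<longleftrightarrow> subseq ?L ?w'"
      using subseq_swap[OF pr[of a3 b3], of "[b1, a1] @ P @ [b2, a2'] @ Q"] ne by simp
    finally show ?thesis .
  qed
  then have "apairs ?w - ?A \<times> ?A = apairs ?w' - ?A \<times> ?A"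
    unfolding apairs_def by blast
  then show ?thesis
    using split[of ?w] split[of ?w'] unfolding f by simp
qed

lemma a2_Nil [simp]: "a2 [] = 0"
  by (simp add: a2_def apairs_def)

lemma a2_Cons:
  assumes "v \<notin> set u" "distinct u"
  shows "a2 (v # u) = (if over v then 0 else
     (\<Sum>y\<leftarrow>u. if over y \<and> subseq [y, bar v, bar y] u then sg v * sg y else 0)) + a2 u"
proof (cases "over v")
  case False
  let ?Y = "{y \<in> set u. over y \<and> subseq [y, bar v, bar y] u}"
  have 1: "{(x, y). x = v \<and> \<not> over v \<and> over y \<and> subseq [y, bar v, bar y] u} = Pair v ` ?Y"
    using False subseq_set[of "[_, bar v, _]" u] by (auto simp: image_iff)
  have "apairs u \<inter> Pair v ` ?Y = {}" using assms apairs_subset[of u] by auto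
  then have "a2 (v # u) = a2 u + (\<Sum>y\<in>?Y. sg v * sg y)"
    unfolding a2_def apairs_Cons[OF assms(1)] 1
    by (subst sum.union_disjoint) (auto simp: sum.reindex inj_on_def)
  also have "(\<Sum>y\<in>?Y. sg v * sg y) = (\<Sum>y\<in>set u. if over y \<and> subseq [y, bar v, bar y] u then sg v * sg y else 0)"
    by (simp add: sum.inter_filter)
  also have "\<dots> = (\<Sum>y\<leftarrow>u. if over y \<and> subseq [y, bar v, bar y] u then sg v * sg y else 0)"
    using assms(2) by (simp add: sum_list_distinct_conv_sum_set)
  finally show ?thesis using False by simp
qed (use assms a2_Cons_over in simp)

text \<open>A finite computation on words of six letters: the directions of the three arcs and the
  levels at the three corners leave 64 cases, and \<open>tri\<close> then fixes the signs. The two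
  statements are for the two cyclic orders of the arcs along the knot.\<close>

lemma tri_a2:
  assumes t: "tri (a1, b1) (a2', b2) (a3, b3)"
  shows "a2 [a1, b1, a2', b2, a3, b3] - a2 [b1, a1, b2, a2', b3, a3] \<in>
      (if over a1 \<noteq> over b1 \<and> over a2' \<noteq> over b2 \<and> over a3 \<noteq> over b3 then {1, - 1} else {0})"
    and "a2 [a1, b1, a3, b3, a2', b2] - a2 [b1, a1, b3, a3, b2, a2'] \<in>
      (if over a1 \<noteq> over b1 \<and> over a2' \<noteq> over b2 \<and> over a3 \<noteq> over b3 then {1, - 1} else {0})"
proof -
  obtain d1 d2 d3 :: bool and x y z where A: "a1 = (if d1 then y else x)" "b1 = (if d1 then x else y)"
    "a2' = (if d2 then bar x else z)" "b2 = (if d2 then z else bar x)"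
    "a3 = (if d3 then bar z else bar y)" "b3 = (if d3 then bar y else bar z)"
    and f: "fr x = (d1 = d2)" "fr z = (d2 = d3)" "fr y = (d3 \<noteq> d1)"
    and ne: "crossing x \<noteq> crossing y" "crossing y \<noteq> crossing z" "crossing x \<noteq> crossing z"
    using triD[OF t] by (elim exE conjE) (rule that)
  have "x \<noteq> y" "x \<noteq> z" "y \<noteq> z" "x \<noteq> bar y" "x \<noteq> bar z" "y \<noteq> bar z" "y \<noteq> bar x" "z \<noteq> bar x" "z \<noteq> bar y"
    using ne by (metis bar_simps(1))+
  note nes = this this[symmetric]
  have sgs: "sg x = (if over x = (d1 = d2) then 1 else - 1)" "sg z = (if over z = (d2 = d3) then 1 else - 1)"
    "sg y = (if over y = (d3 \<noteq> d1) then 1 else - 1)"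
    using f by (auto simp: sg_def fr_def)
  show "a2 [a1, b1, a2', b2, a3, b3] - a2 [b1, a1, b2, a2', b3, a3] \<in>
      (if over a1 \<noteq> over b1 \<and> over a2' \<noteq> over b2 \<and> over a3 \<noteq> over b3 then {1, - 1} else {0})"
    using sgs unfolding A
    by (cases d1; cases d2; cases d3; cases "over x"; cases "over y"; cases "over z"; simp add: a2_Cons nes)
  show "a2 [a1, b1, a3, b3, a2', b2] - a2 [b1, a1, b3, a3, b2, a2'] \<in>
      (if over a1 \<noteq> over b1 \<and> over a2' \<noteq> over b2 \<and> over a3 \<noteq> over b3 then {1, - 1} else {0})"
    using sgs unfolding A
    by (cases d1; cases d2; cases d3; cases "over x"; cases "over y"; cases "over z"; simp add: a2_Cons nes)
qed

lemma rotate_balanced_a2: "knot_word w \<Longrightarrow> a2 (rotate k w) = a2 w"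
  by (rule a2_rotate[OF knot_word_balanced])

lemma a2_push_triangle:
  assumes w: "knot_word w" and w': "knot_word (push_triangle w T)" and T: "triangle w T"
  shows "a2 w - a2 (push_triangle w T) \<in> (if cyclic_triangle w T then {1, - 1} else {0})"
proof -
  obtain k a1 b1 a2' b2 a3 b3 P Q R where r: "rotate k w = [a1, b1] @ P @ [a2', b2] @ Q @ [a3, b3] @ R"
    "rotate k (push_triangle w T) = [b1, a1] @ P @ [b2, a2'] @ Q @ [b3, a3] @ R"
    and t: "tri (a1, b1) (a2', b2) (a3, b3) \<or> tri (a1, b1) (a3, b3) (a2', b2)"
    and c: "cyclic_triangle w T \<longleftrightarrow> over a1 \<noteq> over b1 \<and> over a2' \<noteq> over b2 \<and> over a3 \<noteq> over b3"
    using triangle_list[OF knot_wordD(1)[OF w] T] by (elim exE conjE) (rule that)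
  have kr: "knot_word (rotate k w)" using same_knot_rotate[OF w] by (simp add: same_knot_def)
  have bars: "{bar a1, bar b1, bar a2', bar b2, bar a3, bar b3} = {a1, b1, a2', b2, a3, b3}"
  proof (rule disjE[OF t])
    assume "tri (a1, b1) (a3, b3) (a2', b2)"
    from tri_letters[OF this] show ?thesis by (simp only: insert_commute)
  qed (rule tri_letters)
  have ne: "crossing a1 \<noteq> crossing b1" "crossing a2' \<noteq> crossing b2" "crossing a3 \<noteq> crossing b3"
    using t tri_distinct(2-4) by (metis distinct_length_2_or_more)+
  have "a2 w - a2 (push_triangle w T) = a2 (rotate k w) - a2 (rotate k (push_triangle w T))"
    using rotate_balanced_a2 w w' by simp
  also have "\<dots> = a2 [a1, b1, a2', b2, a3, b3] - a2 [b1, a1, b2, a2', b3, a3]"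
    unfolding r by (rule a2_swap[OF _ bars ne]) (use knot_wordD(1)[OF kr] r(1) in simp)
  also have "\<dots> \<in> (if cyclic_triangle w T then {1, - 1} else {0})"
    unfolding c using t
  proof
    assume "tri (a1, b1) (a3, b3) (a2', b2)"
    from tri_a2(2)[OF this] show "a2 [a1, b1, a2', b2, a3, b3] - a2 [b1, a1, b2, a2', b3, a3]
        \<in> (if over a1 \<noteq> over b1 \<and> over a2' \<noteq> over b2 \<and> over a3 \<noteq> over b3 then {1, - 1} else {0})"
      by (simp only: conj_commute[of "over a2' \<noteq> over b2"])
  qed (rule tri_a2(1))
  finally show ?thesis .
qed

lemma a2_word_step:
  assumes "word_step w w'" "knot_word w" "knot_word w'"
  shows "a2 w = a2 w'"
  using assms
proof (induction rule: word_step.induct)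
  case (rotate w)
  then show ?case using rotate_balanced_a2[of w 1] by simp
next
  case (reverse w)
  then show ?case by (simp add: a2_rev)
next
  case (relabel f w)
  then show ?case using a2_map[OF knot_wordD(1)] by simp
next
  case (R1 a xs ys u s)
  have "Passage a (\<not> u) s = bar (Passage a u s)" by (simp add: bar_def)
  with R1 show ?case using a2_R1[of xs "Passage a u s" ys] by simp
next
  case (R2_parallel a b xs ys zs u s)
  have "Passage a (\<not> u) s = bar (Passage a u s)" "Passage b (\<not> u) (\<not> s) = bar (Passage b u (\<not> s))"
    by (simp_all add: bar_def)
  with R2_parallel show ?case
    using a2_R2[of xs "Passage a u s" "Passage b u (\<not> s)" ys "bar (Passage a u s)" "bar (Passage b u (\<not> s))" zs]
    by simp
next
  case (R2_antiparallel a b xs ys zs u s)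
  have "Passage a (\<not> u) s = bar (Passage a u s)" "Passage b (\<not> u) (\<not> s) = bar (Passage b u (\<not> s))"
    by (simp_all add: bar_def)
  with R2_antiparallel show ?case
    using a2_R2[of xs "Passage a u s" "Passage b u (\<not> s)" ys "bar (Passage b u (\<not> s))" "bar (Passage a u s)" zs]
    by simp
next
  case (R3 w T)
  then show ?case using a2_push_triangle[of w T] by simp
qed

lemma a2_knot:
  assumes "knot_of D = knot_of D'"
  shows "a2 (word D) = a2 (word D')"
proof -
  have "equivclp diagram_step D D'" using assms by (simp add: knot.abs_eq_iff)
  then show ?thesis
  proof (induction rule: equivclp_induct)
    case (step y z)
    then have "a2 (word y) = a2 (word z)"
      unfolding diagram_step_def using a2_word_step knot_word_word by metis
    with step show ?case by simp
  qed simp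
qed

lemma a2_delta_move:
  assumes "delta_move D D'"
  shows "\<bar>a2 (word D) - a2 (word D')\<bar> = 1"
proof -
  obtain T where T: "cyclic_triangle (word D) T" "word D' = push_triangle (word D) T"
    using assms by (auto simp: delta_move_def)
  have "triangle (word D) T" using T(1) by (simp add: cyclic_triangle_def)
  then have "a2 (word D) - a2 (word D') \<in> {1, - 1}"
    using a2_push_triangle[of "word D" T] knot_word_word[of D] knot_word_word[of D'] T by simp
  then show ?thesis by auto
qed

section \<open>Reduction to words with one negative crossing\<close>

lemma delta_unknotting_number_1:
  assumes "delta_unknotting_number (knot_of D) = 1"
  shows "\<bar>a2 (word D)\<bar> = 1"
proof -
  let ?S = "{enat n | n. (delta_related ^^ n) (knot_of D) trivial_knot}"
  have I: "Inf ?S = 1" using assms by (simp add: delta_unknotting_number_def delta_gordian_distance_def)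
  have "?S \<noteq> {}"
  proof
    assume "?S = {}"
    then have "Inf ?S = \<infinity>" by (simp add: Inf_enat_def)
    with I show False by simp
  qed
  \<comment> \<open>The infimum of a nonempty set of extended naturals is attained, so a single move
    actually exists.\<close>
  then have "Inf ?S \<in> ?S" by (metis (no_types, lifting) Inf_enat_def LeastI ex_in_conv)
  then have "(delta_related ^^ 1) (knot_of D) trivial_knot"
    using I by (auto simp: one_enat_def)
  then have "delta_related (knot_of D) trivial_knot" by (simp add: relcompp_apply eq_OO)
  then obtain D1 D2 where D: "knot_of D1 = knot_of D" "knot_of D2 = trivial_knot" "delta_move D1 D2"
    by (auto simp: delta_related_def)
  have "word (Diagram []) = []" by (rule word_Diagram) (simp add: knot_word_def gauss_word_def planar_def)
  then have "a2 (word D2) = 0" using a2_knot[of D2 "Diagram []"] D(2) by (simp add: trivial_knot_def)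
  moreover have "a2 (word D1) = a2 (word D)" using a2_knot D(1) by blast
  ultimately show ?thesis using a2_delta_move[OF D(3)] by simp
qed

definition negatives :: "passage list \<Rightarrow> nat set" where
  "negatives w = crossing ` {v \<in> set w. \<not> positive v}"

lemma negative_crossings_word: "negative_crossings D = negatives (word D)"
  by (simp add: negative_crossings_def negatives_def)

text \<open>With the base point at the over passage of \<open>c\<close>, this crossing does not
  count, and every remaining pair contributes \<open>1 * 1\<close>.\<close>

lemma a2_eq_card:
  assumes "over c" "distinct (c # S @ bar c # R)" "\<And>v. v \<in> set (S @ R) \<Longrightarrow> positive v"
  shows "a2 (c # S @ bar c # R) = int (card (apairs (S @ R)))"
proof -
  have "a2 (c # S @ bar c # R) = a2 (S @ R)" using assms by (intro a2_over_first) auto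
  also have "\<dots> = (\<Sum>p\<in>apairs (S @ R). 1)"
    unfolding a2_def using apairs_subset[of "S @ R"] assms(3) by (intro sum.cong) (auto simp: sg_def)
  finally show ?thesis by simp
qed

lemma negative_first:
  assumes w: "knot_word w" and c: "card (negatives w) = 1"
  shows "\<exists>n c S R. rotate n w = c # S @ bar c # R \<and> over c \<and> \<not> positive c \<and> (\<forall>v\<in>set (S @ R). positive v)"
proof -
  note g = knot_wordD[OF w]
  obtain a where a: "negatives w = {a}" using c by (auto simp: card_1_singleton_iff)
  then have "a \<in> negatives w" by simp
  then obtain v where v: "v \<in> set w" "\<not> positive v" "a = crossing v" by (auto simp: negatives_def)
  define c where "c = (if over v then v else bar v)"
  have c: "c \<in> set w" "over c" "\<not> positive c" "crossing c = a"
    using v gauss_word_bar[OF g(1)] by (auto simp: c_def)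
  obtain xs ys where w': "w = xs @ c # ys" using c(1) by (auto simp: in_set_conv_decomp)
  have "bar c \<in> set (ys @ xs)" using gauss_word_bar[OF g(1) c(1)] w' by auto
  then obtain S R where SR: "ys @ xs = S @ bar c # R" using split_list[of "bar c" "ys @ xs"] by blast
  have r: "rotate (length xs) w = c # S @ bar c # R" by (simp add: w' rotate_append SR)
  have d: "distinct (c # S @ bar c # R)" using g(3) r by (metis distinct_rotate)
  have st: "set w = set (c # S @ bar c # R)" using r by (metis set_rotate)
  have "positive v" if "v \<in> set (S @ R)" for v
  proof (rule ccontr)
    assume n: "\<not> positive v"
    have vw: "v \<in> set w" using that st by auto
    then have "crossing v \<in> negatives w" using n by (auto simp: negatives_def)
    then have "crossing v = crossing c" using a c(4) by simp
    then have "v = c \<or> v = bar c" using gauss_word_same_crossing[OF g(1) vw c(1)] by simp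
    then show False using that d by auto
  qed
  with r c show ?thesis by blast
qed

text \<open>Excludes the value \<open>- 1\<close>, which the absolute value in
  \<open>delta_unknotting_number_1\<close> leaves open.\<close>

lemma a2_nonneg:
  assumes w: "knot_word w" and c: "card (negatives w) = 1"
  shows "a2 w \<ge> 0"
proof -
  obtain n c S R where r: "rotate n w = c # S @ bar c # R" "over c" "\<not> positive c" "\<forall>v\<in>set (S @ R). positive v"
    using negative_first[OF assms] by blast
  have "distinct (c # S @ bar c # R)" using knot_wordD(3)[OF w] r(1) by (metis distinct_rotate)
  then have "a2 (c # S @ bar c # R) \<ge> 0" using a2_eq_card[of c S R] r by simp
  then show ?thesis using rotate_balanced_a2[OF w, of n] r(1) by simp
qed

text \<open>It suffices to find a positive diagram for each word with one negative crossing and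
  invariant one, since an almost positive knot is not positive by definition.\<close>

lemma main_reduction:
  assumes main: "\<And>w. knot_word w \<Longrightarrow> card (negatives w) = 1 \<Longrightarrow> a2 w = 1 \<Longrightarrow>
    \<exists>w'. same_knot w w' \<and> negatives w' = {}"
  shows "\<not> (\<exists>K :: knot. almost_positive_knot K \<and> delta_unknotting_number K = 1)"
proof
  assume "\<exists>K :: knot. almost_positive_knot K \<and> delta_unknotting_number K = 1"
  then obtain D where D: "\<not> positive_knot (knot_of D)" "card (negative_crossings D) = 1"
    "delta_unknotting_number (knot_of D) = 1"
    by (auto simp: almost_positive_knot_def)
  have n: "card (negatives (word D)) = 1" using D(2) by (simp add: negative_crossings_word)
  have "a2 (word D) = 1"
    using delta_unknotting_number_1[OF D(3)] a2_nonneg[OF knot_word_word n] by simp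
  from main[OF knot_word_word n this] obtain w' where w': "same_knot (word D) w'" "negatives w' = {}" by blast
  then have "knot_of (Diagram w') = knot_of D" "word (Diagram w') = w'"
    by (auto simp: same_knot_def word_inverse word_Diagram)
  then have "positive_knot (knot_of D)"
    unfolding positive_knot_def negative_crossings_word using w'(2) by metis
  with D(1) show False ..
qed

section \<open>Bigons around a local knot\<close>

text \<open>The four labels at the crossing of \<open>v\<close> for which \<open>v\<close> has the
  incoming labels \<open>i\<close> and the outgoing labels \<open>j\<close>: an inverse of
  \<open>inc\<close> and \<open>out\<close>.\<close>

definition corners :: "passage \<Rightarrow> 'b \<times> 'b \<Rightarrow> 'b \<times> 'b \<Rightarrow> bool \<Rightarrow> bool \<Rightarrow> 'b" where
  "corners v i j = (\<lambda>n e. if fr v then (if n then (if e then snd j else fst j) else (if e then snd i else fst i))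
     else (if n then (if e then snd i else snd j) else (if e then fst i else fst j)))"

lemma inc_out_corners:
  assumes "K (crossing v) = corners v i j"
  shows "inc K v = i" "out K v = j"
    "inc K (bar v) = (if fr v then (snd i, snd j) else (fst j, fst i))"
    "out K (bar v) = (if fr v then (fst i, fst j) else (snd j, snd i))"
  using assms by (auto simp: inc_def out_def corners_def)

lemma inc_out_bar:
  "inc K (bar v) = (if fr v then (snd (inc K v), snd (out K v)) else (fst (out K v), fst (inc K v)))"
  "out K (bar v) = (if fr v then (fst (inc K v), fst (out K v)) else (snd (out K v), snd (inc K v)))"
  by (auto simp: inc_def out_def)

lemma labels_inc_out:
  "range (case_prod (K (crossing v))) = {fst (inc K v), snd (inc K v), fst (out K v), snd (out K v)}"
  unfolding range_corners by (auto simp: inc_def out_def)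

lemma chain_concat:
  assumes "chain K s U t" "\<And>v. v \<in> set U \<Longrightarrow> chain K' (inc K v) (sub v) (out K v)"
  shows "chain K' s (concat (map sub U)) t"
  using assms
proof (induction U arbitrary: s)
  case (Cons v U)
  have "chain K' s (sub v) (out K v)" using Cons.prems by simp
  moreover have "chain K' (out K v) (concat (map sub U)) t" using Cons by simp
  ultimately show ?case by (simp add: chain_appendI)
qed simp

lemma split_two:
  assumes "x \<in> set U" "y \<in> set U" "x \<noteq> y" "distinct U"
  shows "\<exists>U1 U2 U3 a b. U = U1 @ a # U2 @ b # U3 \<and> (a = x \<and> b = y \<or> a = y \<and> b = x) \<and>
    {x, y} \<inter> set (U1 @ U2 @ U3) = {}"
proof -
  obtain A B where U: "U = A @ x # B" using assms(1) by (auto simp: in_set_conv_decomp)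
  then consider "y \<in> set A" | "y \<in> set B" using assms(2,3) by auto
  then show ?thesis
  proof cases
    case 1
    then obtain C D where "A = C @ y # D" by (auto simp: in_set_conv_decomp)
    then show ?thesis using U assms(3,4)
      by (intro exI[of _ C] exI[of _ D] exI[of _ B] exI[of _ y] exI[of _ x]) auto
  next
    case 2
    then obtain C D where "B = C @ y # D" by (auto simp: in_set_conv_decomp)
    then show ?thesis using U assms(3,4)
      by (intro exI[of _ A] exI[of _ C] exI[of _ D] exI[of _ x] exI[of _ y]) auto
  qed
qed

lemma concat_map_sub:
  "{x, y} \<inter> set L = {} \<Longrightarrow> concat (map (\<lambda>v. if v = x then p else if v = y then q else [v]) L) = L"
  by (induction L) auto

text \<open>A finger of the strand of \<open>bar zb\<close> is pushed across the strand of
  \<open>bar b\<close>, creating the crossings of \<open>f\<close> and \<open>g\<close>.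
  Reidemeister moves are steps only between planar words, and \<open>knot_word_R2\<close> goes in
  the direction of fewer crossings, so planarity of the larger diagram needs its own
  labelling.\<close>

lemma push_insert:
  assumes W: "knot_word ([zb, b] @ U)" and zb: "crossing zb \<noteq> crossing b"
    and fresh: "crossing f \<notin> crossing ` set ([zb, b] @ U)" "crossing g \<notin> crossing ` set ([zb, b] @ U)" "crossing f \<noteq> crossing g"
    and frfg: "fr (bar g) = (fr zb = fr b)" "fr (bar f) = (fr zb \<noteq> fr b)"
  defines "sub \<equiv> \<lambda>v. if v = bar zb then (if fr zb then [bar zb, f, g] else [g, f, bar zb])
      else if v = bar b then (if fr b then [bar b, bar f, bar g] else [bar g, bar f, bar b]) else [v]"
  shows "knot_word ([zb, b] @ concat (map sub U))"
proof -
  let ?W = "[zb, b] @ U" and ?M = "[zb, b] @ concat (map sub U)"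
  note g = knot_wordD[OF W]
  have ne: "?W \<noteq> []" by simp
  obtain K :: "nat \<Rightarrow> bool \<Rightarrow> bool \<Rightarrow> nat" and s where K: "chain K s ?W s" "card (labels K ?W) = length ?W div 2 + 2"
    using knot_word_chain[OF W ne] by (elim exE conjE)
  \<comment> \<open>Two new labels for two new crossings: \<open>t\<close> for the triangle with
    corners at \<open>zb\<close>, \<open>b\<close> and \<open>f\<close>, and \<open>t'\<close> for
    the bigon between \<open>f\<close> and \<open>g\<close>.\<close>
  obtain t where t: "t \<notin> labels K ?W" using ex_new_if_finite[OF infinite_UNIV_nat finite_labels] by blast
  obtain t' where t': "t' \<notin> insert t (labels K ?W)"
    using ex_new_if_finite[OF infinite_UNIV_nat, of "insert t (labels K ?W)"] by auto
  have inU: "bar zb \<in> set U" "bar b \<in> set U"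
    using gauss_word_bar[OF g(1), of zb] gauss_word_bar[OF g(1), of b] zb by (auto dest: arg_cong[where f = crossing])
  have s: "s = inc K zb" "out K zb = inc K b" "chain K (out K b) U s" using K(1) by auto
  \<comment> \<open>\<open>S\<close>, \<open>F\<close> and \<open>G\<close> are the regions to the
    left of the edge before \<open>zb\<close>, the edge from \<open>zb\<close> to \<open>b\<close>,
    and the edge after \<open>b\<close>. The finger cuts \<open>t\<close> off from \<open>F\<close>,
    and \<open>t'\<close> from \<open>G\<close>.\<close>
  define G where "G = fst (out K b)"
  define F where "F = fst (inc K b)"
  define S where "S = fst (inc K zb)"
  have F: "fst (out K zb) = F" using s(2) by (simp add: F_def)
  define gi where "gi = (if fr b then (S, t') else (G, F))"
  define go where "go = (if fr b then (F, G) else (t', S))"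
  define fi where "fi = (if fr b then (t, G) else (t', S))"
  define fo where "fo = (if fr b then (S, t') else (G, t))"
  define K' where "K' = K(crossing zb := corners zb (inc K zb) (t, snd (out K zb)),
     crossing b := corners b (t, snd (inc K b)) (out K b),
     crossing f := corners (bar f) fi fo, crossing g := corners (bar g) gi go)"
  have fr1: "crossing f \<noteq> crossing v" "crossing g \<noteq> crossing v" if "v \<in> set ?W" for v
    using fresh that by (metis imageI)+
  note frz = fr1[of zb] fr1[of b]
  have Kz: "K' (crossing zb) = corners zb (inc K zb) (t, snd (out K zb))"
    and Kb: "K' (crossing b) = corners b (t, snd (inc K b)) (out K b)"
    and Kf: "K' (crossing (bar f)) = corners (bar f) fi fo"
    and Kg: "K' (crossing (bar g)) = corners (bar g) gi go"
    using frz zb fresh(3) by (auto simp: K'_def)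
  have Ko: "K' (crossing v) = K (crossing v)" if "v \<in> set U" "v \<noteq> bar zb" "v \<noteq> bar b" for v
  proof -
    have vW: "v \<in> set ?W" using that by simp
    have "v \<noteq> zb" "v \<noteq> b" using g(3) that by auto
    then have "crossing v \<noteq> crossing zb" "crossing v \<noteq> crossing b"
      using gauss_word_same_crossing[OF g(1) vW, of zb] gauss_word_same_crossing[OF g(1) vW, of b] that by auto
    with fr1[OF vW] show ?thesis by (auto simp: K'_def)
  qed
  note iz = inc_out_corners[of K' zb, OF Kz] and ib = inc_out_corners[of K' b, OF Kb]
    and ifb = inc_out_corners[of K' "bar f", OF Kf] and ig = inc_out_corners[of K' "bar g", OF Kg]
  have cs: "chain K' (inc K v) (sub v) (out K v)" if v: "v \<in> set U" for v
  proof -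
    consider "v = bar zb" | "v = bar b" "v \<noteq> bar zb" | "v \<noteq> bar zb" "v \<noteq> bar b" by blast
    then show ?thesis
    proof cases
      case 1
      have nb: "bar zb \<noteq> bar b" using zb by auto
      show ?thesis
        unfolding 1 sub_def inc_out_bar[of K zb]
        using frfg iz(3,4) ifb(3,4) ig(3,4) F
        by (cases "fr zb"; cases "fr b"; simp add: gi_def go_def fi_def fo_def S_def[symmetric])
    next
      case 2
      show ?thesis
        using 2(2) unfolding 2(1) sub_def inc_out_bar[of K b]
        using frfg ib(3,4) ifb(1,2) ig(1,2)
        by (cases "fr zb"; cases "fr b"; simp add: gi_def go_def fi_def fo_def G_def[symmetric] F_def[symmetric])
    next
      case 3
      then have "inc K' v = inc K v" "out K' v = out K v" using Ko[OF v] by (simp_all add: inc_def out_def)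
      then show ?thesis using 3 by (simp add: sub_def)
    qed
  qed
  have cM: "chain K' s ?M s"
    using chain_concat[OF s(3) cs] s(1,2) iz(1,2) ib(1,2) by simp
  obtain U1 U2 U3 x1 x2 where U: "U = U1 @ x1 # U2 @ x2 # U3"
    "x1 = bar zb \<and> x2 = bar b \<or> x1 = bar b \<and> x2 = bar zb" "{bar zb, bar b} \<inter> set (U1 @ U2 @ U3) = {}"
    using split_two[OF inU] zb g(3) by fastforce
  have cU: "concat (map sub Ui) = Ui" if "{bar zb, bar b} \<inter> set Ui = {}" for Ui
    using concat_map_sub[OF that] unfolding sub_def .
  have M: "concat (map sub U) = U1 @ sub x1 @ U2 @ sub x2 @ U3"
    using cU[of U1] cU[of U2] cU[of U3] U(1,3) by auto
  have ms: "mset (sub x1) + mset (sub x2) = {#bar zb, bar b, f, g, bar f, bar g#}"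
    using U(2) zb by (auto simp: sub_def)
  have mM: "mset ?M = mset ?W + {#f, g, bar f, bar g#}"
  proof -
    have "mset ?M = {#zb, b#} + mset U1 + mset U2 + mset U3 + (mset (sub x1) + mset (sub x2))"
      unfolding M by simp
    also have "\<dots> = mset ?W + {#f, g, bar f, bar g#}" unfolding ms using U(1,2) by auto
    finally show ?thesis .
  qed
  have setM: "set ?M = set ?W \<union> {f, g, bar f, bar g}"
    using arg_cong[OF mM, of set_mset] by simp
  have notW: "x \<notin> set ?W" if "x \<in> {f, g, bar f, bar g}" for x
    using that fr1[of x] by auto
  have fg: "f \<noteq> g" "f \<noteq> bar g" "g \<noteq> bar f" using fresh(3) by auto
  have "distinct [f, g, bar f, bar g]" using fg by auto
  then have "distinct (?W @ [f, g, bar f, bar g])" using g(3) notW by auto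
  moreover have "mset (?W @ [f, g, bar f, bar g]) = mset ?M" using mM by simp
  ultimately have dM: "distinct ?M" by (metis mset_eq_imp_distinct_iff)
  have gM: "gauss_word ?M"
    unfolding gauss_word_iff setM
  proof (intro conjI ballI impI dM)
    fix v assume "v \<in> set ?W \<union> {f, g, bar f, bar g}"
    then show "bar v \<in> set ?W \<union> {f, g, bar f, bar g}"
    proof
      assume "v \<in> set ?W"
      from gauss_word_bar[OF g(1) this] show ?thesis ..
    next
      assume "v \<in> {f, g, bar f, bar g}"
      then show ?thesis by (elim insertE emptyE) simp_all
    qed
  next
    fix u v assume uv: "u \<in> set ?W \<union> {f, g, bar f, bar g}" "v \<in> set ?W \<union> {f, g, bar f, bar g}"
      "crossing u = crossing v"
    have N: "crossing x \<noteq> crossing y" if "x \<in> {f, g, bar f, bar g}" "y \<in> set ?W" for x y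
      using that(1) fr1[OF that(2)] by (elim insertE emptyE) simp_all
    have NN: "x = y \<or> x = bar y" if "x \<in> {f, g, bar f, bar g}" "y \<in> {f, g, bar f, bar g}" "crossing x = crossing y" for x y
      using that fresh(3) by (elim insertE emptyE) simp_all
    show "u = v \<or> u = bar v"
      using uv(1,2)
    proof (elim UnE)
      assume "u \<in> set ?W" "v \<in> set ?W"
      then show ?thesis by (rule gauss_word_same_crossing[OF g(1) _ _ uv(3)])
    next
      assume "u \<in> set ?W" "v \<in> {f, g, bar f, bar g}"
      from N[OF this(2,1)] show ?thesis using uv(3) by simp
    next
      assume "u \<in> {f, g, bar f, bar g}" "v \<in> set ?W"
      from N[OF this] show ?thesis using uv(3) by simp
    next
      assume "u \<in> {f, g, bar f, bar g}" "v \<in> {f, g, bar f, bar g}"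
      from NN[OF this uv(3)] show ?thesis .
    qed
  qed
  have "length ?M div 2 + 2 \<le> card (labels K' ?M)"
  proof -
    have len: "length ?M = length ?W + 4" using arg_cong[OF mM, of size] by simp
    have inM: "range (case_prod (K' (crossing v))) \<subseteq> labels K' ?M" if "v \<in> set ?M" for v
      unfolding labels_def using that by blast
    have gM': "{F, t'} \<subseteq> labels K' ?M"
    proof -
      have "bar g \<in> set ?M" unfolding setM by simp
      from inM[OF this] have "{fst gi, snd gi, fst go, snd go} \<subseteq> labels K' ?M"
        unfolding labels_inc_out ig(1,2) .
      then show ?thesis unfolding gi_def go_def by (cases "fr b") simp_all
    qed
    have zM: "{fst (inc K zb), snd (inc K zb), t, snd (out K zb)} \<subseteq> labels K' ?M"
      using inM[of zb] unfolding labels_inc_out iz(1,2) by simp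
    have bM: "{snd (inc K b), fst (out K b), snd (out K b)} \<subseteq> labels K' ?M"
      using inM[of b] unfolding labels_inc_out ib(1,2) by simp
    have "range (case_prod (K (crossing v))) \<subseteq> labels K' ?M" if v: "v \<in> set ?W" for v
    proof -
      consider "crossing v = crossing zb" | "crossing v = crossing b"
        | "crossing v \<noteq> crossing zb" "crossing v \<noteq> crossing b"
        by blast
      then show ?thesis
      proof cases
        case 1
        then show ?thesis unfolding 1 labels_inc_out F using zM gM' by auto
      next
        case 2
        then show ?thesis unfolding 2 labels_inc_out F_def[symmetric] using bM gM' by auto
      next
        case 3
        then have v3: "v \<in> set U" "v \<noteq> bar zb" "v \<noteq> bar b" using v by auto
        have "v \<in> set ?M" unfolding setM using v by simp
        from inM[OF this] show ?thesis unfolding Ko[OF v3] .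
      qed
    qed
    then have "labels K ?W \<subseteq> labels K' ?M" unfolding labels_def[of K] by blast
    then have "insert t' (insert t (labels K ?W)) \<subseteq> labels K' ?M" using zM gM' by auto
    then have "card (insert t' (insert t (labels K ?W))) \<le> card (labels K' ?M)"
      by (intro card_mono) auto
    then show ?thesis using t t' K(2) len by simp
  qed
  with gM cM show ?thesis by (intro knot_wordI)
qed

text \<open>A strand \<open>bar zb\<close> crossing the edge from \<open>zb\<close> to \<open>b\<close> is pushed over (or under) the crossing of \<open>b\<close>.\<close>

lemma push_strand:
  assumes W: "knot_word ([zb, b] @ U)" and zb: "crossing zb \<noteq> crossing b"
    and fresh: "crossing f \<notin> crossing ` set ([zb, b] @ U)" "crossing g \<notin> crossing ` set ([zb, b] @ U)" "crossing f \<noteq> crossing g"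
    and frfg: "fr (bar g) = (fr zb = fr b)" "fr (bar f) = (fr zb \<noteq> fr b)"
    and over: "over f = over (bar zb)" "over g = over (bar zb)"
  shows "same_knot ([zb, b] @ U)
    ([b, zb] @ concat (map (\<lambda>v. if v = bar zb then (if fr zb then [f, bar zb, g] else [g, bar zb, f])
      else if v = bar b then (if fr b then [bar f, bar b, bar g] else [bar g, bar b, bar f]) else [v]) U))"
proof -
  define sub where "sub = (\<lambda>v. if v = bar zb then (if fr zb then [bar zb, f, g] else [g, f, bar zb])
      else if v = bar b then (if fr b then [bar b, bar f, bar g] else [bar g, bar f, bar b]) else [v])"
  define sub' where "sub' = (\<lambda>v. if v = bar zb then (if fr zb then [f, bar zb, g] else [g, bar zb, f])
      else if v = bar b then (if fr b then [bar f, bar b, bar g] else [bar g, bar b, bar f]) else [v])"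
  let ?W = "[zb, b] @ U" and ?M = "[zb, b] @ concat (map sub U)"
  \<comment> \<open>The word with the finger lies between both sides: cancelling its bigon gives
    back the original word, and the third Reidemeister move at the triangle \<open>zb\<close>,
    \<open>b\<close>, \<open>f\<close> gives the target. That move is admissible because the pushed
    strand is on the same level at both of its corners.\<close>
  have kM: "knot_word ?M" unfolding sub_def by (rule push_insert[OF W zb fresh frfg])
  note g = knot_wordD[OF W]
  have inU: "bar zb \<in> set U" "bar b \<in> set U"
    using gauss_word_bar[OF g(1), of zb] gauss_word_bar[OF g(1), of b] zb by (auto dest: arg_cong[where f = crossing])
  obtain U1 U2 U3 x1 x2 where U: "U = U1 @ x1 # U2 @ x2 # U3"
    and x: "x1 = bar zb \<and> x2 = bar b \<or> x1 = bar b \<and> x2 = bar zb" and nU: "{bar zb, bar b} \<inter> set (U1 @ U2 @ U3) = {}"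
    using split_two[OF inU] zb g(3) by fastforce
  have cU: "concat (map sub Ui) = Ui" "concat (map sub' Ui) = Ui" if "{bar zb, bar b} \<inter> set Ui = {}" for Ui
    using concat_map_sub[OF that] unfolding sub_def sub'_def by auto
  have M: "concat (map sub U) = U1 @ sub x1 @ U2 @ sub x2 @ U3"
    "concat (map sub' U) = U1 @ sub' x1 @ U2 @ sub' x2 @ U3"
    using cU[of U1] cU[of U2] cU[of U3] U nU by auto
  have nb: "bar zb \<noteq> bar b" using zb by auto
  have fg: "over f = over g" "positive f \<noteq> positive g"
    using over frfg by (auto simp: fr_def)
  have z2: "\<exists>A1 A2 p q. sub (bar zb) = A1 @ [p, q] @ A2 \<and> A1 @ A2 = [bar zb] \<and> (p = f \<and> q = g \<or> p = g \<and> q = f)"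
  proof (cases "fr zb")
    case True
    then show ?thesis
      by (intro exI[of _ "[bar zb]"] exI[of _ "[]"] exI[of _ f] exI[of _ g]) (simp add: sub_def)
  next
    case False
    then show ?thesis
      by (intro exI[of _ "[]"] exI[of _ "[bar zb]"] exI[of _ g] exI[of _ f]) (simp add: sub_def)
  qed
  have b2: "\<exists>A1 A2 p q. sub (bar b) = A1 @ [p, q] @ A2 \<and> A1 @ A2 = [bar b] \<and> (p = bar f \<and> q = bar g \<or> p = bar g \<and> q = bar f)"
  proof (cases "fr b")
    case True
    then show ?thesis
      by (intro exI[of _ "[bar b]"] exI[of _ "[]"] exI[of _ "bar f"] exI[of _ "bar g"]) (use nb in \<open>simp add: sub_def\<close>)
  next
    case False
    then show ?thesis
      by (intro exI[of _ "[]"] exI[of _ "[bar b]"] exI[of _ "bar g"] exI[of _ "bar f"]) (use nb in \<open>simp add: sub_def\<close>)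
  qed
  obtain A1 A2 p q B1 B2 p' q' where AB: "sub x1 = A1 @ [p, q] @ A2" "A1 @ A2 = [x1]"
    "sub x2 = B1 @ [p', q'] @ B2" "B1 @ B2 = [x2]"
    and pq: "over p = over q" "positive p \<noteq> positive q" "p' = bar p \<and> q' = bar q \<or> p' = bar q \<and> q' = bar p"
  proof (rule disjE[OF x])
    assume *: "x1 = bar zb \<and> x2 = bar b"
    obtain A1 A2 p q where A: "sub x1 = A1 @ [p, q] @ A2" "A1 @ A2 = [x1]" "p = f \<and> q = g \<or> p = g \<and> q = f"
      using z2[folded conjunct1[OF *]] by (elim exE conjE) (rule that)
    obtain B1 B2 p' q' where B: "sub x2 = B1 @ [p', q'] @ B2" "B1 @ B2 = [x2]" "p' = bar f \<and> q' = bar g \<or> p' = bar g \<and> q' = bar f"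
      using b2[folded conjunct2[OF *]] by (elim exE conjE) (rule that)
    show thesis by (rule that[OF A(1,2) B(1,2)]) (use A(3) B(3) fg in auto)
  next
    assume *: "x1 = bar b \<and> x2 = bar zb"
    obtain A1 A2 p q where A: "sub x2 = A1 @ [p, q] @ A2" "A1 @ A2 = [x2]" "p = f \<and> q = g \<or> p = g \<and> q = f"
      using z2[folded conjunct2[OF *]] by (elim exE conjE) (rule that)
    obtain B1 B2 p' q' where B: "sub x1 = B1 @ [p', q'] @ B2" "B1 @ B2 = [x1]" "p' = bar f \<and> q' = bar g \<or> p' = bar g \<and> q' = bar f"
      using b2[folded conjunct1[OF *]] by (elim exE conjE) (rule that)
    show thesis by (rule that[OF B(1,2) A(1,2)]) (use A(3) B(3) fg in auto)
  qed
  have M': "?M = ([zb, b] @ U1 @ A1) @ [p, q] @ (A2 @ U2 @ B1) @ [p', q'] @ (B2 @ U3)"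
    unfolding M AB(1,3) by simp
  have "same_knot ?M (([zb, b] @ U1 @ A1) @ (A2 @ U2 @ B1) @ (B2 @ U3))"
    unfolding M' by (rule same_knot_R2[OF kM[unfolded M'] pq])
  also have "([zb, b] @ U1 @ A1) @ (A2 @ U2 @ B1) @ (B2 @ U3) = [zb, b] @ U1 @ (A1 @ A2) @ U2 @ (B1 @ B2) @ U3"
    by simp
  also have "\<dots> = ?W" unfolding AB(2,4) U by simp
  finally have MW: "same_knot ?M ?W" .
  define za where "za = (if fr zb then (bar zb, f) else (f, bar zb))"
  define ba where "ba = (if fr b then (bar b, bar f) else (bar f, bar b))"
  have tri: "tri (zb, b) ba za"
    unfolding tri_def
  proof (rule exI[of _ True], rule exI[of _ "fr b"], rule exI[of _ "\<not> fr zb"], rule exI[of _ b], rule exI[of _ zb],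
      rule exI[of _ "bar f"], intro conjI)
    show "crossing b \<noteq> crossing zb" using zb by simp
    show "crossing zb \<noteq> crossing (bar f)" "crossing b \<noteq> crossing (bar f)" using fresh(1) by auto
  qed (use frfg in \<open>auto simp: za_def ba_def\<close>)
  have z3: "\<exists>C1 C2. sub (bar zb) = C1 @ [fst za, snd za] @ C2 \<and> sub' (bar zb) = C1 @ [snd za, fst za] @ C2"
  proof (cases "fr zb")
    case True
    then show ?thesis by (intro exI[of _ "[]"] exI[of _ "[g]"]) (simp add: sub_def sub'_def za_def)
  next
    case False
    then show ?thesis by (intro exI[of _ "[g]"] exI[of _ "[]"]) (simp add: sub_def sub'_def za_def)
  qed
  have b3: "\<exists>C1 C2. sub (bar b) = C1 @ [fst ba, snd ba] @ C2 \<and> sub' (bar b) = C1 @ [snd ba, fst ba] @ C2"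
  proof (cases "fr b")
    case True
    then show ?thesis using nb by (intro exI[of _ "[]"] exI[of _ "[bar g]"]) (simp add: sub_def sub'_def ba_def)
  next
    case False
    then show ?thesis using nb by (intro exI[of _ "[bar g]"] exI[of _ "[]"]) (simp add: sub_def sub'_def ba_def)
  qed
  obtain C1 C2 D1 D2 r s where CD: "sub x1 = C1 @ [fst r, snd r] @ C2" "sub' x1 = C1 @ [snd r, fst r] @ C2"
    "sub x2 = D1 @ [fst s, snd s] @ D2" "sub' x2 = D1 @ [snd s, fst s] @ D2"
    and rs: "r = ba \<and> s = za \<or> r = za \<and> s = ba"
  proof (rule disjE[OF x])
    assume *: "x1 = bar zb \<and> x2 = bar b"
    obtain C1 C2 where C: "sub x1 = C1 @ [fst za, snd za] @ C2" "sub' x1 = C1 @ [snd za, fst za] @ C2"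
      using z3[folded conjunct1[OF *]] by (elim exE conjE) (rule that)
    obtain D1 D2 where D: "sub x2 = D1 @ [fst ba, snd ba] @ D2" "sub' x2 = D1 @ [snd ba, fst ba] @ D2"
      using b3[folded conjunct2[OF *]] by (elim exE conjE) (rule that)
    show thesis by (rule that[OF C D]) simp
  next
    assume *: "x1 = bar b \<and> x2 = bar zb"
    obtain C1 C2 where C: "sub x2 = C1 @ [fst za, snd za] @ C2" "sub' x2 = C1 @ [snd za, fst za] @ C2"
      using z3[folded conjunct2[OF *]] by (elim exE conjE) (rule that)
    obtain D1 D2 where D: "sub x1 = D1 @ [fst ba, snd ba] @ D2" "sub' x1 = D1 @ [snd ba, fst ba] @ D2"
      using b3[folded conjunct1[OF *]] by (elim exE conjE) (rule that)
    show thesis by (rule that[OF D C]) simp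
  qed
  have M'': "?M = [zb, b] @ (U1 @ C1) @ [fst r, snd r] @ (C2 @ U2 @ D1) @ [fst s, snd s] @ (D2 @ U3)"
    unfolding M CD(1,3) by simp
  have tr: "tri (zb, b) (fst r, snd r) (fst s, snd s) \<or> tri (zb, b) (fst s, snd s) (fst r, snd r)"
    using rs tri by auto
  have nc: "over zb = over b \<or> over (fst r) = over (snd r) \<or> over (fst s) = over (snd s)"
  proof -
    have "over (fst za) = over (snd za)" using over by (cases "fr zb") (simp_all add: za_def)
    with rs show ?thesis by blast
  qed
  have "same_knot ?M ([b, zb] @ (U1 @ C1) @ [snd r, fst r] @ (C2 @ U2 @ D1) @ [snd s, fst s] @ (D2 @ U3))"
    unfolding M'' by (rule same_knot_R3[OF kM[unfolded M''] tr nc])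
  also have "[b, zb] @ (U1 @ C1) @ [snd r, fst r] @ (C2 @ U2 @ D1) @ [snd s, fst s] @ (D2 @ U3) =
     [b, zb] @ concat (map sub' U)"
    unfolding M CD(2,4) by simp
  finally have "same_knot ?M ([b, zb] @ concat (map sub' U))" .
  from same_knot_trans[OF same_knot_sym[OF MW] this] show ?thesis unfolding sub'_def .
qed

lemma chain_mid: "chain K s (U @ v # V) t \<longleftrightarrow> chain K s U (inc K v) \<and> chain K (out K v) V t"
  by (induction U arbitrary: s) auto

text \<open>Every crossing between the two strands is seen with opposite signs of \<open>eps\<close>
  from its two passages.\<close>

lemma lk_swap:
  assumes "distinct U" "distinct V"
  shows "lk U (set V) = - lk V (set U)"
proof -
  have "bij_betw bar {x \<in> set U. bar x \<in> set V} {x \<in> set V. bar x \<in> set U}"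
    by (rule bij_betw_byWitness[where f' = bar]) auto
  from sum.reindex_bij_betw[OF this, of eps] show ?thesis
    unfolding lk_sum[OF assms(1)] lk_sum[OF assms(2)] by (simp add: sum_negf)
qed

lemma lk_self: "distinct U \<Longrightarrow> lk U (set U) = 0"
  using lk_swap[of U U] by simp

lemma lk_union:
  assumes "A \<inter> B = {}"
  shows "lk U (A \<union> B) = lk U A + lk U B"
  by (induction U) (use assms in \<open>auto simp: lk_Cons\<close>)

lemma lk_all: "\<forall>x\<in>set U. bar x \<in> A \<Longrightarrow> lk U A = (\<Sum>x\<leftarrow>U. eps x)"
  by (induction U) (simp_all add: lk_Cons)

lemma sum_eps_parity: "even (\<Sum>x\<leftarrow>U. eps x) \<longleftrightarrow> even (length U)"
  by (induction U) (auto simp: eps_def)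

text \<open>Crossings of \<open>S\<close> with itself cancel in pairs, and those with the rest add
  up to zero by \<open>loop_index\<close>.\<close>

lemma loop_eps:
  assumes w: "knot_word (v # S @ bar v # R)"
  shows "(\<Sum>x\<leftarrow>S. eps x) = 0"
proof -
  note g = knot_wordD[OF w]
  have d: "distinct S" "distinct R" "set S \<inter> set R = {}" using g(3) by auto
  have "bar x \<in> set S \<union> set R" if "x \<in> set S" for x
  proof -
    have "bar x \<in> set (v # S @ bar v # R)" using gauss_word_bar[OF g(1), of x] that by simp
    moreover have "bar x \<noteq> v" "bar x \<noteq> bar v" using g(3) that by auto
    ultimately show ?thesis by auto
  qed
  then have "(\<Sum>x\<leftarrow>S. eps x) = lk S (set S) + lk S (set R)"
    using lk_all[of S "set S \<union> set R"] lk_union[OF d(3)] by simp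
  also have "\<dots> = 0" using lk_self[OF d(1)] lk_swap[OF d(1,2)] loop_index[OF w] by simp
  finally show ?thesis .
qed

text \<open>Gauss's parity condition for the code of a curve on the sphere.\<close>

lemma loop_even:
  assumes w: "knot_word (v # S @ bar v # R)"
  shows "even (length S)"
  using loop_eps[OF w] sum_eps_parity[of S] by simp

text \<open>A bigon between two strands bounds a disk. A second bigon that leaves the first one at its corner
  would have to enter it.\<close>

lemma bigons_not_crossed:
  assumes w: "knot_word (a # C1 @ c # C2 @ b # C3 @ d # R)"
    and R: "R = R1 @ [x, y] @ R2" "R = R1' @ [x', y'] @ R2'"
    and xy: "x = bar a \<and> y = bar b \<or> x = bar b \<and> y = bar a"
    and xy': "x' = bar c \<and> y' = bar d \<or> x' = bar d \<and> y' = bar c"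
    and fr: "fr x = fr x'" "fr x \<noteq> fr y" "fr x' \<noteq> fr y'"
    and C: "\<forall>v\<in>set (C2 @ C3). bar v \<in> set R"
  shows False
proof -
  let ?w = "a # C1 @ c # C2 @ b # C3 @ d # R"
  have g: "gauss_word ?w" "planar ?w" "?w \<noteq> []" "distinct ?w"
    using knot_wordD[OF w] by auto
  have ab: "crossing a \<noteq> crossing b"
    using gauss_word_same_crossing[OF g(1), of a b] g(4) xy R(1) by auto
  \<comment> \<open>The arc from \<open>a\<close> to \<open>b\<close> and the edge from
    \<open>x\<close> to \<open>y\<close> form a closed curve. Jumps at its two corners give a
    potential which, modulo 2, distinguishes its two sides: the flow is odd on this curve and even
    elsewhere.\<close>
  obtain H :: "nat \<Rightarrow> bool \<Rightarrow> bool \<Rightarrow> int" and s where H: "chain H s ?w s" "flow s mod 2 = 0 mod 2"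
    "\<And>k. k \<in> crossing ` set ?w \<Longrightarrow> jump H k mod 2 = of_bool (k = crossing a \<or> k = crossing b) mod 2"
    using ex_flow[OF g(1-3), of 2 0 "\<lambda>k. of_bool (k = crossing a \<or> k = crossing b)"] by auto
  have j1: "odd (jump H (crossing a))" "odd (jump H (crossing b))"
    using H(3)[of "crossing a"] H(3)[of "crossing b"] by (simp_all add: odd_iff_mod_2_eq_one)
  have j0: "2 dvd jump H (crossing v)" if "v \<in> set ?w" "v \<notin> {a, b, bar a, bar b}" for v
  proof -
    have *: "crossing v \<noteq> crossing a" "crossing v \<noteq> crossing b"
      using gauss_word_same_crossing[OF g(1) that(1), of a] gauss_word_same_crossing[OF g(1) that(1), of b] that(2) by auto
    show ?thesis using H(3)[OF imageI[OF that(1)]] * by (simp add: mod_eq_0_iff_dvd)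
  qed
  have xyR: "set [x, y] = {bar a, bar b}"
    using xy by (elim disjE conjE) (simp_all only: list.set insert_commute)
  have ch: "chain H (out H a) (C1 @ c # C2) (inc H b)" "chain H (out H b) (C3 @ d # R1) (inc H x)"
    "inc H y = out H x" "chain H (out H y) R2 (inc H a)" "s = inc H a"
    using H(1) unfolding R(1) by (auto simp: chain_mid)
  have ne: "v \<notin> {a, b, bar a, bar b}" if "v \<in> set (C1 @ c # C2 @ C3 @ d # R1 @ R2)" for v
  proof -
    have "v \<noteq> a" "v \<noteq> b" "v \<notin> set [x, y]" using that g(4) unfolding R(1) by (simp_all, blast+)
    then show ?thesis unfolding xyR by simp
  qed
  have e: "odd (eps v)" for v by (simp add: eps_def)
  have fa: "2 dvd flow (out H a) - 1" using flow_out[of H a] j1(1) e[of a] H(2) ch(5) by auto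
  note 1 = chain_flow_const[OF ch(1) fa]
  have fb: "2 dvd flow (inc H b) - 1"
    by (rule conjunct1[OF 1]) (rule j0, use ne in auto)
  have fb': "2 dvd flow (out H b) - 0" using flow_out[of H b] j1(2) e[of b] fb by auto
  note 2 = chain_flow_const[OF ch(2) fb']
  have f2: "2 dvd flow (inc H x) - 0 \<and> (\<forall>v\<in>set (C3 @ d # R1). 2 dvd flow (inc H v) - 0 \<and> 2 dvd flow (out H v) - 0)"
    by (rule 2) (rule j0, use ne R(1) in auto)
  have jx: "odd (jump H (crossing x))" "odd (jump H (crossing y))" using xy j1 by auto
  have fx: "odd (flow (out H x))" using flow_out[of H x] jx(1) e[of x] f2 by auto
  have fy: "2 dvd flow (out H y) - 0" using flow_out[of H y] jx(2) e[of y] fx ch(3) by auto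
  note 3 = chain_flow_const[OF ch(4) fy]
  have f3: "2 dvd flow (inc H a) - 0 \<and> (\<forall>v\<in>set R2. 2 dvd flow (inc H v) - 0 \<and> 2 dvd flow (out H v) - 0)"
    by (rule 3) (rule j0, use ne R(1) in auto)
  have fR: "even (flow (inc H v)) \<and> even (flow (out H v))" if "v \<in> set R" "v \<notin> {x, y}" for v
    using that f2 f3 unfolding R(1) by auto
  define \<beta> where "\<beta> = fr x"
  \<comment> \<open>On the side \<open>\<beta>\<close>, passing \<open>b\<close> crosses exactly the
    edge from \<open>x\<close> to \<open>y\<close>, so here the potential changes parity. All other
    passages between \<open>c\<close> and \<open>d\<close> cross edges with even flow.\<close>
  have sb: "odd (side \<beta> (out H b) - side \<beta> (inc H b))"
    using side_step[of \<beta> H b] xy fr(2) fx ch(3) e[of b] unfolding \<beta>_def by auto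
  have ev: "even (side \<beta> (out H v) - side \<beta> (inc H v))" if "bar v \<in> set R" "bar v \<notin> {x, y}" for v
    using side_step[of \<beta> H v] fR[OF that] by auto
  have seg: "even (side \<beta> t - side \<beta> s)" if "chain H s U t" "\<forall>v\<in>set U. bar v \<in> set R - {x, y}" for s t U
    using that
  proof (induction U arbitrary: s)
    case (Cons v U)
    then have "even (side \<beta> t - side \<beta> (out H v))" by auto
    moreover have "even (side \<beta> (out H v) - side \<beta> (inc H v))" using ev[of v] Cons.prems by auto
    ultimately show ?case using Cons.prems(1) by auto
  qed simp
  have bc: "bar c \<in> set R - {x, y}" "bar d \<in> set R - {x, y}" using xy' xyR R(2) g(4) by auto
  have c2: "chain H (out H c) C2 (inc H b)" "chain H (out H b) C3 (inc H d)"
    using H(1) by (simp_all add: chain_mid)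
  have CR: "\<forall>v\<in>set U. bar v \<in> set R - {x, y}" if "U = C2 \<or> U = C3" for U
    using that C xyR g(4) by auto
  have s1: "even (side \<beta> (inc H b) - side \<beta> (out H c))" by (rule seg[OF c2(1) CR]) simp
  have s2: "even (side \<beta> (inc H d) - side \<beta> (out H b))" by (rule seg[OF c2(2) CR]) simp
  have s3: "even (side \<beta> (out H c) - side \<beta> (inc H c))" "even (side \<beta> (out H d) - side \<beta> (inc H d))"
    using ev bc by auto
  have xy2: "inc H y' = out H x'" using H(1) unfolding R(2) by (simp add: chain_mid)
  \<comment> \<open>\<open>c\<close> and \<open>d\<close> are joined by the edge from
    \<open>x'\<close> to \<open>y'\<close>. The equality of the labels at its two ends compares the
    corners at \<open>c\<close> and \<open>d\<close>, so there is no change of parity overall,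
    against the single change at \<open>b\<close>.\<close>
  have "even (side \<beta> (inc H d) - side \<beta> (inc H c))"
  proof -
    have b: "\<beta> = fr x'" using fr(1) by (simp add: \<beta>_def)
    show ?thesis
    proof (rule disjE[OF xy'])
      assume *: "x' = bar c \<and> y' = bar d"
      then have "inc H (bar d) = out H (bar c)" "fr d \<noteq> fr c" "\<beta> = (\<not> fr c)" using xy2 fr(3) b by simp_all
      then show ?thesis using s3
        unfolding inc_out_bar[of H c] inc_out_bar[of H d] side_def by (cases "fr c") simp_all
    next
      assume *: "x' = bar d \<and> y' = bar c"
      then have "inc H (bar c) = out H (bar d)" "fr d \<noteq> fr c" "\<beta> = fr c" using xy2 fr(3) b by simp_all
      then show ?thesis using s3
        unfolding inc_out_bar[of H c] inc_out_bar[of H d] side_def by (cases "fr c") simp_all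
    qed
  qed
  with s1 s2 s3 sb show False by simp
qed

section \<open>Sweeping a strand across a local knot\<close>

definition pty :: "('a \<Rightarrow> bool) \<Rightarrow> 'a list \<Rightarrow> bool" where
  "pty P A \<longleftrightarrow> odd (length (filter P A))"

lemma pty_simps [simp]: "\<not> pty P []" "pty P (x # A) = (P x \<noteq> pty P A)" "pty P (A @ B) = (pty P A \<noteq> pty P B)"
  by (auto simp: pty_def)

lemma pty_cong: "(\<And>v. v \<in> set A \<Longrightarrow> P v = Q v) \<Longrightarrow> pty P A = pty Q A"
  unfolding pty_def using filter_cong[of A A P Q] by simp

text \<open>
  \<open>P\<close> marks the passages of a strand that is swept across a local knot. Between an odd and the next even
  marked passage the local knot has not been swept yet.
\<close>

fun unswept :: "('a \<Rightarrow> bool) \<Rightarrow> bool \<Rightarrow> 'a list \<Rightarrow> nat" where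
  "unswept P i [] = 0"
| "unswept P i (x # A) = (if P x then unswept P (\<not> i) A else of_bool i + unswept P i A)"

lemma unswept_append: "unswept P i (A @ B) = unswept P i A + unswept P (i \<noteq> pty P A) B"
  by (induction A arbitrary: i) auto

lemma unswept_cong: "(\<And>v. v \<in> set A \<Longrightarrow> P v = Q v) \<Longrightarrow> unswept P i A = unswept Q i A"
  by (induction A arbitrary: i) auto

text \<open>A condition kept during the sweep: the marked passages of \<open>T\<close> meet the
  swept strand alternately from its two sides. Neighbouring ones then have opposite signs, as the
  cancellation of a bigon requires.\<close>

fun alternating :: "(passage \<Rightarrow> bool) \<Rightarrow> bool \<Rightarrow> passage list \<Rightarrow> bool" where
  "alternating P f [] = True"
| "alternating P f (x # A) = (if P x then fr x = f \<and> alternating P (\<not> f) A else alternating P f A)"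

lemma alternating_append: "alternating P f (A @ B) \<longleftrightarrow> alternating P f A \<and> alternating P (f \<noteq> pty P A) B"
  by (induction A arbitrary: f) auto

lemma alternating_cong: "(\<And>v. v \<in> set A \<Longrightarrow> P v = Q v) \<Longrightarrow> alternating P f A = alternating Q f A"
  by (induction A arbitrary: f) auto

text \<open>Locates the next push: a marked passage right before an unswept letter. Starting outside
  an unswept stretch, only the second alternative remains.\<close>

lemma unswept_first:
  assumes "0 < unswept P i T"
  shows "i \<and> (\<exists>b B. T = b # B \<and> \<not> P b) \<or> (\<exists>A x b B. T = A @ x # b # B \<and> P x \<and> \<not> P b \<and> pty P A = i)"
  using assms
proof (induction T arbitrary: i)
  case (Cons y T)
  show ?case
  proof (cases "P y")
    case True
    with Cons have "\<not> i \<and> (\<exists>b B. T = b # B \<and> \<not> P b) \<or> (\<exists>A x b B. T = A @ x # b # B \<and> P x \<and> \<not> P b \<and> pty P A = (\<not> i))"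
      by simp
    then show ?thesis
    proof
      assume "\<not> i \<and> (\<exists>b B. T = b # B \<and> \<not> P b)"
      then obtain b B where "\<not> i" "T = b # B" "\<not> P b" by blast
      then show ?thesis using True by (intro disjI2 exI[of _ "[]"]) simp
    next
      assume "\<exists>A x b B. T = A @ x # b # B \<and> P x \<and> \<not> P b \<and> pty P A = (\<not> i)"
      then obtain A x b B where "T = A @ x # b # B" "P x" "\<not> P b" "pty P A = (\<not> i)" by blast
      then show ?thesis using True by (intro disjI2 exI[of _ "y # A"]) auto
    qed
  next
    case False
    show ?thesis
    proof (cases i)
      case True
      with False show ?thesis by blast
    next
      case i: False
      have "0 < unswept P i T" using Cons.prems i False by simp
      from Cons.IH[OF this] i have "\<exists>A x b B. T = A @ x # b # B \<and> P x \<and> \<not> P b \<and> pty P A = i" by simp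
      then obtain A x b B where "T = A @ x # b # B" "P x" "\<not> P b" "pty P A = i" by blast
      then show ?thesis using False by (intro disjI2 exI[of _ "y # A"]) auto
    qed
  qed
qed simp

text \<open>When nothing is left unswept, no letter separates an odd marked passage from the
  following even one.\<close>

lemma swept_pair:
  assumes "unswept P False T = 0" "alternating P f T" "\<not> pty P T" "x \<in> set T" "P x"
  shows "\<exists>A B y z. T = A @ [y, z] @ B \<and> x \<in> {y, z} \<and> P y \<and> P z \<and> fr y = f \<and> fr z \<noteq> f"
proof -
  obtain A B where T: "T = A @ x # B" using assms(4) by (auto simp: in_set_conv_decomp)
  show ?thesis
  proof (cases "pty P A")
    case False
    then obtain z B' where B: "B = z # B'" using assms(3,5) T by (cases B) auto
    have "P z" using assms(1,5) False unfolding T B by (auto simp: unswept_append split: if_splits)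
    then show ?thesis using assms(2,5) False unfolding T B
      by (intro exI[of _ A] exI[of _ B'] exI[of _ x] exI[of _ z]) (auto simp: alternating_append)
  next
    case True
    then have "A \<noteq> []" by auto
    then obtain A' y where A: "A = A' @ [y]" by (cases A rule: rev_cases) auto
    have y: "P y" using assms(1) True unfolding T A by (auto simp: unswept_append split: if_splits)
    then show ?thesis using assms(2,5) True unfolding T A
      by (intro exI[of _ A'] exI[of _ B] exI[of _ y] exI[of _ x]) (auto simp: alternating_append)
  qed
qed

text \<open>The crossings of \<open>a\<close> and \<open>b\<close> are the ends of one edge on
  \<open>T\<close>. Fixing \<open>f\<close> as the direction at its first end determines whether a
  passage is paired with its successor or with its predecessor on \<open>T\<close>.\<close>

definition mates :: "passage list \<Rightarrow> bool \<Rightarrow> passage \<Rightarrow> passage \<Rightarrow> bool" where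
  "mates T f a b \<longleftrightarrow> (\<exists>A B y z. T = A @ [y, z] @ B \<and> (y = bar a \<and> z = bar b \<or> y = bar b \<and> z = bar a) \<and> fr y = f \<and> fr z \<noteq> f)"

lemma mates_sym: "mates T f a b \<Longrightarrow> mates T f b a"
  unfolding mates_def by (simp only: disj_commute)

text \<open>The value of \<open>fr\<close> tells whether \<open>bar a\<close> is the first or the
  second of its pair, which fixes its neighbour.\<close>

lemma mates_unique:
  assumes "distinct T" "mates T f a b" "mates T f a c"
  shows "b = c"
proof -
  obtain A B y z where 1: "T = A @ [y, z] @ B" "y = bar a \<and> z = bar b \<or> y = bar b \<and> z = bar a" "fr y = f" "fr z \<noteq> f"
    using assms(2) unfolding mates_def by (elim exE conjE) (rule that)
  obtain A' B' y' z' where 2: "T = A' @ [y', z'] @ B'" "y' = bar a \<and> z' = bar c \<or> y' = bar c \<and> z' = bar a" "fr y' = f" "fr z' \<noteq> f"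
    using assms(3) unfolding mates_def by (elim exE conjE) (rule that)
  show ?thesis
  proof (cases "y = bar a")
    case True
    then have "y' = bar a" using 1 2 by auto
    then have "A @ bar a # z # B = A' @ bar a # z' # B'" using True 1(1) 2(1) by simp
    moreover have "bar a \<notin> set A" "bar a \<notin> set (z # B)" using assms(1) True unfolding 1(1) by auto
    ultimately have "z = z'" using append_Cons_eq_iff[of "bar a" A "z # B" A' "z' # B'"] by simp
    moreover have "z = bar b" "z' = bar c" using 1 2 True \<open>y' = bar a\<close> by auto
    ultimately show ?thesis by simp
  next
    case False
    then have z: "z = bar a" "y = bar b" using 1(2) by auto
    then have z': "z' = bar a" "y' = bar c" using 1(3,4) 2 by auto
    have "(A @ [y]) @ bar a # B = (A' @ [y']) @ bar a # B'" using z z' 1(1) 2(1) by simp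
    moreover have "bar a \<notin> set (A @ [y])" "bar a \<notin> set B" using assms(1) z(1) unfolding 1(1) by auto
    ultimately have "A @ [y] = A' @ [y']" using append_Cons_eq_iff[of "bar a" "A @ [y]" B "A' @ [y']" B'] by simp
    then show ?thesis using z z' by simp
  qed
qed

text \<open>Adjacent passages on \<open>T\<close> need not be adjacent on the swept strand. But by
  \<open>bigons_not_crossed\<close> the pairs are nested or disjoint there, like brackets, so some
  innermost pair is adjacent and bounds an empty bigon.\<close>

lemma adjacent_mates:
  assumes w: "knot_word (Y1 @ Y @ Y3 @ ys @ T @ zs)" and bars: "\<forall>z\<in>set Y. bar z \<in> set T"
    and Y: "Y \<noteq> []" "\<forall>a\<in>set Y. \<exists>b\<in>set Y. mates T f a b"
  shows "\<exists>Y1' a b Y3'. Y1 @ Y @ Y3 = Y1' @ [a, b] @ Y3' \<and> mates T f a b"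
  using assms
proof (induction "length Y" arbitrary: Y Y1 Y3 rule: less_induct)
  case less
  note d = knot_wordD(3)[OF less.prems(1)]
  have dT: "distinct T" using d by simp
  obtain a Y' where Y': "Y = a # Y'" using less.prems(3) by (cases Y) auto
  obtain b where b: "b \<in> set Y" "mates T f a b" using less.prems(4) Y' by auto
  have "a \<noteq> b" using b(2) unfolding mates_def by auto
  then obtain C D where CD: "Y' = C @ b # D" using b(1) Y' by (auto simp: in_set_conv_decomp)
  show ?case
  proof (cases "C = []")
    case True
    then show ?thesis using b(2) Y' CD
      by (intro exI[of _ Y1] exI[of _ a] exI[of _ b] exI[of _ "D @ Y3"]) simp
  next
    case False
    have cl: "\<exists>d\<in>set C. mates T f c d" if c: "c \<in> set C" for c
    proof -
      have cY: "c \<in> set Y" using c CD Y' by simp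
      then obtain e where e: "e \<in> set Y" "mates T f c e" using less.prems(4) by blast
      have "e \<noteq> a"
      proof
        assume "e = a"
        then have "c = b" using mates_unique[OF dT _ b(2)] mates_sym[OF e(2)] by simp
        then show False using c d CD Y' by simp
      qed
      moreover have "e \<noteq> b"
      proof
        assume "e = b"
        then have "c = a" using mates_unique[OF dT mates_sym[OF e(2)]] mates_sym[OF b(2)] by simp
        then show False using c d CD Y' by simp
      qed
      \<comment> \<open>A mate of \<open>c\<close> beyond \<open>b\<close> would give two
        interleaved bigons.\<close>
      moreover have "e \<notin> set D"
      proof
        assume "e \<in> set D"
        then obtain C3 D' where D: "D = C3 @ e # D'" by (auto simp: in_set_conv_decomp)
        obtain C1 C2 where C: "C = C1 @ c # C2" using c by (auto simp: in_set_conv_decomp)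
        let ?R = "D' @ Y3 @ ys @ T @ zs @ Y1"
        have kw: "knot_word (a # C1 @ c # C2 @ b # C3 @ e # ?R)"
          using knot_word_append[of Y1 "Y @ Y3 @ ys @ T @ zs"] less.prems(1) Y' CD C D by simp
        obtain A B y z where 1: "T = A @ [y, z] @ B" "y = bar a \<and> z = bar b \<or> y = bar b \<and> z = bar a" "fr y = f" "fr z \<noteq> f"
          using b(2) unfolding mates_def by (elim exE conjE) (rule that)
        obtain A' B' y' z' where 2: "T = A' @ [y', z'] @ B'" "y' = bar c \<and> z' = bar e \<or> y' = bar e \<and> z' = bar c" "fr y' = f" "fr z' \<noteq> f"
          using e(2) unfolding mates_def by (elim exE conjE) (rule that)
        have R: "?R = (D' @ Y3 @ ys @ A) @ [y, z] @ (B @ zs @ Y1)" "?R = (D' @ Y3 @ ys @ A') @ [y', z'] @ (B' @ zs @ Y1)"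
          by (simp_all only: 1(1), simp) (simp only: 1(1)[symmetric] 2(1), simp)
        have bR: "\<forall>v\<in>set (C2 @ C3). bar v \<in> set ?R" using less.prems(2) Y' CD C D by auto
        show False by (rule bigons_not_crossed[OF kw R 1(2) 2(2) _ _ _ bR]) (use 1(3,4) 2(3,4) in simp_all)
      qed
      ultimately have "e \<in> set C" using e(1) Y' CD by simp
      with e(2) show ?thesis by blast
    qed
    have "\<exists>Y1' a' b' Y3'. (Y1 @ [a]) @ C @ (b # D @ Y3) = Y1' @ [a', b'] @ Y3' \<and> mates T f a' b'"
    proof (rule less.hyps[OF _ _ _ False])
      show "length C < length Y" using Y' CD by simp
      show "knot_word ((Y1 @ [a]) @ C @ (b # D @ Y3) @ ys @ T @ zs)" using less.prems(1) Y' CD by simp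
      show "\<forall>z\<in>set C. bar z \<in> set T" using less.prems(2) Y' CD by simp
      show "\<forall>a\<in>set C. \<exists>b\<in>set C. mates T f a b" using cl by blast
    qed
    then show ?thesis using Y' CD by simp
  qed
qed

text \<open>After the sweep all marked passages form adjacent pairs, and innermost bigons are
  cancelled one after the other.\<close>

lemma swept_strand:
  assumes "knot_word (Z @ ys @ T @ zs)" "\<forall>z\<in>set Z. over z = u \<and> bar z \<in> set T"
    "alternating (\<lambda>v. bar v \<in> set Z) f T" "\<not> pty (\<lambda>v. bar v \<in> set Z) T"
    "unswept (\<lambda>v. bar v \<in> set Z) False T = 0"
  shows "same_knot (Z @ ys @ T @ zs) (ys @ filter (\<lambda>v. bar v \<notin> set Z) T @ zs)"
  using assms
proof (induction "length Z" arbitrary: Z T rule: less_induct)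
  case less
  show ?case
  proof (cases "Z = []")
    case True
    then show ?thesis using less.prems(1) by (simp add: same_knot_refl)
  next
    case False
    let ?P = "\<lambda>v. bar v \<in> set Z"
    note d = knot_wordD(3)[OF less.prems(1)]
    have "\<exists>b\<in>set Z. mates T f a b" if a: "a \<in> set Z" for a
    proof -
      have "bar a \<in> set T" "bar (bar a) \<in> set Z" using a less.prems(2) by simp_all
      from swept_pair[OF less.prems(5,3,4) this]
      obtain A B y z where 1: "T = A @ [y, z] @ B" "bar a \<in> {y, z}" "bar y \<in> set Z" "bar z \<in> set Z" "fr y = f" "fr z \<noteq> f"
        by (elim exE conjE) (rule that)
      show ?thesis
      proof (cases "y = bar a")
        case True
        then show ?thesis unfolding mates_def using 1
          by (intro bexI[of _ "bar z"] exI[of _ A] exI[of _ B] exI[of _ y] exI[of _ z]) simp_all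
      next
        case False
        then show ?thesis unfolding mates_def using 1
          by (intro bexI[of _ "bar y"] exI[of _ A] exI[of _ B] exI[of _ y] exI[of _ z]) auto
      qed
    qed
    then obtain Y1 a b Y3 where Z: "Z = Y1 @ [a, b] @ Y3" and m: "mates T f a b"
      using adjacent_mates[of "[]" Z "[]" ys T zs f] less.prems(1,2) False by auto
    obtain A B y z where T: "T = A @ [y, z] @ B" and yz: "y = bar a \<and> z = bar b \<or> y = bar b \<and> z = bar a" and fr: "fr y = f" "fr z \<noteq> f"
      using m unfolding mates_def by (elim exE conjE) (rule that)
    let ?Z = "Y1 @ Y3" and ?T = "A @ B"
    let ?P' = "\<lambda>v. bar v \<in> set ?Z"
    have ov: "over a = over b" using less.prems(2) Z by simp
    have ps: "positive a \<noteq> positive b" using yz fr ov by (elim disjE conjE) (simp_all add: fr_def, blast+)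
    have w: "Z @ ys @ T @ zs = Y1 @ [a, b] @ (Y3 @ ys @ A) @ [y, z] @ (B @ zs)" unfolding Z T by simp
    have 1: "same_knot (Z @ ys @ T @ zs) (?Z @ ys @ ?T @ zs)"
      using same_knot_R2[OF less.prems(1)[unfolded w] ov ps yz] unfolding w by simp
    have P: "?P v = ?P' v" if "v \<in> set ?T" for v
    proof -
      have "v \<noteq> y" "v \<noteq> z" using that d unfolding T by auto
      then have "bar v \<noteq> a" "bar v \<noteq> b" using yz by auto
      then show ?thesis unfolding Z by simp
    qed
    have Pyz: "bar y \<in> set Z" "bar z \<in> set Z" using yz unfolding Z by auto
    have PA: "?P v = ?P' v" if "v \<in> set A" for v using P[of v] that by simp
    have PB: "?P v = ?P' v" if "v \<in> set B" for v using P[of v] that by simp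
    note pA = pty_cong[of A ?P ?P', OF PA] pty_cong[of B ?P ?P', OF PB]
    note aA = alternating_cong[of A ?P ?P', OF PA] alternating_cong[of B ?P ?P', OF PB]
    note uA = unswept_cong[of A ?P ?P', OF PA] unswept_cong[of B ?P ?P', OF PB]
    have 2: "same_knot (?Z @ ys @ ?T @ zs) (ys @ filter (\<lambda>v. bar v \<notin> set ?Z) ?T @ zs)"
    proof (rule less.hyps)
      show "length ?Z < length Z" unfolding Z by simp
      show "knot_word (?Z @ ys @ ?T @ zs)" using 1 by (simp add: same_knot_def)
      show "\<forall>z\<in>set ?Z. over z = u \<and> bar z \<in> set ?T"
      proof
        fix v assume v: "v \<in> set ?Z"
        then have "v \<noteq> a" "v \<noteq> b" using d unfolding Z by auto
        then have "bar v \<noteq> y" "bar v \<noteq> z" using yz by auto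
        moreover have "v \<in> set Z" using v unfolding Z by auto
        ultimately show "over v = u \<and> bar v \<in> set ?T" using less.prems(2) unfolding T by auto
      qed
      show "alternating ?P' f ?T" using less.prems(3) Pyz unfolding T by (simp add: alternating_append pA aA)
      show "\<not> pty ?P' ?T" using less.prems(4) Pyz unfolding T by (simp add: pA)
      show "unswept ?P' False ?T = 0" using less.prems(5) Pyz unfolding T by (simp add: unswept_append pA uA)
    qed
    have "filter (\<lambda>v. bar v \<notin> set ?Z) ?T = filter (\<lambda>v. bar v \<notin> set Z) ?T"
      by (rule filter_cong[OF refl]) (simp only: P)
    also have "\<dots> = filter (\<lambda>v. bar v \<notin> set Z) T" using Pyz unfolding T by simp
    finally show ?thesis using same_knot_trans[OF 1 2] by (simp only:)
  qed
qed

text \<open>Effect of the two crossings that a push creates on either side of the other passage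
  \<open>b\<close> of the pushed crossing. If \<open>b\<close> was unswept, the new marks take it
  out of the unswept part; if the direction of \<open>s1\<close> fits, the marks still
  alternate.\<close>

lemma thread_insert:
  assumes P: "\<And>v. v \<in> set L \<Longrightarrow> P' v = P v" and s: "P' s1" "P' s2" "\<not> P b" "fr s1 \<noteq> fr s2"
  defines "ins \<equiv> \<lambda>v. if v = b then [s1, b, s2] else [v :: passage]"
  shows "filter (\<lambda>v. \<not> P' v) (concat (map ins L)) = filter (\<lambda>v. \<not> P v) L"
    "pty P' (concat (map ins L)) = pty P L"
    "(\<And>L1 L2. L = L1 @ b # L2 \<Longrightarrow> i \<noteq> pty P L1) \<Longrightarrow> unswept P' i (concat (map ins L)) \<le> unswept P i L"
    "(\<And>L1 L2. L = L1 @ b # L2 \<Longrightarrow> (fr s1 = g) = (\<not> pty P L1)) \<Longrightarrow> alternating P' g (concat (map ins L)) = alternating P g L"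
proof -
  show "filter (\<lambda>v. \<not> P' v) (concat (map ins L)) = filter (\<lambda>v. \<not> P v) L"
    using P by (induction L) (use s in \<open>auto simp: ins_def\<close>)
  show "pty P' (concat (map ins L)) = pty P L"
    using P by (induction L) (use s in \<open>auto simp: ins_def\<close>)
  show "unswept P' i (concat (map ins L)) \<le> unswept P i L" if "\<And>L1 L2. L = L1 @ b # L2 \<Longrightarrow> i \<noteq> pty P L1"
    using that P
  proof (induction L arbitrary: i)
    case (Cons v L)
    have i: "v = b \<Longrightarrow> i" using Cons.prems(1)[of "[]" L] by simp
    have "unswept P' (i \<noteq> P v) (concat (map ins L)) \<le> unswept P (i \<noteq> P v) L"
    proof (rule Cons.IH)
      fix L1 L2 assume "L = L1 @ b # L2"
      then show "(i \<noteq> P v) \<noteq> pty P L1" using Cons.prems(1)[of "v # L1" L2] by auto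
    qed (use Cons.prems(2) in simp)
    then show ?case using i s Cons.prems(2)[of v] by (auto simp: ins_def split: if_splits)
  qed simp
  show "alternating P' g (concat (map ins L)) = alternating P g L"
    if "\<And>L1 L2. L = L1 @ b # L2 \<Longrightarrow> (fr s1 = g) = (\<not> pty P L1)"
    using that P
  proof (induction L arbitrary: g)
    case (Cons v L)
    have i: "v = b \<Longrightarrow> fr s1 = g" using Cons.prems(1)[of "[]" L] by simp
    have "alternating P' (g \<noteq> P v) (concat (map ins L)) = alternating P (g \<noteq> P v) L"
    proof (rule Cons.IH)
      fix L1 L2 assume "L = L1 @ b # L2"
      then show "(fr s1 = (g \<noteq> P v)) = (\<not> pty P L1)" using Cons.prems(1)[of "v # L1" L2] by auto
    qed (use Cons.prems(2) in simp)
    then show ?case using i s Cons.prems(2)[of v] by (auto simp: ins_def split: if_splits)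
  qed simp
qed

lemma pty_between:
  assumes "even (length S)" "even (length (filter (\<lambda>v. \<not> P v) S))"
  shows "\<not> pty P S"
  using assms sum_length_filter_compl[of P S] unfolding pty_def by (metis even_add)

lemma fresh_passages:
  assumes "finite A"
  shows "\<exists>f g. crossing f \<notin> A \<and> crossing g \<notin> A \<and> crossing f \<noteq> crossing g \<and> over f = u \<and> over g = u \<and>
    fr (bar f) = d \<and> fr (bar g) = e"
proof -
  obtain k where k: "k \<notin> A" using ex_new_if_finite[OF infinite_UNIV_nat assms] by blast
  obtain l where l: "l \<notin> insert k A" using ex_new_if_finite[OF infinite_UNIV_nat, of "insert k A"] assms by auto
  show ?thesis
    by (rule exI[of _ "Passage k u (u = (\<not> d))"], rule exI[of _ "Passage l u (u = (\<not> e))"])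
      (use k l in \<open>auto simp: fr_def\<close>)
qed

text \<open>The local knot \<open>H\<close> sits on \<open>T\<close>, and the strand
  \<open>Z\<close> meets \<open>T\<close> only with marked passages. Each push carries
  \<open>Z\<close> across one crossing of \<open>H\<close>. It may lengthen \<open>Z\<close>, but it
  decreases the number of unswept letters, on which the induction runs.\<close>

lemma sweep:
  assumes "knot_word (Z @ ys @ T @ zs)" "\<forall>z\<in>set Z. over z = u \<and> bar z \<in> set T"
    "alternating (\<lambda>v. bar v \<in> set Z) f T" "\<not> pty (\<lambda>v. bar v \<in> set Z) T"
    "filter (\<lambda>v. bar v \<notin> set Z) T = H"
    and H: "\<forall>v\<in>set H. bar v \<in> set H" "\<And>A v S B. H = A @ v # S @ bar v # B \<Longrightarrow> even (length S)"
  shows "same_knot (Z @ ys @ T @ zs) (ys @ H @ zs)"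
  using assms(1-5)
proof (induction "unswept (\<lambda>v. bar v \<in> set Z) False T" arbitrary: Z T rule: less_induct)
  case less
  let ?P = "\<lambda>v. bar v \<in> set Z"
  note w = less.prems(1)
  note gw = knot_wordD(1)[OF w] and d = knot_wordD(3)[OF w]
  show ?case
  proof (cases "unswept ?P False T = 0")
    case True
    then show ?thesis using swept_strand[OF less.prems(1-4)] less.prems(5) by simp
  next
    case False
    then obtain A x b B where T: "T = A @ x # b # B" and P: "?P x" "\<not> ?P b" "\<not> pty ?P A"
      using unswept_first[of ?P False T] by auto
    define z where "z = bar x"
    have z: "z \<in> set Z" using P(1) by (simp add: z_def)
    then obtain Z1 Z2 where Z: "Z = Z1 @ z # Z2" by (auto simp: in_set_conv_decomp)
    have bH: "b \<in> set H" using less.prems(5) P(2) T by auto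
    then have "bar b \<in> set H" using H(1) by simp
    then have bb: "bar b \<in> set T" "b \<notin> set Z" using less.prems(5) by auto
    have xb: "crossing x \<noteq> crossing b"
    proof
      assume "crossing x = crossing b"
      moreover have "x \<in> set (Z @ ys @ T @ zs)" "b \<in> set (Z @ ys @ T @ zs)" unfolding T by auto
      ultimately have "x = b \<or> x = bar b" using gauss_word_same_crossing[OF gw] by blast
      then show False using P bb(2) by auto
    qed
    let ?U = "B @ zs @ Z1 @ [z] @ Z2 @ ys @ A"
    have w1: "Z @ ys @ T @ zs = (Z1 @ [z] @ Z2 @ ys @ A) @ ([x, b] @ B @ zs)" unfolding Z T by simp
    have s1: "same_knot (Z @ ys @ T @ zs) ([x, b] @ ?U)"
      using same_knot_append[OF w[unfolded w1]] unfolding w1 by simp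
    then have kU: "knot_word ([x, b] @ ?U)" by (simp add: same_knot_def)
    obtain F G where FG: "crossing F \<notin> crossing ` set ([x, b] @ ?U)" "crossing G \<notin> crossing ` set ([x, b] @ ?U)"
      "crossing F \<noteq> crossing G" "over F = u" "over G = u" "fr (bar F) = (fr x \<noteq> fr b)" "fr (bar G) = (fr x = fr b)"
      using fresh_passages[of "crossing ` set ([x, b] @ ?U)" u "fr x \<noteq> fr b" "fr x = fr b"] by auto
    have ou: "over F = over (bar x)" "over G = over (bar x)" using FG(4,5) bspec[OF less.prems(2) z] by (simp_all add: z_def)
    define sz where "sz = (if fr x then [F, z, G] else [G, z, F])"
    define t1 where "t1 = (if fr b then bar F else bar G)"
    define t2 where "t2 = (if fr b then bar G else bar F)"
    define ins where "ins = (\<lambda>v. if v = bar b then [t1, bar b, t2] else [v])"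
    let ?sub = "\<lambda>v. if v = bar x then (if fr x then [F, bar x, G] else [G, bar x, F])
      else if v = bar b then (if fr b then [bar F, bar b, bar G] else [bar G, bar b, bar F]) else [v]"
    have sub: "concat (map ?sub L) = concat (map ins L)" if "z \<notin> set L" for L
      using that by (induction L) (auto simp: ins_def t1_def t2_def z_def)
    have id: "concat (map ins L) = L" if "bar b \<notin> set L" for L
      using that by (induction L) (auto simp: ins_def)
    let ?A = "concat (map ins A)" and ?B = "concat (map ins B)"
    have zn: "z \<notin> set A" "z \<notin> set B" "z \<notin> set zs" "z \<notin> set ys" "z \<notin> set Z1" "z \<notin> set Z2" using d Z T by auto
    have bn: "bar b \<notin> set zs" "bar b \<notin> set ys" "bar b \<notin> set Z1" "bar b \<notin> set Z2" using d bb Z by auto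
    have U': "concat (map ?sub ?U) = ?B @ zs @ Z1 @ sz @ Z2 @ ys @ ?A"
    proof -
      have "concat (map ?sub [z]) = sz" by (simp add: sz_def z_def)
      then show ?thesis
        unfolding map_append concat_append using sub[OF zn(1)] sub[OF zn(2)] sub[OF zn(3)] sub[OF zn(4)] sub[OF zn(5)] sub[OF zn(6)]
          id[OF bn(1)] id[OF bn(2)] id[OF bn(3)] id[OF bn(4)] by presburger
    qed
    let ?Z = "Z1 @ sz @ Z2" and ?T = "?A @ b # x # ?B"
    let ?P' = "\<lambda>v. bar v \<in> set ?Z"
    have s2: "same_knot ([x, b] @ ?U) ([b, x] @ ?B @ zs @ Z1 @ sz @ Z2 @ ys @ ?A)"
      using push_strand[OF kU xb FG(1-3,7,6) ou] unfolding U' .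
    have s3: "same_knot (([b, x] @ ?B @ zs) @ (Z1 @ sz @ Z2 @ ys @ ?A)) ((Z1 @ sz @ Z2 @ ys @ ?A) @ ([b, x] @ ?B @ zs))"
      by (rule same_knot_append) (use s2 in \<open>simp add: same_knot_def\<close>)
    have s: "same_knot (Z @ ys @ T @ zs) (?Z @ ys @ ?T @ zs)"
      using same_knot_trans[OF s1 same_knot_trans[OF s2]] s3 by simp
    have setZ: "set ?Z = set Z \<union> {F, G}" unfolding sz_def Z by auto
    have fresh: "v \<noteq> bar F \<and> v \<noteq> bar G" if "v \<in> set T" for v
    proof -
      have "v \<in> set ([x, b] @ ?U)" using that unfolding T by auto
      then show ?thesis using FG(1,2) by (metis bar_simps(1) imageI)
    qed
    have PP: "?P' v = ?P v" if "v \<in> set T" for v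
    proof -
      have "bar v \<noteq> F" "bar v \<noteq> G" using fresh[OF that] by auto
      then show ?thesis unfolding setZ by simp
    qed
    have PA: "?P' v = ?P v" if "v \<in> set A" for v using PP[of v] that T by simp
    have PB: "?P' v = ?P v" if "v \<in> set B" for v using PP[of v] that T by simp
    have Pxb: "?P' x" "\<not> ?P' b" using PP[of x] PP[of b] P T by simp_all
    have Pt: "?P' t1" "?P' t2" unfolding setZ t1_def t2_def by auto
    have Pbb: "\<not> ?P (bar b)" using bb by simp
    have frt: "fr t1 = (\<not> fr x)" "fr t2 = fr x" using FG(6,7) unfolding t1_def t2_def by auto
    then have frt': "fr t1 \<noteq> fr t2" by simp
    have frx: "fr x = f" using less.prems(3) P unfolding T by (simp add: alternating_append)
    \<comment> \<open>Between the two passages of a crossing of \<open>H\<close> there is an even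
      number of letters, both in the whole word and in \<open>H\<close> alone. So the number of
      marked letters in between is even, and \<open>bar b\<close> is unswept because
      \<open>b\<close> is; the same argument gives \<open>evB\<close>.\<close>
    have oddA: "pty ?P L1" if L: "A = L1 @ bar b # L2" for L1 L2
    proof -
      have w2: "Z @ ys @ T @ zs = (Z @ ys @ L1) @ (bar b # (L2 @ [x]) @ b # B @ zs)" unfolding T L by simp
      have "knot_word (bar b # (L2 @ [x]) @ bar (bar b) # (B @ zs @ Z @ ys @ L1))"
        using knot_word_append[OF w[unfolded w2]] by simp
      from loop_even[OF this] have "even (length (L2 @ [x]))" .
      moreover have "H = filter (\<lambda>v. \<not> ?P v) L1 @ bar b # filter (\<lambda>v. \<not> ?P v) (L2 @ [x]) @ bar (bar b) # filter (\<lambda>v. \<not> ?P v) B"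
        using less.prems(5) P Pbb unfolding T L by simp
      from H(2)[OF this] have "even (length (filter (\<lambda>v. \<not> ?P v) (L2 @ [x])))" .
      ultimately have "\<not> pty ?P (L2 @ [x])" by (rule pty_between)
      then show ?thesis using P Pbb unfolding L by auto
    qed
    have evB: "\<not> pty ?P L1" if L: "B = L1 @ bar b # L2" for L1 L2
    proof -
      have w2: "Z @ ys @ T @ zs = (Z @ ys @ A @ [x]) @ (b # L1 @ bar b # L2 @ zs)" unfolding T L by simp
      have "knot_word (b # L1 @ bar b # (L2 @ zs @ Z @ ys @ A @ [x]))"
        using knot_word_append[OF w[unfolded w2]] by simp
      from loop_even[OF this] have "even (length L1)" .
      moreover have "H = filter (\<lambda>v. \<not> ?P v) A @ b # filter (\<lambda>v. \<not> ?P v) L1 @ bar b # filter (\<lambda>v. \<not> ?P v) L2"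
        using less.prems(5) P Pbb unfolding T L by simp
      from H(2)[OF this] have "even (length (filter (\<lambda>v. \<not> ?P v) L1))" .
      ultimately show ?thesis by (rule pty_between)
    qed
    note tA = thread_insert[of A ?P' ?P, OF PA Pt Pbb frt', folded ins_def]
      and tB = thread_insert[of B ?P' ?P, OF PB Pt Pbb frt', folded ins_def]
    have uA: "unswept ?P' False ?A \<le> unswept ?P False A" by (rule tA(3)) (use oddA in auto)
    have uB: "unswept ?P' True ?B \<le> unswept ?P True B" by (rule tB(3)) (use evB in auto)
    have aA: "alternating ?P' f ?A = alternating ?P f A" by (rule tA(4)) (use oddA frt frx in auto)
    have aB: "alternating ?P' (\<not> f) ?B = alternating ?P (\<not> f) B" by (rule tB(4)) (use evB frt frx in auto)
    have "same_knot (?Z @ ys @ ?T @ zs) (ys @ H @ zs)"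
    proof (rule less.hyps)
      show "unswept ?P' False ?T < unswept ?P False T"
        using uA uB P Pxb tA(2) unfolding T by (simp add: unswept_append)
      show "knot_word (?Z @ ys @ ?T @ zs)" using s by (simp add: same_knot_def)
      show "\<forall>v\<in>set ?Z. over v = u \<and> bar v \<in> set ?T"
      proof
        fix v assume "v \<in> set ?Z"
        then have v: "v \<in> set Z \<or> v = F \<or> v = G" unfolding setZ by blast
        have sub1: "set L \<subseteq> set (concat (map ins L))" for L by (auto simp: ins_def)
        have "set T \<subseteq> set ?T" unfolding T using sub1[of A] sub1[of B] by auto
        moreover have "{bar F, bar G} \<subseteq> set ?T"
        proof -
          have "bar b \<in> set A \<or> bar b \<in> set B" using bb(1) xb unfolding T by auto
          then have "{t1, t2} \<subseteq> set ?A \<union> set ?B" by (auto simp: ins_def)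
          moreover have "{t1, t2} = {bar F, bar G}" unfolding t1_def t2_def by (cases "fr b") (simp_all add: insert_commute)
          ultimately show ?thesis by auto
        qed
        ultimately show "over v = u \<and> bar v \<in> set ?T" using v FG(4,5) less.prems(2) by auto
      qed
      show "alternating ?P' f ?T"
        using less.prems(3) aA aB P Pxb tA(2) unfolding T by (simp add: alternating_append)
      show "\<not> pty ?P' ?T" using less.prems(4) P Pxb tA(2) tB(2) unfolding T by simp
      show "filter (\<lambda>v. bar v \<notin> set ?Z) ?T = H" using less.prems(5) P Pxb tA(1) tB(1) unfolding T by auto
    qed
    with s show ?thesis by (rule same_knot_trans)
  qed
qed

text \<open>A bigon one of whose sides carries a local knot \<open>H\<close>. The strand with
  \<open>p\<close> and \<open>q\<close> is swept across \<open>H\<close>, which removes both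
  crossings and leaves \<open>H\<close> in place.\<close>

lemma same_knot_bead:
  assumes w: "knot_word ([p, q] @ ys @ [p'] @ H @ [q'] @ zs)"
    and H: "\<forall>v\<in>set H. bar v \<in> set H"
    and pq: "over p = over q" "positive p \<noteq> positive q"
    and b: "p' = bar p \<and> q' = bar q \<or> p' = bar q \<and> q' = bar p"
  shows "same_knot ([p, q] @ ys @ [p'] @ H @ [q'] @ zs) (ys @ H @ zs)"
proof -
  note d = knot_wordD(3)[OF w]
  have n: "\<not> (bar v = p \<or> bar v = q)" if "v \<in> set H" for v
    using H that d b by auto
  have fH: "filter (\<lambda>v. bar v \<noteq> p \<and> bar v \<noteq> q) H = H" "filter (\<lambda>v. bar v = p \<or> bar v = q) H = []"
    using n by (auto simp: filter_id_conv filter_empty_conv)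
  have aH: "alternating (\<lambda>v. bar v = p \<or> bar v = q) f H" for f
    using alternating_cong[of H "\<lambda>v. bar v = p \<or> bar v = q" "\<lambda>v. False"] n by (induction H arbitrary: f) auto
  have fr: "fr p' \<noteq> fr q'" using pq b by (auto simp: fr_def)
  have "same_knot ([p, q] @ ys @ ([p'] @ H @ [q']) @ zs) (ys @ H @ zs)"
  proof (rule sweep[where u = "over p" and f = "fr p'"])
    show "knot_word ([p, q] @ ys @ ([p'] @ H @ [q']) @ zs)" using w by simp
    show "\<forall>z\<in>set [p, q]. over z = over p \<and> bar z \<in> set ([p'] @ H @ [q'])" using pq b by auto
    show "alternating (\<lambda>v. bar v \<in> set [p, q]) (fr p') ([p'] @ H @ [q'])"
      using b fr aH fH(2) by (auto simp: alternating_append pty_def)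
    show "\<not> pty (\<lambda>v. bar v \<in> set [p, q]) ([p'] @ H @ [q'])" using b fH(2) by (auto simp: pty_def)
    show "filter (\<lambda>v. bar v \<notin> set [p, q]) ([p'] @ H @ [q']) = H" using b fH(1) by auto
    show "\<forall>v\<in>set H. bar v \<in> set H" by (rule H)
    fix A v S B assume "H = A @ v # S @ bar v # B"
    then have "[p, q] @ ys @ [p'] @ H @ [q'] @ zs = ([p, q] @ ys @ [p'] @ A) @ (v # S @ bar v # B @ [q'] @ zs)" by simp
    from knot_word_append[OF w[unfolded this]] show "even (length S)"
      using loop_even[of v S "B @ [q'] @ zs @ [p, q] @ ys @ [p'] @ A"] by simp
  qed
  then show ?thesis by simp
qed

lemma same_knot_a2: "same_knot w w' \<Longrightarrow> a2 w = a2 w'"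
  using a2_knot[of "Diagram w" "Diagram w'"] by (simp add: same_knot_def word_Diagram)

lemma negatives_mono: "set w' \<subseteq> set w \<Longrightarrow> negatives w' \<subseteq> negatives w"
  by (auto simp: negatives_def)

section \<open>Minimal counterexamples\<close>

text \<open>Minimal among all counterexamples, not within one knot: every shorter word with one
  negative crossing and invariant one already has a positive diagram.\<close>

definition critical :: "passage list \<Rightarrow> bool" where
  "critical w \<longleftrightarrow> knot_word w \<and> card (negatives w) = 1 \<and> a2 w = 1 \<and>
     (\<nexists>w'. same_knot w w' \<and> negatives w' = {}) \<and>
     (\<forall>w'. knot_word w' \<and> card (negatives w') = 1 \<and> a2 w' = 1 \<and> length w' < length w \<longrightarrow>
       (\<exists>w''. same_knot w' w'' \<and> negatives w'' = {}))"

lemma ex_critical: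
  assumes "knot_word w" "card (negatives w) = 1" "a2 w = 1" "\<nexists>w'. same_knot w w' \<and> negatives w' = {}"
  shows "\<exists>w. critical w"
  using assms
proof (induction "length w" arbitrary: w rule: less_induct)
  case less
  show ?case
  proof (cases "critical w")
    case False
    have "\<not> (\<forall>w'. knot_word w' \<and> card (negatives w') = 1 \<and> a2 w' = 1 \<and> length w' < length w \<longrightarrow>
       (\<exists>w''. same_knot w' w'' \<and> negatives w'' = {}))" (is "\<not> ?all")
    proof
      assume ?all
      then have "critical w" unfolding critical_def using less.prems by (intro conjI)
      with False show False ..
    qed
    then obtain w' where "knot_word w'" "card (negatives w') = 1" "a2 w' = 1" "length w' < length w"
      "\<nexists>w''. same_knot w' w'' \<and> negatives w'' = {}"
      by (auto simp only: not_all not_imp)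
    then show ?thesis by (intro less.hyps)
  qed (rule exI)
qed

text \<open>A change of diagram without new negative crossings cannot remove the negative crossing,
  as this would give a positive diagram; so the result satisfies the same hypotheses and by
  minimality is not shorter.\<close>

lemma critical_step:
  assumes w: "critical w" and s: "same_knot w w'" "length w' \<le> length w" "negatives w' \<subseteq> negatives w"
  shows "critical w' \<and> length w' = length w"
proof -
  have c1: "card (negatives w) = 1" and a: "a2 w' = 1"
    using w same_knot_a2[OF s(1)] by (simp_all add: critical_def)
  have n: "negatives w' \<noteq> {}" using w s(1) unfolding critical_def by blast
  have "negatives w' = negatives w" using n c1 s(3) by (metis card_1_singletonE subset_singletonD)
  then have c: "card (negatives w') = 1" using c1 by simp
  have k: "knot_word w'" using s(1) by (simp add: same_knot_def)
  have bad: "\<nexists>w''. same_knot w' w'' \<and> negatives w'' = {}"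
    using w same_knot_trans[OF s(1)] unfolding critical_def by blast
  have "length w' = length w"
  proof (rule ccontr)
    assume "length w' \<noteq> length w"
    with s(2) have "length w' < length w" by simp
    with w k c a bad show False unfolding critical_def by blast
  qed
  with w k c a bad show ?thesis unfolding critical_def by simp
qed

lemma critical_knot_word: "critical w \<Longrightarrow> knot_word w"
  by (simp add: critical_def)

lemma critical_append: "critical (u @ v) \<Longrightarrow> critical (v @ u)"
  using critical_step[of "u @ v" "v @ u"] same_knot_append[OF critical_knot_word] negatives_mono[of "v @ u" "u @ v"] by auto

lemma critical_no_kink: "\<not> critical (xs @ [p, bar p] @ ys)"
proof
  assume w: "critical (xs @ [p, bar p] @ ys)"
  have "length (xs @ ys) = length (xs @ [p, bar p] @ ys)"
    by (rule conjunct2[OF critical_step[OF w same_knot_R1[OF critical_knot_word[OF w]]]])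
      (simp, rule negatives_mono, auto)
  then show False by simp
qed

text \<open>As the signs of \<open>p\<close> and \<open>q\<close> differ, one of the two crossings
  is the negative one.\<close>

lemma critical_no_bead:
  assumes H: "\<forall>v\<in>set H. bar v \<in> set H"
    and pq: "over p = over q" "positive p \<noteq> positive q"
    and b: "p' = bar p \<and> q' = bar q \<or> p' = bar q \<and> q' = bar p"
  shows "\<not> critical ([p, q] @ ys @ [p'] @ H @ [q'] @ zs)"
proof
  assume w: "critical ([p, q] @ ys @ [p'] @ H @ [q'] @ zs)"
  have "length (ys @ H @ zs) = length ([p, q] @ ys @ [p'] @ H @ [q'] @ zs)"
    by (rule conjunct2[OF critical_step[OF w same_knot_bead[OF critical_knot_word[OF w] H pq b]]])
      (simp, rule negatives_mono, auto)
  then show False by simp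
qed

lemma critical_negative:
  assumes "critical w"
  shows "\<exists>c\<in>set w. over c \<and> \<not> positive c"
proof -
  note g = knot_wordD[OF critical_knot_word[OF assms]]
  have "negatives w \<noteq> {}" using assms unfolding critical_def by (metis card.empty zero_neq_one)
  then obtain v where v: "v \<in> set w" "\<not> positive v" by (auto simp: negatives_def)
  then show ?thesis using gauss_word_bar[OF g(1) v(1)] by (cases "over v") (auto intro: bexI[of _ v] bexI[of _ "bar v"])
qed

lemma critical_negative_unique:
  assumes "critical w" "u \<in> set w" "v \<in> set w" "\<not> positive u" "\<not> positive v"
  shows "u = v \<or> u = bar v"
proof -
  have "card (negatives w) = 1" using assms(1) by (simp add: critical_def)
  then obtain k where k: "negatives w = {k}" by (auto simp: card_1_singleton_iff)
  have "crossing u \<in> negatives w" "crossing v \<in> negatives w" using assms by (auto simp: negatives_def)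
  then have "crossing u = crossing v" using k by simp
  then show ?thesis
    using gauss_word_same_crossing[OF knot_wordD(1)[OF critical_knot_word[OF assms(1)]] assms(2,3)] by blast
qed

lemma critical_apairs:
  assumes w: "critical (c # Y)" and c: "over c" "\<not> positive c"
  shows "card (apairs Y) = 1"
proof -
  note g = knot_wordD[OF critical_knot_word[OF w]]
  have "bar c \<in> set Y" using gauss_word_bar[OF g(1), of c] by simp
  then obtain S R where Y: "Y = S @ bar c # R" by (auto simp: in_set_conv_decomp)
  have d: "distinct (c # S @ bar c # R)" using g(3) Y by simp
  have "positive v" if "v \<in> set (S @ R)" for v
  proof (rule ccontr)
    assume "\<not> positive v"
    then have "v = c \<or> v = bar c" using critical_negative_unique[OF w, of v c] that Y c by auto
    then show False using that d by auto
  qed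
  then have "int (card (apairs (S @ R))) = 1"
    using a2_eq_card[OF c(1) d] w Y by (simp add: critical_def)
  moreover have "apairs Y = apairs (S @ R)" unfolding Y by (rule apairs_remove[where p = c]) (use d c in auto)
  ultimately show ?thesis by simp
qed

lemma apairs_mono: "subseq u w \<Longrightarrow> apairs u \<subseteq> apairs w"
  unfolding apairs_def using subseq_order.trans by blast

lemma apairsI:
  assumes "\<not> over x" "over y"
  shows "(x, y) \<in> apairs (A @ x # B @ y # C @ bar x # D @ bar y # E)"
proof -
  have "subseq [x, y, bar x, bar y] (A @ x # B @ y # C @ bar x # D @ bar y # E)"
    by (intro subseq_drop_many subseq_Cons2 | simp)+
  then show ?thesis using assms by (simp add: apairs_def)
qed

section \<open>Loops on one level\<close>

lemma subseq_pair_iff: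
  assumes "distinct (A @ v # S)"
  shows "subseq [v, u] (A @ v # S) \<longleftrightarrow> u \<in> set S"
  using assms by (induction A) (auto simp: subseq_Cons2_iff subseq_singleton_left)

lemma subseq_pair_iff':
  assumes "distinct (A @ v # S)"
  shows "subseq [u, v] (A @ v # S) \<longleftrightarrow> u \<in> set A"
  using assms by (induction A) (auto simp: subseq_Cons2_iff subseq_singleton_left dest: subseq_set)

text \<open>Without counted pairs there is a loop which contains, with every over passage, also its
  partner. Either it consists of under passages only, or it contains a smaller loop, to which the
  induction applies.\<close>

lemma under_loop:
  assumes "distinct Y" "apairs Y = {}" "\<And>A f F B y. Y = A @ f # F @ bar f # B \<Longrightarrow> y \<in> set F \<Longrightarrow> over y \<Longrightarrow> bar y \<in> set Y"
    "\<exists>v\<in>set Y. bar v \<in> set Y"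
  shows "\<exists>A v E B. Y = A @ v # E @ bar v # B \<and> (\<forall>y\<in>set E. \<not> over y)"
  using assms
proof (induction "length Y" arbitrary: Y rule: less_induct)
  case less
  have "\<exists>A v E B. Y = A @ v # E @ bar v # B \<and> (\<forall>y\<in>set E. over y \<longrightarrow> bar y \<in> set E)"
  proof (cases "\<exists>v\<in>set Y. \<not> over v \<and> subseq [v, bar v] Y")
    case True
    \<comment> \<open>Take the first chord met under first. For an over passage \<open>y\<close>
      inside it, a partner behind the loop would make \<open>(v, y)\<close> a counted pair, and a
      partner before it would start an earlier chord of this kind.\<close>
    obtain A v S where Y: "Y = A @ v # S" and v: "\<not> over v" "subseq [v, bar v] Y"
      and A: "\<forall>y\<in>set A. \<not> (\<not> over y \<and> subseq [y, bar y] Y)"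
      using split_list_first_prop[OF True] by blast
    have "bar v \<in> set S" using subseq_pair_iff[of A v S "bar v"] v(2) less.prems(1) unfolding Y by blast
    then obtain E B where S: "S = E @ bar v # B" by (auto simp: in_set_conv_decomp)
    have Y': "Y = A @ v # E @ bar v # B" using Y S by simp
    have "bar y \<in> set E" if y: "y \<in> set E" "over y" for y
    proof -
      have "bar y \<in> set Y" by (rule less.prems(3)[OF Y' y])
      moreover have "bar y \<noteq> v" "bar y \<noteq> bar v" using y less.prems(1) unfolding Y' by auto
      moreover have "bar y \<notin> set B"
      proof
        assume "bar y \<in> set B"
        then obtain B1 B2 where "B = B1 @ bar y # B2" by (auto simp: in_set_conv_decomp)
        moreover obtain E1 E2 where "E = E1 @ y # E2" using y by (auto simp: in_set_conv_decomp)
        ultimately have "(v, y) \<in> apairs Y" using apairsI[OF v(1) y(2), of A E1 E2 B1 B2] unfolding Y' by simp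
        then show False using less.prems(2) by simp
      qed
      moreover have "bar y \<notin> set A"
      proof
        assume a: "bar y \<in> set A"
        then obtain A1 A2 where "A = A1 @ bar y # A2" by (auto simp: in_set_conv_decomp)
        then have "Y = A1 @ bar y # (A2 @ v # E @ bar v # B)" unfolding Y' by simp
        then have "subseq [bar y, bar (bar y)] Y"
          using subseq_pair_iff[of A1 "bar y" "A2 @ v # E @ bar v # B" y] less.prems(1) y(1) by simp
        then show False using A a y(2) by auto
      qed
      ultimately show ?thesis unfolding Y' by auto
    qed
    then show ?thesis using Y' by blast
  next
    case False
    obtain v where v: "v \<in> set Y" "bar v \<in> set Y" "\<not> over v" using less.prems(4) bar_simps(2,4) by metis
    have ord: "subseq [bar u, u] Y" if u: "u \<in> set Y" "bar u \<in> set Y" "\<not> over u" for u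
    proof -
      obtain A B where Y: "Y = A @ u # B" using u(1) by (auto simp: in_set_conv_decomp)
      have "\<not> subseq [u, bar u] Y" using False u by blast
      then have "bar u \<notin> set B" using subseq_pair_iff[of A u B "bar u"] less.prems(1) unfolding Y by blast
      then have "bar u \<in> set A" using u(2) unfolding Y by auto
      then show ?thesis using subseq_pair_iff'[of A u B "bar u"] less.prems(1) unfolding Y by blast
    qed
    have "\<exists>u\<in>set Y. \<not> over u \<and> bar u \<in> set Y" using v by blast
    \<comment> \<open>Now every chord is met over first; take the one that ends last. For an over
      passage inside, a partner behind the loop would end later, and a partner before the loop would
      be met under first.\<close>
    from split_list_last_prop[OF this]
    obtain A' u B where Y: "Y = A' @ u # B" and u: "\<not> over u" "bar u \<in> set Y"
      and B: "\<forall>y\<in>set B. \<not> (\<not> over y \<and> bar y \<in> set Y)"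
      by blast
    have "bar u \<in> set A'" using subseq_pair_iff'[of A' u B "bar u"] ord[of u] u less.prems(1) unfolding Y by auto
    then obtain A E where A': "A' = A @ bar u # E" by (auto simp: in_set_conv_decomp)
    have Y': "Y = A @ bar u # E @ bar (bar u) # B" using Y A' by simp
    have "bar y \<in> set E" if y: "y \<in> set E" "over y" for y
    proof -
      have byY: "bar y \<in> set Y" by (rule less.prems(3)[OF Y' y])
      moreover have "bar y \<noteq> u" "bar y \<noteq> bar u" using y less.prems(1) unfolding Y' by auto
      moreover have yY: "y \<in> set Y" using y unfolding Y' by simp
      moreover have "bar y \<notin> set B" using B y(2) yY by auto
      moreover have "bar y \<notin> set A"
      proof
        assume a: "bar y \<in> set A"
        then obtain A1 A2 where A1: "A = A1 @ bar y # A2" by (auto simp: in_set_conv_decomp)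
        have Y1: "Y = A1 @ bar y # (A2 @ bar u # E @ u # B)" unfolding Y' A1 by simp
        have "y \<in> set A1" using subseq_pair_iff'[of A1 "bar y" "A2 @ bar u # E @ u # B" y]
            ord[of "bar y"] byY yY y(2) less.prems(1) unfolding Y1 by auto
        then show False using y(1) less.prems(1) unfolding Y1 by auto
      qed
      ultimately show ?thesis unfolding Y' by auto
    qed
    then show ?thesis using Y' by blast
  qed
  then obtain A v E B where Y: "Y = A @ v # E @ bar v # B" and E: "\<And>y. y \<in> set E \<Longrightarrow> over y \<Longrightarrow> bar y \<in> set E" by blast
  show ?case
  proof (cases "\<forall>y\<in>set E. \<not> over y")
    case True
    then show ?thesis using Y by blast
  next
    case False
    have sE: "subseq E Y" using sublist_imp_subseq[OF sublist_appendI[of E "A @ [v]" "bar v # B"]] unfolding Y by simp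
    have "\<exists>A' v' E' B'. E = A' @ v' # E' @ bar v' # B' \<and> (\<forall>y\<in>set E'. \<not> over y)"
    proof (rule less.hyps)
      show "length E < length Y" unfolding Y by simp
      show "distinct E" using less.prems(1) unfolding Y by simp
      show "apairs E = {}" using apairs_mono[OF sE] less.prems(2) by simp
      show "bar y \<in> set E" if "E = A' @ f # F @ bar f # B'" "y \<in> set F" "over y" for A' f F B' y
        using E that by simp
      show "\<exists>v\<in>set E. bar v \<in> set E" using False E by blast
    qed
    then obtain A' v' E' B' where "E = A' @ v' # E' @ bar v' # B'" "\<forall>y\<in>set E'. \<not> over y" by blast
    then show ?thesis using Y
      by (intro exI[of _ "A @ v # A'"] exI[of _ v'] exI[of _ E'] exI[of _ "B' @ bar v # B"]) simp
  qed
qed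

lemma sum_eps_over:
  assumes "\<And>y. y \<in> set E \<Longrightarrow> over y = o'"
  shows "(\<Sum>x\<leftarrow>E. eps x) = (if o' then 1 else - 1) *
    (int (length (filter positive E)) - int (length (filter (\<lambda>v. \<not> positive v) E)))"
  using assms by (induction E) (auto simp: eps_def fr_def)

lemma lk_zero: "\<forall>x\<in>set U. bar x \<notin> A \<Longrightarrow> lk U A = 0"
  by (induction U) (simp_all add: lk_Cons)

text \<open>If a passage on the arc \<open>M\<close> had its partner on the rest of
  \<open>R\<close>, the resulting loop would cross \<open>S\<close> exactly once, against
  \<open>disjoint_loops_index\<close>. So \<open>M\<close> is a local knot.\<close>

lemma clasped_arc_closed:
  assumes w: "knot_word (v # S @ bar v # R1 @ p' # M @ q' # R2)"
    and p': "bar p' \<in> set S" "bar q' \<in> set S"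
    and S: "\<And>x. x \<in> set S \<Longrightarrow> bar x \<in> set S \<or> bar x = p' \<or> bar x = q'"
  shows "\<forall>m\<in>set M. bar m \<in> set M"
proof
  fix m assume m: "m \<in> set M"
  let ?w = "v # S @ bar v # R1 @ p' # M @ q' # R2"
  note g = knot_wordD[OF w]
  have nS: "bar x \<notin> set S" if "x \<in> set (R1 @ M @ R2)" for x
  proof
    assume "bar x \<in> set S"
    then have "x \<in> set S \<or> x = p' \<or> x = q'" using S[of "bar x"] by simp
    then show False using that g(3) by auto
  qed
  show "bar m \<in> set M"
  proof (rule ccontr)
    assume n: "bar m \<notin> set M"
    have "bar m \<in> set ?w" using gauss_word_bar[OF g(1), of m] m by simp
    moreover have "bar m \<notin> set S" using nS m by simp
    moreover have "bar m \<noteq> v" "bar m \<noteq> bar v" using m g(3) by auto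
    moreover have "bar m \<noteq> p'" "bar m \<noteq> q'" using p' nS[of m] m g(3) by (auto simp: bar_eq_iff[symmetric, of "bar m"] simp del: bar_eq_iff)
    ultimately have "bar m \<in> set R1 \<or> bar m \<in> set R2" using n by auto
    obtain M1 M2 where M: "M = M1 @ m # M2" using m by (auto simp: in_set_conv_decomp)
    from \<open>bar m \<in> set R1 \<or> bar m \<in> set R2\<close> show False
    proof
      assume "bar m \<in> set R1"
      then obtain X1 X2 where R1: "R1 = X1 @ bar m # X2" by (auto simp: in_set_conv_decomp)
      have "knot_word (v # S @ bar v # X1 @ bar m # (X2 @ p' # M1) @ bar (bar m) # (M2 @ q' # R2))" using w R1 M by simp
      from disjoint_loops_index[OF this] have "lk (X2 @ p' # M1) (set S) = 0" .
      moreover have "lk X2 (set S) = 0" "lk M1 (set S) = 0" using nS R1 M by (auto intro: lk_zero)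
      ultimately show False using p' by (auto simp: lk_Cons eps_def split: if_splits)
    next
      assume "bar m \<in> set R2"
      then obtain X1 X2 where R2: "R2 = X1 @ bar m # X2" by (auto simp: in_set_conv_decomp)
      have "knot_word (v # S @ bar v # (R1 @ p' # M1) @ m # (M2 @ q' # X1) @ bar m # X2)" using w R2 M by simp
      from disjoint_loops_index[OF this] have "lk (M2 @ q' # X1) (set S) = 0" .
      moreover have "lk M2 (set S) = 0" "lk X1 (set S) = 0" using nS R2 M by (auto intro: lk_zero)
      ultimately show False using p' by (auto simp: lk_Cons eps_def split: if_splits)
    qed
  qed
qed

text \<open>On a constant level \<open>eps\<close> is the sign of the crossing up to a global
  factor, so by \<open>loop_eps\<close> the loop has as many positive as negative crossings. With
  only one negative crossing available it is a kink, or it forms a bigon around a local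
  knot.\<close>

lemma no_monochromatic_loop:
  assumes w: "critical (v # E @ bar v # R)" and E: "\<And>y. y \<in> set E \<Longrightarrow> over y = o'"
  shows False
proof -
  let ?w = "v # E @ bar v # R"
  note k = critical_knot_word[OF w]
  note g = knot_wordD[OF k]
  have len: "length (filter positive E) = length (filter (\<lambda>v. \<not> positive v) E)"
    using loop_eps[OF k] sum_eps_over[of E o', OF E] by (cases o') simp_all
  have neg: "u = u'" if "u \<in> set E" "u' \<in> set E" "\<not> positive u" "\<not> positive u'" for u u'
    using critical_negative_unique[OF w, of u u'] that E[OF that(1)] E[OF that(2)] by auto
  have "length (filter (\<lambda>v. \<not> positive v) E) \<le> 1"
  proof -
    have d: "distinct (filter (\<lambda>v. \<not> positive v) E)" using g(3) by simp
    have "card (set (filter (\<lambda>v. \<not> positive v) E)) \<le> 1" using neg by (intro card_le_Suc0_iff_eq[THEN iffD2, folded One_nat_def]) auto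
    then show ?thesis using distinct_card[OF d] by simp
  qed
  then have l2: "length E = 0 \<or> length E = 2 \<and> length (filter positive E) = 1"
    using len sum_length_filter_compl[of positive E] by arith
  show False
  proof (cases "E = []")
    case True
    then show False using critical_no_kink[of "[]" v R] w by simp
  next
    case False
    then have l: "length E = 2" and l1: "length (filter positive E) = 1" using l2 by auto
    then obtain p q where pq: "E = [p, q]"
      unfolding numeral_2_eq_2 length_Suc_conv length_0_conv by blast
    have ps: "positive p \<noteq> positive q" using l1 unfolding pq by (auto split: if_splits)
    have ov: "over p = over q" using E[of p] E[of q] unfolding pq by simp
    have pqn: "p \<noteq> v" "p \<noteq> bar v" "q \<noteq> v" "q \<noteq> bar v" "p \<noteq> q" using g(3) unfolding pq by auto
    have inR: "bar x \<in> set R" if x: "x = p \<or> x = q" for x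
    proof -
      have "x \<in> set ?w" using x unfolding pq by auto
      then have "bar x \<in> set ?w" by (rule gauss_word_bar[OF g(1)])
      moreover have "bar x \<noteq> p" "bar x \<noteq> q" using x ov by auto
      moreover have "bar x \<noteq> v" "bar x \<noteq> bar v" using x pqn by auto
      ultimately show ?thesis unfolding pq by auto
    qed
    have dR: "distinct R" using g(3) by simp
    \<comment> \<open>The two passages under or over the loop may come in either order; the arc
      \<open>M\<close> between them carries the local knot.\<close>
    obtain R1 M R2 p' q' where R: "R = R1 @ p' # M @ q' # R2" and p': "p' = bar p \<and> q' = bar q \<or> p' = bar q \<and> q' = bar p"
    proof -
      have "bar p \<noteq> bar q" using pqn(5) by simp
      from split_two[OF inR[OF disjI1[OF refl]] inR[OF disjI2[OF refl]] this dR]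
      show thesis by (elim exE conjE) (rule that)
    qed
    have M: "\<forall>m\<in>set M. bar m \<in> set M"
      by (rule clasped_arc_closed[of v E R1 p' M q' R2]) (use k R pq p' in auto)
    have "critical ([p, q] @ (bar v # R1) @ [p'] @ M @ [q'] @ (R2 @ [v]))"
      using critical_append[of "[v]" "E @ bar v # R"] w pq R by simp
    then show False using critical_no_bead[OF M ov ps p'] by blast
  qed
qed

text \<open>Such a loop either has under passages only or contains, by \<open>under_loop\<close>, a
  smaller loop of this kind.\<close>

lemma no_pairless_loop:
  assumes w: "critical (v # E @ bar v # R)" and a: "apairs E = {}" and E: "\<And>y. y \<in> set E \<Longrightarrow> over y \<Longrightarrow> bar y \<in> set E"
  shows False
proof (cases "\<exists>y\<in>set E. over y")
  case True
  have "distinct E" using knot_wordD(3)[OF critical_knot_word[OF w]] by simp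
  then have "\<exists>A v' E' B. E = A @ v' # E' @ bar v' # B \<and> (\<forall>y\<in>set E'. \<not> over y)"
    by (rule under_loop[OF _ a]) (use E True in auto)
  then obtain A v' E' B where E': "E = A @ v' # E' @ bar v' # B" "\<forall>y\<in>set E'. \<not> over y" by blast
  have "critical (v' # E' @ bar v' # (B @ bar v # R @ v # A))"
    using critical_append[of "v # A" "v' # E' @ bar v' # B @ bar v # R"] w E'(1) by simp
  from no_monochromatic_loop[OF this, of False] E'(2) show False by auto
next
  case False
  then show False using no_monochromatic_loop[OF w, of False] by auto
qed

text \<open>If the partner of \<open>p\<close> is \<open>c\<close> or lies in \<open>A\<close> or
  \<open>B\<close>, a loop with over passages only arises. If it lies in \<open>P\<close> or
  \<open>C\<close>, an over passage that leaves the loop at \<open>p\<close> would give a second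
  counted pair with \<open>p\<close>, so the loop falls under
  \<open>no_pairless_loop\<close>.\<close>

lemma core_left_end:
  assumes w: "critical (c # A @ p # P @ C @ Q @ B)" and c: "over c"
    and AB: "\<And>y. y \<in> set (A @ B) \<Longrightarrow> over y"
    and a: "apairs (A @ p # P @ C @ Q @ B) = {(i, j)}" and C: "C = i # D @ [bar j]" and p: "\<not> over p"
  shows "bar p \<in> set Q"
proof (rule ccontr)
  assume nQ: "bar p \<notin> set Q"
  let ?w = "c # A @ p # P @ C @ Q @ B"
  note g = knot_wordD[OF critical_knot_word[OF w]]
  have "bar p \<in> set ?w" using gauss_word_bar[OF g(1), of p] by simp
  then consider "bar p = c" | "bar p \<in> set A" | "bar p \<in> set B" | "bar p \<in> set (P @ C)" using nQ by auto
  then show False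
  proof cases
    case 1
    then have "critical (c # A @ bar c # (P @ C @ Q @ B))" using w by (metis bar_simps(4))
    from no_monochromatic_loop[OF this, of True] AB show False by simp
  next
    case 2
    then obtain A1 A2 where A: "A = A1 @ bar p # A2" by (auto simp: in_set_conv_decomp)
    have "critical (bar p # A2 @ bar (bar p) # (P @ C @ Q @ B @ c # A1))"
      using critical_append[of "c # A1" "bar p # A2 @ p # P @ C @ Q @ B"] w A by simp
    from no_monochromatic_loop[OF this, of True] AB A show False by simp
  next
    case 3
    then obtain B1 B2 where B: "B = B1 @ bar p # B2" by (auto simp: in_set_conv_decomp)
    have "critical (bar p # (B2 @ c # A) @ bar (bar p) # (P @ C @ Q @ B1))"
      using critical_append[of "c # A @ p # P @ C @ Q @ B1" "bar p # B2"] w B by simp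
    from no_monochromatic_loop[OF this, of True] AB B c show False by auto
  next
    case 4
    then obtain E R where E: "P @ C = E @ bar p # R" using split_list[of "bar p" "P @ C"] by blast
    have Y: "A @ p # P @ C @ Q @ B = A @ p # E @ bar p # R @ Q @ B" using E by (metis append.assoc append_Cons)
    have EE: "bar y \<in> set E" if y: "y \<in> set E" "over y" for y
    proof -
      have dY: "distinct (c # A @ p # E @ bar p # R @ Q @ B)" using g(3) unfolding Y .
      have "y \<in> set ?w" unfolding Y using y by simp
      then have "bar y \<in> set ?w" by (rule gauss_word_bar[OF g(1)])
      moreover have "bar y \<noteq> c" "bar y \<notin> set A" "bar y \<notin> set B" using y(2) c AB[of "bar y"] by auto
      moreover have "bar y \<noteq> p" "bar y \<noteq> bar p" using y(1) dY by auto
      moreover have "bar y \<notin> set (R @ Q)"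
      proof
        assume "bar y \<in> set (R @ Q)"
        then obtain R1 R2 where R: "R @ Q = R1 @ bar y # R2" using split_list[of "bar y" "R @ Q"] by blast
        obtain E1 E2 where E1: "E = E1 @ y # E2" using y by (auto simp: in_set_conv_decomp)
        have e: "A @ p # E @ bar p # R @ Q @ B = A @ p # E1 @ y # E2 @ bar p # R1 @ bar y # (R2 @ B)"
          using R unfolding E1 by (metis append.assoc append_Cons)
        have "(p, y) \<in> apairs (A @ p # P @ C @ Q @ B)"
          unfolding Y e by (rule apairsI[OF p y(2)])
        then have "p = i" using a by simp
        then show False using g(3) C by simp
      qed
      ultimately show ?thesis unfolding Y by auto
    qed
    have "sublist E (A @ p # P @ C @ Q @ B)" unfolding Y using sublist_appendI[of E "A @ [p]" "bar p # R @ Q @ B"] by simp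
    from apairs_mono[OF sublist_imp_subseq[OF this]] have sE: "apairs E \<subseteq> {(i, j)}" unfolding a .
    have "apairs E = {}"
    proof (rule ccontr)
      assume "apairs E \<noteq> {}"
      then have "(i, j) \<in> apairs E" using sE by auto
      then have "bar j \<in> set E" unfolding apairs_def by (auto dest!: subseq_set)
      moreover have "bar j \<in> set (bar p # R)"
      proof -
        have "last (P @ C) = bar j" using C by simp
        then have "last (bar p # R) = bar j" unfolding E by simp
        then show ?thesis by (metis last_in_set list.distinct(1))
      qed
      moreover have "distinct (P @ C)" using g(3) by auto
      ultimately show False unfolding E by auto
    qed
    moreover have "critical (p # E @ bar p # (R @ Q @ B @ c # A))"
      using critical_append[of "c # A" "p # E @ bar p # R @ Q @ B"] w unfolding Y by simp
    ultimately show False using no_pairless_loop EE by blast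
  qed
qed

text \<open>The reversed situation of \<open>core_left_end\<close>; here a second pair would be
  \<open>(bar y, bar q)\<close>.\<close>

lemma core_right_end:
  assumes w: "critical (c # A @ P @ C @ Q @ q # B)" and c: "over c"
    and AB: "\<And>y. y \<in> set (A @ B) \<Longrightarrow> over y"
    and a: "apairs (A @ P @ C @ Q @ q # B) = {(i, j)}" and C: "C = i # D @ [bar j]" and q: "\<not> over q"
  shows "bar q \<in> set P"
proof (rule ccontr)
  assume nP: "bar q \<notin> set P"
  let ?w = "c # A @ P @ C @ Q @ q # B"
  note g = knot_wordD[OF critical_knot_word[OF w]]
  have "bar q \<in> set ?w" using gauss_word_bar[OF g(1), of q] by simp
  then consider "bar q = c" | "bar q \<in> set A" | "bar q \<in> set B" | "bar q \<in> set (C @ Q)" using nP by auto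
  then show False
  proof cases
    case 1
    then have "critical (q # B @ bar q # (A @ P @ C @ Q))" using critical_append[of "c # A @ P @ C @ Q" "q # B"] w by simp
    from no_monochromatic_loop[OF this, of True] AB show False by simp
  next
    case 2
    then obtain A1 A2 where A: "A = A1 @ bar q # A2" by (auto simp: in_set_conv_decomp)
    have "critical (q # (B @ c # A1) @ bar q # (A2 @ P @ C @ Q))"
      using critical_append[of "c # A @ P @ C @ Q" "q # B"] w A by simp
    from no_monochromatic_loop[OF this, of True] AB A c show False by auto
  next
    case 3
    then obtain B1 B2 where B: "B = B1 @ bar q # B2" by (auto simp: in_set_conv_decomp)
    have "critical (q # B1 @ bar q # (B2 @ c # A @ P @ C @ Q))"
      using critical_append[of "c # A @ P @ C @ Q" "q # B"] w B by simp
    from no_monochromatic_loop[OF this, of True] AB B show False by simp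
  next
    case 4
    then obtain R E where E: "C @ Q = R @ bar q # E" using split_list[of "bar q" "C @ Q"] by blast
    have Y: "A @ P @ C @ Q @ q # B = A @ P @ R @ bar q # E @ q # B" using E by (metis append.assoc append_Cons)
    have EE: "bar y \<in> set E" if y: "y \<in> set E" "over y" for y
    proof -
      have dY: "distinct (c # A @ P @ R @ bar q # E @ q # B)" using g(3) unfolding Y .
      have "y \<in> set ?w" unfolding Y using y by simp
      then have "bar y \<in> set ?w" by (rule gauss_word_bar[OF g(1)])
      moreover have "bar y \<noteq> c" "bar y \<notin> set A" "bar y \<notin> set B" using y(2) c AB[of "bar y"] by auto
      moreover have "bar y \<noteq> q" "bar y \<noteq> bar q" using y(1) dY by auto
      moreover have "bar y \<notin> set (P @ R)"
      proof
        assume "bar y \<in> set (P @ R)"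
        then obtain R1 R2 where R: "P @ R = R1 @ bar y # R2" using split_list[of "bar y" "P @ R"] by blast
        obtain E1 E2 where E1: "E = E1 @ y # E2" using y by (auto simp: in_set_conv_decomp)
        have e: "A @ P @ R @ bar q # E @ q # B = (A @ R1) @ bar y # R2 @ bar q # E1 @ y # E2 @ q # B"
          using R unfolding E1 by (metis append.assoc append_Cons)
        have "(bar y, bar q) \<in> apairs (A @ P @ C @ Q @ q # B)"
          unfolding Y e using apairsI[of "bar y" "bar q" "A @ R1" R2 E1 E2 B] q y(2) by simp
        then have "q = bar j" using a by (metis Pair_inject bar_simps(4) singletonD)
        then show False using g(3) C by simp
      qed
      ultimately show ?thesis unfolding Y by auto
    qed
    have "sublist E (A @ P @ C @ Q @ q # B)" unfolding Y using sublist_appendI[of E "A @ P @ R @ [bar q]" "q # B"] by simp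
    from apairs_mono[OF sublist_imp_subseq[OF this]] have sE: "apairs E \<subseteq> {(i, j)}" unfolding a .
    have "apairs E = {}"
    proof (rule ccontr)
      assume "apairs E \<noteq> {}"
      then have ij: "(i, j) \<in> apairs E" using sE by auto
      then have "i \<in> set E" using apairs_subset[of E] by auto
      moreover have "i \<in> set (R @ [bar q])"
      proof -
        have "hd (C @ Q) = i" using C by simp
        then have "hd (R @ [bar q]) = i" unfolding E by (cases R) simp_all
        then show ?thesis by (metis hd_in_set snoc_eq_iff_butlast)
      qed
      moreover have "distinct (C @ Q)" using g(3) by auto
      ultimately show False unfolding E by auto
    qed
    moreover have "critical (bar q # E @ bar (bar q) # (B @ c # A @ P @ R))"
      using critical_append[of "c # A @ P @ R" "bar q # E @ q # B"] w unfolding Y by simp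
    ultimately show False using no_pairless_loop EE by blast
  qed
qed

text \<open>Over passages at the outer ends of \<open>P\<close> and \<open>Q\<close> are moved to
  \<open>A\<close> and \<open>B\<close>. Once no end can be moved, the outermost passages are under
  and their partners lie on opposite sides of \<open>C\<close>.\<close>

lemma core_complement_over:
  assumes "critical (c # A @ P @ C @ Q @ B)" "over c" "\<And>y. y \<in> set (A @ B) \<Longrightarrow> over y"
    "apairs (A @ P @ C @ Q @ B) = {(i, j)}" "C = i # D @ [bar j]"
  shows "\<forall>y\<in>set (P @ Q). over y"
  using assms
proof (induction "length P + length Q" arbitrary: A B P Q rule: less_induct)
  case less
  consider "P = []" "Q = []" | p P' where "P = p # P'" "over p" | Q' q where "Q = Q' @ [q]" "over q"
    | p P' where "P = p # P'" "\<not> over p" "Q = [] \<or> \<not> over (last Q)"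
    | Q' q where "P = []" "Q = Q' @ [q]" "\<not> over q"
    by (cases P; cases Q rule: rev_cases) auto
  then show ?case
  proof cases
    case 2
    have "\<forall>y\<in>set (P' @ Q). over y"
      by (rule less.hyps[of P' Q "A @ [p]" B]) (use less.prems 2 in auto)
    then show ?thesis using 2 by simp
  next
    case 3
    have "\<forall>y\<in>set (P @ Q'). over y"
      by (rule less.hyps[of P Q' A "q # B"]) (use less.prems 3 in auto)
    then show ?thesis using 3 by simp
  next
    case 4
    have bp: "bar p \<in> set Q"
      by (rule core_left_end[of c A p P' C Q B i j D]) (use less.prems 4 in auto)
    then obtain Q' q where Q: "Q = Q' @ [q]" by (cases Q rule: rev_cases) auto
    have q: "\<not> over q" using 4 Q by simp
    have bq: "bar q \<in> set P"
      by (rule core_right_end[of c A P C Q' q B i j D]) (use less.prems Q q in auto)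
    have "bar q \<in> set P'" using bq 4 q by auto
    then obtain P1 P2 where P1: "P' = P1 @ bar q # P2" by (auto simp: in_set_conv_decomp)
    have "bar p \<in> set Q'" using bp Q 4(2) q by auto
    then obtain Q1 Q2 where Q1: "Q' = Q1 @ bar p # Q2" by (auto simp: in_set_conv_decomp)
    \<comment> \<open>The passages \<open>p\<close>, \<open>bar q\<close>, \<open>bar p\<close>,
      \<open>q\<close> occur in this order around \<open>C\<close>, which is a second counted
      pair.\<close>
    have "(p, bar q) \<in> apairs (A @ P @ C @ Q @ B)"
      using apairsI[of p "bar q" A P1 "P2 @ C @ Q1" Q2 B] 4(1,2) q P1 Q1 Q by simp
    then have "p = i" using less.prems(4) by simp
    then have False using knot_wordD(3)[OF critical_knot_word[OF less.prems(1)]] less.prems(5) 4(1) by simp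
    then show ?thesis ..
  next
    case 5
    have "bar q \<in> set P"
      by (rule core_right_end[of c A P C Q' q B i j D]) (use less.prems 5 in auto)
    then show ?thesis using 5(1) by simp
  qed simp
qed

lemma lk_const: "\<forall>x\<in>set U. bar x \<in> A \<and> eps x = e \<Longrightarrow> lk U A = e * int (length U)"
  by (induction U) (simp_all add: lk_Cons algebra_simps)

text \<open>Terms of equal sign can only add up to zero if there are none; this turns index
  identities into statements that strands are disjoint.\<close>

lemma lk_same_sign:
  assumes "lk U A = 0" "\<And>x. x \<in> set U \<Longrightarrow> bar x \<in> A \<Longrightarrow> eps x = e" "e = 1 \<or> e = - 1" "x \<in> set U"
  shows "bar x \<notin> A"
proof
  assume a: "bar x \<in> A"
  obtain U1 U2 where U: "U = U1 @ x # U2" using assms(4) by (auto simp: in_set_conv_decomp)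
  have nn: "e * lk V A \<ge> 0" if "set V \<subseteq> set U" for V
    using that by (induction V) (use assms(2,3) in \<open>auto simp: lk_Cons\<close>)
  have "e * lk U A = e * lk U1 A + e * e + e * lk U2 A"
    using a assms(2)[OF assms(4) a] unfolding U by (simp add: lk_Cons algebra_simps)
  moreover have "e * lk U1 A \<ge> 0" "e * lk U2 A \<ge> 0" by (rule nn, use U in auto)+
  ultimately show False using assms(1,3) by auto
qed

text \<open>The shape of a minimal counterexample: \<open>X\<close> is the part of the knot above the arc spanned by the
  only counted pair \<open>(i, j)\<close>.\<close>

locale core_arc =
  fixes c i j :: passage and M1 M2 M3 X :: "passage list"
  assumes critical: "critical (i # M1 @ j # M2 @ bar i # M3 @ bar j # X)"
    and c: "c \<in> set X" "\<not> positive c"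
    and X: "\<And>x. x \<in> set X \<Longrightarrow> over x"
    and ij: "\<not> over i" "over j"
    and pairs: "apairs (i # M1 @ j # M2 @ bar i # M3 @ [bar j]) \<subseteq> {(i, j)}"
begin

abbreviation "T \<equiv> i # M1 @ j # M2 @ bar i # M3 @ [bar j]"

lemma gauss: "gauss_word (T @ X)" "distinct (T @ X)"
  using knot_wordD[OF critical_knot_word[OF critical]] by simp_all

lemma knot: "knot_word (i # M1 @ j # M2 @ bar i # M3 @ bar j # X)"
  by (rule critical_knot_word[OF critical])

lemma bar_in: "y \<in> set T \<or> y \<in> set X \<Longrightarrow> bar y \<in> set T \<or> bar y \<in> set X"
  using gauss_word_bar[OF gauss(1), of y] by auto

lemma block_bar:
  assumes "y \<in> set (M1 @ M2 @ M3 @ X)"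
  shows "bar y \<noteq> i" "bar y \<noteq> j" "bar y \<noteq> bar i" "bar y \<noteq> bar j" "y \<noteq> j"
    "bar y \<in> set M1 \<or> bar y \<in> set M2 \<or> bar y \<in> set M3 \<or> bar y \<in> set X"
proof -
  have n: "y \<noteq> i" "y \<noteq> j" "y \<noteq> bar i" "y \<noteq> bar j" using assms gauss(2) by auto
  then show ne: "bar y \<noteq> i" "bar y \<noteq> j" "bar y \<noteq> bar i" "bar y \<noteq> bar j" "y \<noteq> j" by auto
  show "bar y \<in> set M1 \<or> bar y \<in> set M2 \<or> bar y \<in> set M3 \<or> bar y \<in> set X"
    using bar_in[of y] assms ne by auto
qed

lemma positive: "y \<in> set (T @ X) \<Longrightarrow> y \<noteq> c \<Longrightarrow> y \<noteq> bar c \<Longrightarrow> positive y"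
  using critical_negative_unique[OF critical, of y c] c by auto

lemma eps_T: "y \<in> set T \<Longrightarrow> y \<noteq> bar c \<Longrightarrow> eps y = (if over y then 1 else - 1)"
  using positive[of y] c(1) gauss(2) by (auto simp: eps_def fr_def)

text \<open>Such a crossing would form the counted pair \<open>(z, j)\<close>.\<close>

lemma no_uo_M1:
  assumes z: "z \<in> set M1" "\<not> over z"
  shows "bar z \<notin> set (M2 @ bar i # M3)"
proof
  assume "bar z \<in> set (M2 @ bar i # M3)"
  then obtain E F where E: "M2 @ bar i # M3 = E @ bar z # F" using split_list[of "bar z" "M2 @ bar i # M3"] by blast
  obtain A B where A: "M1 = A @ z # B" using z(1) by (auto simp: in_set_conv_decomp)
  have e: "T = (i # A) @ z # B @ j # E @ bar z # F @ bar j # []"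
    using arg_cong[OF E, of "\<lambda>l. i # A @ z # B @ j # l @ [bar j]"] unfolding A by simp
  have "(z, j) \<in> apairs T" unfolding e by (rule apairsI[OF z(2) ij(2)])
  then have "z = i" using pairs by auto
  then show False using z(1) gauss(2) by simp
qed

text \<open>Such a crossing would form the counted pair \<open>(i, z)\<close>.\<close>

lemma no_ou_M3:
  assumes z: "z \<in> set (M1 @ j # M2)" "over z" "z \<noteq> j"
  shows "bar z \<notin> set M3"
proof
  assume "bar z \<in> set M3"
  then obtain E F where E: "M3 = E @ bar z # F" by (auto simp: in_set_conv_decomp)
  obtain A B where A: "M1 @ j # M2 = A @ z # B" using split_list[OF z(1)] by blast
  have e: "T = [] @ i # A @ z # B @ bar i # E @ bar z # (F @ [bar j])"
    using arg_cong[OF A, of "\<lambda>l. i # l @ bar i # M3 @ [bar j]"] unfolding E by simp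
  have "(i, z) \<in> apairs T" unfolding e by (rule apairsI[OF ij(1) z(2)])
  then show False using pairs z(3) by auto
qed

text \<open>A self-crossing of \<open>M\<close> would yield, by \<open>under_loop\<close>, a loop
  with under passages only. The hypothesis \<open>cl\<close> is what remains to be verified for each
  of the three blocks.\<close>

lemma no_self_chord:
  assumes M: "T @ X = A @ M @ B" and p: "(i, j) \<notin> apairs M" "sublist M T"
    and cl: "\<And>A f F B y. M = A @ f # F @ bar f # B \<Longrightarrow> y \<in> set F \<Longrightarrow> over y \<Longrightarrow> bar y \<in> set M"
    and v: "v \<in> set M"
  shows "bar v \<notin> set M"
proof
  assume "bar v \<in> set M"
  then have ex: "\<exists>v\<in>set M. bar v \<in> set M" using v by blast
  have d: "distinct M" using gauss(2) unfolding M by simp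
  have a: "apairs M = {}" using apairs_mono[OF sublist_imp_subseq[OF p(2)]] pairs p(1) by auto
  have "\<exists>A v E B. M = A @ v # E @ bar v # B \<and> (\<forall>y\<in>set E. \<not> over y)"
    by (rule under_loop[OF d a _ ex]) (rule cl)
  then obtain A' v' E B' where E: "M = A' @ v' # E @ bar v' # B'" "\<forall>y\<in>set E. \<not> over y" by blast
  have "critical (A @ M @ B)" using critical M by simp
  then have "critical (v' # E @ bar v' # (B' @ B @ A @ A'))"
    using critical_append[of "A @ A'" "v' # E @ bar v' # B' @ B"] E(1) by simp
  from no_monochromatic_loop[OF this, of False] E(2) show False by auto
qed

lemma M2_no_self: "v \<in> set M2 \<Longrightarrow> bar v \<notin> set M2"
proof (rule no_self_chord[of "i # M1 @ [j]" M2 "bar i # M3 @ bar j # X"])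
  show "(i, j) \<notin> apairs M2" using apairs_subset[of M2] gauss(2) by auto
  show "sublist M2 T" using sublist_appendI[of M2 "i # M1 @ [j]" "bar i # M3 @ [bar j]"] by simp
  fix A f F B y assume M2: "M2 = A @ f # F @ bar f # B" and y: "y \<in> set F" "over y"
  have yM: "y \<in> set M2" using M2 y by simp
  have "bar y \<notin> set M1" using no_uo_M1[of "bar y"] y(2) yM by auto
  moreover have "bar y \<notin> set M3" using no_ou_M3[of y] y(2) yM block_bar(5)[of y] by auto
  moreover have "bar y \<notin> set X" using X[of "bar y"] y(2) by auto
  ultimately show "bar y \<in> set M2" using block_bar(6)[of y] yM by simp
qed simp_all

text \<open>A loop inside \<open>M1\<close> is disjoint from the loop at \<open>j\<close>. All
  crossings between them are passed over in \<open>M1\<close> and have the same sign, so by the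
  index identity there are none.\<close>

lemma M1_no_self: "v \<in> set M1 \<Longrightarrow> bar v \<notin> set M1"
proof (rule no_self_chord[of "[i]" M1 "j # M2 @ bar i # M3 @ bar j # X"])
  show "(i, j) \<notin> apairs M1" using apairs_subset[of M1] gauss(2) by auto
  show "sublist M1 T" using sublist_appendI[of M1 "[i]" "j # M2 @ bar i # M3 @ [bar j]"] by simp
  fix A f F B y assume M1: "M1 = A @ f # F @ bar f # B" and y: "y \<in> set F" "over y"
  have yM: "y \<in> set M1" using M1 y by simp
  have "knot_word (f # F @ bar f # B @ j # (M2 @ bar i # M3) @ bar j # (X @ i # A))"
    using knot_word_append[of "i # A" "f # F @ bar f # B @ j # M2 @ bar i # M3 @ bar j # X"] knot unfolding M1 by simp
  from disjoint_loops_index[OF this] have l0: "lk (M2 @ bar i # M3) (set F) = 0" .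
  have "bar z \<notin> set F" if z: "z \<in> set (M2 @ bar i # M3)" for z
  proof (rule lk_same_sign[OF l0 _ _ z, of "- 1"])
    fix x assume x: "x \<in> set (M2 @ bar i # M3)" "bar x \<in> set F"
    then have xM: "bar x \<in> set M1" using M1 by simp
    have "\<not> over x" using no_uo_M1[of "bar x"] xM x(1) by auto
    moreover have "x \<noteq> bar c" using xM gauss(2) c(1) by auto
    ultimately show "eps x = - 1" using eps_T[of x] x(1) by auto
  qed simp
  then have "bar y \<notin> set (M2 @ bar i # M3)" using y(1) by (metis bar_simps(4))
  moreover have "bar y \<notin> set X" using X[of "bar y"] y(2) by auto
  ultimately show "bar y \<in> set M1" using block_bar(6)[of y] yM by auto
qed simp_all

text \<open>Reversed version of the argument for \<open>M1\<close>, now with the loop at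
  \<open>i\<close>.\<close>

lemma M3_no_self: "v \<in> set M3 \<Longrightarrow> bar v \<notin> set M3"
proof (rule no_self_chord[of "i # M1 @ j # M2 @ [bar i]" M3 "bar j # X"])
  show "(i, j) \<notin> apairs M3" using apairs_subset[of M3] gauss(2) by auto
  show "sublist M3 T" using sublist_appendI[of M3 "i # M1 @ j # M2 @ [bar i]" "[bar j]"] by simp
  fix A f F B y assume M3: "M3 = A @ f # F @ bar f # B" and y: "y \<in> set F" "over y"
  have yM: "y \<in> set M3" using M3 y by simp
  have "knot_word (i # (M1 @ j # M2) @ bar i # A @ f # F @ bar f # (B @ bar j # X))"
    using knot unfolding M3 by simp
  from disjoint_loops_index[OF this] have l0: "lk F (set (M1 @ j # M2)) = 0" .
  have "bar z \<notin> set (M1 @ j # M2)" if z: "z \<in> set F" for z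
  proof (rule lk_same_sign[OF l0 _ _ z, of 1])
    fix x assume x: "x \<in> set F" "bar x \<in> set (M1 @ j # M2)"
    then have xM: "x \<in> set M3" using M3 by simp
    have "bar x \<noteq> j" using xM block_bar(2)[of x] by simp
    then have "over x" using no_ou_M3[of "bar x"] x(2) xM by auto
    moreover have "bar x \<noteq> c" using x(2) gauss(2) c(1) by auto
    then have "x \<noteq> bar c" by auto
    ultimately show "eps x = 1" using eps_T[of x] xM by auto
  qed simp
  then have "bar y \<notin> set (M1 @ j # M2)" using y(1) by blast
  moreover have "bar y \<notin> set X" using X[of "bar y"] y(2) by auto
  ultimately show "bar y \<in> set M3" using block_bar(6)[of y] yM by auto
qed simp_all

text \<open>This and the following facts list the blocks that can cross: \<open>X\<close> lies over
  everything else, \<open>M1\<close> and \<open>M3\<close> pass over \<open>M2\<close> only, and no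
  block crosses itself.\<close>

lemma M1_over: "y \<in> set M1 \<Longrightarrow> over y \<Longrightarrow> bar y \<in> set M2"
  using block_bar(5,6)[of y] X[of "bar y"] M1_no_self[of y] no_ou_M3[of y] by auto

lemma M1_under: "y \<in> set M1 \<Longrightarrow> \<not> over y \<Longrightarrow> bar y \<in> set X"
  using block_bar(6)[of y] M1_no_self[of y] no_uo_M1[of y] by auto

lemma M2_under: "y \<in> set M2 \<Longrightarrow> \<not> over y"
  using block_bar(5,6)[of y] X[of "bar y"] M2_no_self[of y] no_uo_M1[of "bar y"] no_ou_M3[of y] by auto

lemma M2_bar: "y \<in> set M2 \<Longrightarrow> bar y \<in> set M1 \<or> bar y \<in> set M3 \<or> bar y \<in> set X"
  using block_bar(6)[of y] M2_no_self[of y] by auto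

lemma M3_over: "y \<in> set M3 \<Longrightarrow> over y \<Longrightarrow> bar y \<in> set M2"
  using block_bar(6)[of y] X[of "bar y"] M3_no_self[of y] no_uo_M1[of "bar y"] by auto

lemma M3_under: "y \<in> set M3 \<Longrightarrow> \<not> over y \<Longrightarrow> bar y \<in> set X"
  using block_bar(2,6)[of y] M3_no_self[of y] no_ou_M3[of "bar y"] by auto

lemma X_bar: "x \<in> set X \<Longrightarrow> bar x \<in> set M1 \<or> bar x \<in> set M2 \<or> bar x \<in> set M3"
  using block_bar(6)[of x] X[of x] X[of "bar x"] by auto

end

text \<open>The base point is placed at \<open>c\<close> to find the single pair and to see that
  everything outside its arc is over; then the word is rotated to start with
  \<open>i\<close>.\<close>

lemma critical_core_arc:
  assumes "critical w"
  shows "\<exists>c i j M1 M2 M3 X. core_arc c i j M1 M2 M3 X"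
proof -
  obtain c where c: "c \<in> set w" "over c" "\<not> positive c" using critical_negative[OF assms] by blast
  then obtain w1 w2 where w: "w = w1 @ c # w2" by (auto simp: in_set_conv_decomp)
  define Y where "Y = w2 @ w1"
  have cY: "critical (c # Y)" using critical_append[of w1 "c # w2"] assms unfolding w Y_def by simp
  obtain i j where a: "apairs Y = {(i, j)}" using critical_apairs[OF cY c(2,3)] by (auto simp: card_1_singleton_iff)
  then have ij: "\<not> over i" "over j" and s: "subseq [i, j, bar i, bar j] Y" unfolding apairs_def by auto
  obtain P Y1 where Y1: "Y = P @ i # Y1" "subseq [j, bar i, bar j] Y1" using list_emb_ConsD[OF s] by blast
  obtain M1 Y2 where Y2: "Y1 = M1 @ j # Y2" "subseq [bar i, bar j] Y2" using list_emb_ConsD[OF Y1(2)] by blast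
  obtain M2 Y3 where Y3: "Y2 = M2 @ bar i # Y3" "subseq [bar j] Y3" using list_emb_ConsD[OF Y2(2)] by blast
  obtain M3 Q where Y4: "Y3 = M3 @ bar j # Q" using list_emb_ConsD[OF Y3(2)] by blast
  let ?C = "i # M1 @ j # M2 @ bar i # M3 @ [bar j]"
  have Y: "Y = P @ ?C @ Q" using Y1 Y2 Y3 Y4 by simp
  have "\<forall>y\<in>set (P @ Q). over y"
    by (rule core_complement_over[of c "[]" P ?C Q "[]" i j "M1 @ j # M2 @ bar i # M3"]) (use cY Y a c in auto)
  moreover have "critical (?C @ Q @ c # P)" using critical_append[of "c # P" "?C @ Q"] cY unfolding Y by simp
  moreover have "apairs ?C \<subseteq> {(i, j)}"
    using apairs_mono[OF sublist_imp_subseq[OF sublist_appendI[of ?C P Q]]] a unfolding Y by simp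
  ultimately have "core_arc c i j M1 M2 M3 (Q @ c # P)"
    using c ij by (intro core_arc.intro) auto
  then show ?thesis by blast
qed

section \<open>The remaining words\<close>

fun inserts :: "'a \<Rightarrow> 'a list \<Rightarrow> 'a list list" where
  "inserts x [] = [[x]]"
| "inserts x (y # ys) = (x # y # ys) # map ((#) y) (inserts x ys)"

text \<open>The letters of each block of the word are known but not their order, so all orders are
  tried.\<close>

fun perms :: "'a list \<Rightarrow> 'a list list" where
  "perms [] = [[]]"
| "perms (x # xs) = concat (map (inserts x) (perms xs))"

text \<open>
  For evaluation, letters are integers: \<open>- x\<close> is the other passage of \<open>x\<close>, and \<open>x\<close> is positive if
  \<open>fr\<close> holds. The negative crossing has number \<open>1\<close>, so that \<open>- 1\<close> is its over passage.
  Conditionals instead of connectives make the simplifier evaluate lazily.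
\<close>

definition ov :: "int \<Rightarrow> bool" where
  "ov x = (if x = 1 \<or> x = - 1 then x < 0 else 0 < x)"

definition neg :: "int \<Rightarrow> bool" where
  "neg x = (x = 1 \<or> x = - 1)"

fun adj :: "int \<Rightarrow> int \<Rightarrow> int list \<Rightarrow> bool" where
  "adj a b (x # y # L) = (if x = a then y = b else adj a b (y # L))"
| "adj a b _ = False"

text \<open>The part of the word before \<open>a\<close> is returned in reverse order.\<close>

fun upto_letter :: "int \<Rightarrow> int list \<Rightarrow> int list \<Rightarrow> (int list \<times> int list) option" where
  "upto_letter a S [] = None"
| "upto_letter a S (x # L) = (if x = a then Some (S, L) else upto_letter a (x # S) L)"

text \<open>Gauss's parity condition, the cheapest necessary condition for planarity.\<close>

fun even_loops :: "int list \<Rightarrow> bool" where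
  "even_loops [] = True"
| "even_loops (x # L) = (case upto_letter (- x) [] L of None \<Rightarrow> even_loops L
     | Some (S, R) \<Rightarrow> if even (length S) then even_loops L else False)"

fun lkz :: "int list \<Rightarrow> int list \<Rightarrow> int" where
  "lkz [] A = 0"
| "lkz (x # U) A = (if List.member A (- x) then (if 0 < x then lkz U A + 1 else lkz U A - 1) else lkz U A)"

fun rots :: "nat \<Rightarrow> int list \<Rightarrow> int list list" where
  "rots 0 L = []"
| "rots (Suc n) L = L # rots n (rotate1 L)"

definition rotations :: "int list \<Rightarrow> int list list" where
  "rotations L = rots (length L) L"

fun index_head :: "int list \<Rightarrow> bool" where
  "index_head [] = True"
| "index_head (x # L) = (case upto_letter (- x) [] L of None \<Rightarrow> True | Some (S, R) \<Rightarrow> lkz R S = 0)"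

text \<open>The identity of \<open>crossed_loops_index\<close> for the chord of \<open>v\<close> and
  all chords \<open>u\<close> interleaved with it. \<open>P\<close> collects the letters between
  \<open>v\<close> and \<open>u\<close>, in reverse order.\<close>

fun cross_heads :: "int \<Rightarrow> int list \<Rightarrow> int list \<Rightarrow> int list \<Rightarrow> bool" where
  "cross_heads v P [] R = True"
| "cross_heads v P (u # Q) R = (if (0 < u) = (0 < v) then cross_heads v (u # P) Q R
     else (case upto_letter (- u) [] R of None \<Rightarrow> cross_heads v (u # P) Q R
       | Some (R', T) \<Rightarrow> if lkz Q P + lkz Q Q + lkz R' P + lkz R' Q = 0 then cross_heads v (u # P) Q R else False))"

fun cross_head :: "int list \<Rightarrow> bool" where
  "cross_head [] = True"
| "cross_head (v # L) = (case upto_letter (- v) [] L of None \<Rightarrow> True | Some (S, R) \<Rightarrow> cross_heads v [] (rev S) R)"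

text \<open>On one level, opposite signs mean that exactly one of the two crossings is the negative
  one.\<close>

fun r2_head :: "int list \<Rightarrow> bool" where
  "r2_head (p # q # L) = (if ov p = ov q then if neg p \<noteq> neg q then if adj (- p) (- q) L then True else adj (- q) (- p) L else False else False)"
| "r2_head _ = False"

fun lazy_ex :: "('a \<Rightarrow> bool) \<Rightarrow> 'a list \<Rightarrow> bool" where
  "lazy_ex P [] = False"
| "lazy_ex P (x # L) = (if P x then True else lazy_ex P L)"

fun lazy_all :: "('a \<Rightarrow> bool) \<Rightarrow> 'a list \<Rightarrow> bool" where
  "lazy_all P [] = True"
| "lazy_all P (x # L) = (if P x then lazy_all P L else False)"

text \<open>The value \<open>0\<close> is not the code of a letter and signals failure.\<close>

fun next_letter :: "int \<Rightarrow> int list \<Rightarrow> int" where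
  "next_letter a (x # y # L) = (if x = a then y else next_letter a (y # L))"
| "next_letter a _ = 0"

fun prev_letter :: "int \<Rightarrow> int list \<Rightarrow> int" where
  "prev_letter a (x # y # L) = (if y = a then x else prev_letter a (y # L))"
| "prev_letter a _ = 0"

text \<open>The variables are those of \<open>tri\<close>, with the first arc at the head of the
  word: its far end \<open>x\<close> in the direction \<open>d1\<close> determines the second arc
  and thereby \<open>z\<close>, and the third arc has to match. An admissible triangle has a top
  arc, on which both passages are over, so requiring \<open>ov a = ov b\<close> loses nothing when
  all rotations are tried.\<close>

fun r3_head :: "bool \<Rightarrow> int list \<Rightarrow> int list list" where
  "r3_head d1 (a # b # Z) = (
     let x = (if d1 then b else a); y = (if d1 then a else b); d2 = (d1 = (0 < x)); d3 = (d1 = (y < 0));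
       z = (if d2 then next_letter (- x) Z else prev_letter (- x) Z) in
     if ov a = ov b \<and> ((d2 = (0 < z)) = d3) \<and> z \<noteq> 0 \<and> z \<noteq> y \<and> z \<noteq> - y \<and> (if d3 then adj (- z) (- y) Z else adj (- y) (- z) Z)
     then [map (\<lambda>v. if v = x then y else if v = y then x else if v = - x then z else if v = z then - x
        else if v = - y then - z else if v = - z then - y else v) (a # b # Z)] else [])"
| "r3_head d1 _ = []"

definition r3_moves :: "int list \<Rightarrow> int list list" where
  "r3_moves L = concat (map (\<lambda>L. r3_head True L @ r3_head False L) (rotations L))"

definition reducible :: "int list \<Rightarrow> bool" where
  "reducible L = lazy_ex r2_head (rotations L)"

text \<open>A word passes if it violates a necessary condition on diagrams, or if a bigon at the
  negative crossing appears after at most two moves of type three. The tests are ordered by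
  cost.\<close>

definition checked :: "int list \<Rightarrow> bool" where
  "checked L = (if even_loops L then if reducible L then True else if lazy_all index_head (rotations L) then
     if lazy_all cross_head (rotations L) then let M = r3_moves L in if lazy_ex reducible M then True else lazy_ex (\<lambda>L. lazy_ex reducible (r3_moves L)) M
     else True else True else True)"

text \<open>The letters \<open>- 2\<close>, \<open>3\<close>, \<open>2\<close>, \<open>- 3\<close>
  stand for \<open>i\<close>, \<open>j\<close>, \<open>bar i\<close>, \<open>bar j\<close>.\<close>

definition check_case :: "int list \<Rightarrow> int list \<Rightarrow> int list \<Rightarrow> int list \<Rightarrow> bool" where
  "check_case c1 c2 c3 cx = lazy_all (\<lambda>m1. lazy_all (\<lambda>m2. lazy_all (\<lambda>m3. lazy_all (\<lambda>x. checked (- 2 # m1 @ 3 # m2 @ 2 # m3 @ - 3 # x)) (perms cx)) (perms c3)) (perms c2)) (perms c1)"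


section \<open>Soundness of the evaluated tests\<close>

lemma lazy_ex_iff [simp]: "lazy_ex P xs \<longleftrightarrow> (\<exists>x\<in>set xs. P x)"
  by (induction xs) auto

lemma lazy_all_iff [simp]: "lazy_all P xs \<longleftrightarrow> (\<forall>x\<in>set xs. P x)"
  by (induction xs) auto

lemma set_inserts: "xs \<in> set (inserts x (A @ B)) \<or> xs \<noteq> A @ x # B"
proof -
  have "A @ x # B \<in> set (inserts x (A @ B))"
    by (induction A) (cases B; simp)+
  then show ?thesis by blast
qed

lemma mset_perms: "mset ys = mset xs \<Longrightarrow> ys \<in> set (perms xs)"
proof (induction xs arbitrary: ys)
  case (Cons x xs)
  have "x \<in> set ys" using arg_cong[OF Cons.prems, of set_mset] by auto
  then obtain A B where ys: "ys = A @ x # B" by (auto simp: in_set_conv_decomp)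
  have "A @ B \<in> set (perms xs)" using Cons ys by simp
  then show ?case using set_inserts[of ys x A B] ys by auto
qed simp

lemma upto_letter_Some: "upto_letter a S L = Some (S', R) \<Longrightarrow> \<exists>F. L = F @ a # R \<and> S' = rev F @ S"
proof (induction L arbitrary: S)
  case (Cons x L)
  show ?case
  proof (cases "x = a")
    case True
    then show ?thesis using Cons.prems by (intro exI[of _ "[]"]) simp
  next
    case False
    then obtain F where "L = F @ a # R" "S' = rev F @ x # S" using Cons by auto
    then show ?thesis by (intro exI[of _ "x # F"]) simp
  qed
qed simp

lemma adj_split: "adj a b L \<Longrightarrow> \<exists>A B. L = A @ [a, b] @ B"
proof (induction a b L rule: adj.induct)
  case (1 a b x y L)
  show ?case
  proof (cases "x = a")
    case True
    then show ?thesis using 1 by (intro exI[of _ "[]"] exI[of _ L]) simp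
  next
    case False
    then obtain A B where "y # L = A @ [a, b] @ B" using 1 by auto
    then show ?thesis by (intro exI[of _ "x # A"] exI[of _ B]) simp
  qed
qed simp_all

lemma next_letter_split: "next_letter a L \<noteq> 0 \<Longrightarrow> \<exists>A B. L = A @ [a, next_letter a L] @ B"
proof (induction a L rule: next_letter.induct)
  case (1 a x y L)
  show ?case
  proof (cases "x = a")
    case True
    then show ?thesis by (intro exI[of _ "[]"] exI[of _ L]) simp
  next
    case False
    then obtain A B where "y # L = A @ [a, next_letter a (y # L)] @ B" using 1 by auto
    then show ?thesis using False by (intro exI[of _ "x # A"] exI[of _ B]) simp
  qed
qed simp_all

lemma prev_letter_split: "prev_letter a L \<noteq> 0 \<Longrightarrow> \<exists>A B. L = A @ [prev_letter a L, a] @ B"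
proof (induction a L rule: prev_letter.induct)
  case (1 a x y L)
  show ?case
  proof (cases "y = a")
    case True
    then show ?thesis by (intro exI[of _ "[]"] exI[of _ L]) simp
  next
    case False
    then obtain A B where "y # L = A @ [prev_letter a (y # L), a] @ B" using 1 by auto
    then show ?thesis using False by (intro exI[of _ "x # A"] exI[of _ B]) simp
  qed
qed simp_all

lemma rotations_rotate: "L' \<in> set (rotations L) \<Longrightarrow> \<exists>n. L' = rotate n L"
proof -
  have "\<exists>k. L' = rotate k M" if "L' \<in> set (rots n M)" for n M
    using that
  proof (induction n M rule: rots.induct)
    case (2 n M)
    then consider "L' = M" | k where "L' = rotate k (rotate1 M)" by auto
    then show ?case
    proof cases
      case 1
      then show ?thesis by (intro exI[of _ 0]) simp
    next
      case 2
      then show ?thesis by (intro exI[of _ "Suc k"]) (simp add: rotate1_rotate_swap)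
    qed
  qed simp
  then show "L' \<in> set (rotations L) \<Longrightarrow> ?thesis" unfolding rotations_def .
qed

text \<open>What the tests assume about the integers that stand for the passages of an actual
  word.\<close>

definition coding :: "(int \<Rightarrow> passage) \<Rightarrow> int set \<Rightarrow> bool" where
  "coding d W \<longleftrightarrow> inj_on d W \<and> (\<forall>x\<in>W. - x \<in> W \<and> d (- x) = bar (d x) \<and> fr (d x) = (0 < x) \<and> positive (d x) = (\<not> neg x))"

context
  fixes d :: "int \<Rightarrow> passage" and W :: "int set"
  assumes d: "coding d W"
begin

lemma cd: "x \<in> W \<Longrightarrow> - x \<in> W" "x \<in> W \<Longrightarrow> d (- x) = bar (d x)" "x \<in> W \<Longrightarrow> fr (d x) = (0 < x)"
  "x \<in> W \<Longrightarrow> positive (d x) = (\<not> neg x)" "x \<in> W \<Longrightarrow> y \<in> W \<Longrightarrow> d x = d y \<longleftrightarrow> x = y"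
  using d by (auto simp: coding_def inj_on_def)

lemma over_code: "x \<in> W \<Longrightarrow> over (d x) = ov x"
proof -
  assume x: "x \<in> W"
  have "over (d x) = (fr (d x) = positive (d x))" by (auto simp: fr_def)
  moreover have "x \<noteq> 0"
  proof
    assume "x = 0"
    then show False using cd(2)[OF x] by simp
  qed
  ultimately show ?thesis unfolding cd(3)[OF x] cd(4)[OF x] ov_def neg_def by auto
qed

lemma lkz_code: "set U \<subseteq> W \<Longrightarrow> set V \<subseteq> W \<Longrightarrow> lkz U V = lk (map d U) (set (map d V))"
proof (induction U)
  case (Cons x U)
  have x: "x \<in> W" using Cons.prems by simp
  have "bar (d x) \<in> d ` set V \<longleftrightarrow> - x \<in> set V"
    using inj_on_image_mem_iff[of d W "- x" "set V"] d cd(1,2)[OF x] Cons.prems(2) by (simp add: coding_def)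
  then show ?case using Cons cd(3)[OF x] by (auto simp: lk_Cons eps_def)
qed simp

lemma even_loops_code: "knot_word (map d (A @ L)) \<Longrightarrow> set L \<subseteq> W \<Longrightarrow> even_loops L"
proof (induction L arbitrary: A)
  case (Cons x L)
  have IH: "even_loops L" using Cons.IH[of "A @ [x]"] Cons.prems by simp
  show ?case
  proof (cases "upto_letter (- x) [] L")
    case None
    then show ?thesis using IH by simp
  next
    case (Some p)
    obtain S R where p: "p = (S, R)" by (cases p)
    obtain F where F: "L = F @ - x # R" "S = rev F" using upto_letter_Some[of "- x" "[]" L S R] Some p by auto
    have "knot_word (d x # map d F @ bar (d x) # (map d R @ map d A))"
      using knot_word_append[of "map d A" "map d (x # L)"] Cons.prems cd(2)[of x] unfolding F by simp
    from loop_even[OF this] show ?thesis using Some p F IH by simp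
  qed
qed simp

lemma index_head_code: "knot_word (map d L) \<Longrightarrow> set L \<subseteq> W \<Longrightarrow> index_head L"
proof (cases L)
  case (Cons x L')
  assume w: "knot_word (map d L)" and W: "set L \<subseteq> W"
  show ?thesis
  proof (cases "upto_letter (- x) [] L'")
    case None
    then show ?thesis using Cons by simp
  next
    case (Some p)
    obtain S R where p: "p = (S, R)" by (cases p)
    obtain F where F: "L' = F @ - x # R" "S = rev F" using upto_letter_Some[of "- x" "[]" L' S R] Some p by auto
    have "knot_word (d x # map d F @ bar (d x) # map d R)" using w cd(2)[of x] W unfolding Cons F by simp
    from loop_index[OF this] show ?thesis using Some p F Cons W lkz_code[of R S] by simp
  qed
qed simp

lemma lk_rev: "lk (rev U) A = lk U A"
  by (induction U) (simp_all add: lk_Cons)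

lemma cross_heads_code:
  "knot_word (map d (v # rev P @ Q @ - v # R)) \<Longrightarrow> set (v # P @ Q @ - v # R) \<subseteq> W \<Longrightarrow> cross_heads v P Q R"
proof (induction Q arbitrary: P)
  case (Cons u Q)
  have IH: "cross_heads v (u # P) Q R" using Cons.IH[of "u # P"] Cons.prems by simp
  show ?case
  proof (cases "(0 < u) = (0 < v)")
    case True
    then show ?thesis using IH by simp
  next
    case fr: False
    show ?thesis
    proof (cases "upto_letter (- u) [] R")
      case None
      then show ?thesis using IH fr by simp
    next
      case (Some p)
      obtain R' T where p: "p = (R', T)" by (cases p)
      obtain F where F: "R = F @ - u # T" "R' = rev F" using upto_letter_Some[of "- u" "[]" R R' T] Some p by auto
      have uv: "u \<in> W" "v \<in> W" using Cons.prems by auto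
      have "knot_word (d v # map d (rev P) @ d u # map d Q @ bar (d v) # map d F @ bar (d u) # map d T)"
        using Cons.prems(1) cd(2)[OF uv(1)] cd(2)[OF uv(2)] unfolding F by simp
      moreover have "fr (d u) \<noteq> fr (d v)" using fr cd(3) uv by simp
      ultimately have l: "lk (map d Q @ map d F) (set (map d (rev P) @ map d Q)) = 0" by (rule crossed_loops_index)
      have sub: "set Q \<subseteq> W" "set P \<subseteq> W" "set R' \<subseteq> W" using Cons.prems(2) F by auto
      have dis: "set (map d P) \<inter> set (map d Q) = {}" using knot_wordD(3)[OF Cons.prems(1)] by auto
      have "lkz Q P + lkz Q Q + lkz R' P + lkz R' Q =
          lk (map d Q) (set (map d P) \<union> set (map d Q)) + lk (map d R') (set (map d P) \<union> set (map d Q))"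
        unfolding lk_union[OF dis] lkz_code[OF sub(1,2)] lkz_code[OF sub(1,1)] lkz_code[OF sub(3,2)] lkz_code[OF sub(3,1)] by simp
      also have "\<dots> = 0" using l lk_rev[of "map d F"] unfolding F by (simp add: rev_map)
      finally have "lkz Q P + lkz Q Q + lkz R' P + lkz R' Q = 0" .
      then show ?thesis using IH fr Some p by simp
    qed
  qed
qed simp

lemma cross_head_code: "knot_word (map d L) \<Longrightarrow> set L \<subseteq> W \<Longrightarrow> cross_head L"
proof (cases L)
  case (Cons v L')
  assume w: "knot_word (map d L)" and W: "set L \<subseteq> W"
  show ?thesis
  proof (cases "upto_letter (- v) [] L'")
    case None
    then show ?thesis using Cons by simp
  next
    case (Some p)
    obtain S R where p: "p = (S, R)" by (cases p)
    obtain F where F: "L' = F @ - v # R" "S = rev F" using upto_letter_Some[of "- v" "[]" L' S R] Some p by auto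
    have "cross_heads v [] F R" by (rule cross_heads_code) (use w W Cons F in auto)
    then show ?thesis using Some p F Cons by simp
  qed
qed simp

lemma r2_head_code: "critical (map d L) \<Longrightarrow> set L \<subseteq> W \<Longrightarrow> \<not> r2_head L"
proof
  assume w: "critical (map d L)" and W: "set L \<subseteq> W" and r: "r2_head L"
  obtain p q Z where L: "L = p # q # Z" using r by (cases L rule: r2_head.cases) auto
  have pq: "p \<in> W" "q \<in> W" using W L by auto
  have o: "over (d p) = over (d q)" "positive (d p) \<noteq> positive (d q)" "adj (- p) (- q) Z \<or> adj (- q) (- p) Z"
    using r unfolding L over_code[OF pq(1)] over_code[OF pq(2)] cd(4)[OF pq(1)] cd(4)[OF pq(2)] by (auto split: if_splits)
  obtain A B p' q' where Z: "Z = A @ [p', q'] @ B" "p' = - p \<and> q' = - q \<or> p' = - q \<and> q' = - p"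
    using o(3) adj_split[of "- p" "- q" Z] adj_split[of "- q" "- p" Z] by blast
  have "critical ([d p, d q] @ map d A @ [d p'] @ [] @ [d q'] @ map d B)" using w unfolding L Z by simp
  moreover have "d p' = bar (d p) \<and> d q' = bar (d q) \<or> d p' = bar (d q) \<and> d q' = bar (d p)"
    using Z(2) cd(2)[OF pq(1)] cd(2)[OF pq(2)] by auto
  ultimately show False using critical_no_bead[of "[]" "d p" "d q" "d p'" "d q'"] o by auto
qed

lemma rotations_code:
  assumes "critical (map d L)" "L' \<in> set (rotations L)"
  shows "critical (map d L')" "set L' = set L"
proof -
  obtain n where n: "L' = rotate n L" using rotations_rotate[OF assms(2)] by blast
  then have "L' = drop (n mod length L) L @ take (n mod length L) L" by (simp add: rotate_drop_take)
  then show "critical (map d L')"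
    using critical_append[of "map d (take (n mod length L) L)" "map d (drop (n mod length L) L)"] assms(1)
    by (metis append_take_drop_id map_append)
  show "set L' = set L" using n by simp
qed

lemma reducible_code: "critical (map d L) \<Longrightarrow> set L \<subseteq> W \<Longrightarrow> \<not> reducible L"
  unfolding reducible_def using r2_head_code rotations_code by auto

end

text \<open>The second and the third arc of a triangle are found separately; this puts them into one
  decomposition of the word.\<close>

lemma two_adjacent:
  assumes Z: "distinct Z" "Z = P @ [a, b] @ Q" "Z = P' @ [a', b'] @ Q'" and ne: "{a, b} \<inter> {a', b'} = {}"
  shows "(\<exists>A B C. Z = A @ [a, b] @ B @ [a', b'] @ C) \<or> (\<exists>A B C. Z = A @ [a', b'] @ B @ [a, b] @ C)"
proof -
  have d: "a' \<notin> set P'" "a' \<notin> set (b' # Q')" using Z(1) unfolding Z(3) by auto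
  have ne': "a' \<noteq> a" "a' \<noteq> b" "b' \<noteq> a" using ne by auto
  have "a' \<in> set (P @ [a, b] @ Q)" unfolding Z(2)[symmetric] Z(3) by simp
  then consider "a' \<in> set P" | "a' \<in> set Q" using ne' by auto
  then show ?thesis
  proof cases
    case 1
    then obtain P1 P2 where P: "P = P1 @ a' # P2" by (auto simp: in_set_conv_decomp)
    have "P' @ a' # (b' # Q') = P1 @ a' # (P2 @ [a, b] @ Q)" using Z(2,3) unfolding P by simp
    from iffD1[OF append_Cons_eq_iff[OF d] this] have e: "b' # Q' = P2 @ [a, b] @ Q" ..
    obtain P3 where "P2 = b' # P3" using e ne'(3) by (cases P2) simp_all
    then have "Z = P1 @ [a', b'] @ P3 @ [a, b] @ Q" using Z(2) P by simp
    then show ?thesis by blast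
  next
    case 2
    then obtain Q1 Q2 where Q: "Q = Q1 @ a' # Q2" by (auto simp: in_set_conv_decomp)
    have "P' @ a' # (b' # Q') = (P @ [a, b] @ Q1) @ a' # Q2" using Z(2,3) unfolding Q by simp
    from iffD1[OF append_Cons_eq_iff[OF d] this] have "Q2 = b' # Q'" by simp
    then have "Z = P @ [a, b] @ Q1 @ [a', b'] @ Q'" using Z(2) Q by simp
    then show ?thesis by blast
  qed
qed

lemma critical_R3:
  assumes w: "critical ([u1, v1] @ P @ [u2, v2] @ Q @ [u3, v3] @ R)"
    and t: "tri (u1, v1) (u2, v2) (u3, v3) \<or> tri (u1, v1) (u3, v3) (u2, v2)" and o: "over u1 = over v1"
  shows "critical ([v1, u1] @ P @ [v2, u2] @ Q @ [v3, u3] @ R)"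
proof -
  have "same_knot ([u1, v1] @ P @ [u2, v2] @ Q @ [u3, v3] @ R) ([v1, u1] @ P @ [v2, u2] @ Q @ [v3, u3] @ R)"
    by (rule same_knot_R3[OF critical_knot_word[OF w] t]) (use o in simp)
  from critical_step[OF w this] show ?thesis using negatives_mono by (auto simp: negatives_def)
qed

context
  fixes d :: "int \<Rightarrow> passage" and W :: "int set"
  assumes d: "coding d W"
begin

lemma r3_head_code:
  assumes w: "critical (map d L)" "set L \<subseteq> W" and L': "L' \<in> set (r3_head d1 L)"
  shows "critical (map d L')" "set L' \<subseteq> W"
proof -
  note cd = cd[OF d]
  obtain a b Z where L: "L = a # b # Z" using L' by (cases "(d1, L)" rule: r3_head.cases) auto
  define x where "x = (if d1 then b else a)"
  define y where "y = (if d1 then a else b)"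
  define d2 where "d2 = (d1 = (0 < x))"
  define d3 where "d3 = (d1 = (y < 0))"
  define z where "z = (if d2 then next_letter (- x) Z else prev_letter (- x) Z)"
  \<comment> \<open>Exchanges the two letters on each of the three arcs and fixes all others, so
    mapping it over the word is the push of the triangle.\<close>
  define \<sigma> where "\<sigma> = (\<lambda>v. if v = x then y else if v = y then x else if v = - x then z else if v = z then - x
          else if v = - y then - z else if v = - z then - y else v)"
  have "r3_head d1 L = (if ov a = ov b \<and> ((d2 = (0 < z)) = d3) \<and> z \<noteq> 0 \<and> z \<noteq> y \<and> z \<noteq> - y \<and>
      (if d3 then adj (- z) (- y) Z else adj (- y) (- z) Z) then [map \<sigma> L] else [])" (is "_ = (if ?c then _ else _)")
    unfolding L r3_head.simps Let_def x_def[symmetric] y_def[symmetric] d2_def[symmetric] d3_def[symmetric] z_def[symmetric]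
      \<sigma>_def[symmetric] ..
  then have "?c \<and> L' = map \<sigma> L" using L' by (cases ?c) simp_all
  then have c: "ov a = ov b" "(d2 = (0 < z)) = d3" "z \<noteq> 0" "z \<noteq> y" "z \<noteq> - y"
    "if d3 then adj (- z) (- y) Z else adj (- y) (- z) Z" and L'': "L' = map \<sigma> L"
    by blast+
  define B where "B = (if d2 then (- x, z) else (z, - x))"
  define C where "C = (if d3 then (- z, - y) else (- y, - z))"
  have dL: "distinct L" using knot_wordD(3)[OF critical_knot_word[OF w(1)]] by (simp add: distinct_map)
  have dZ: "distinct Z" and ab: "a \<noteq> b" "a \<notin> set Z" "b \<notin> set Z" using dL unfolding L by auto
  have "\<exists>P Q. Z = P @ [fst B, snd B] @ Q"
    using c(3) next_letter_split[of "- x" Z] prev_letter_split[of "- x" Z] unfolding B_def z_def by (auto split: if_splits)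
  then obtain P Q where Z1: "Z = P @ [fst B, snd B] @ Q" by blast
  have "\<exists>P Q. Z = P @ [fst C, snd C] @ Q"
    using c(6) adj_split[of "- z" "- y" Z] adj_split[of "- y" "- z" Z] unfolding C_def by (auto split: if_splits)
  then obtain P' Q' where Z2: "Z = P' @ [fst C, snd C] @ Q'" by blast
  have zZ: "z \<in> set Z" "- x \<in> set Z" using Z1 unfolding B_def by (auto split: if_splits)
  have zZ': "- z \<in> set Z" "- y \<in> set Z" using Z2 unfolding C_def by (auto split: if_splits)
  have xy: "x \<in> set [a, b]" "y \<in> set [a, b]" "x \<noteq> y" using ab unfolding x_def y_def by auto
  have xW: "x \<in> W" "y \<in> W" "z \<in> W" using w(2) xy zZ unfolding L by auto
  have ne: "x \<noteq> - y" "x \<noteq> - x" "y \<noteq> - y" "z \<noteq> x" "z \<noteq> - x" "z \<noteq> - z"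
  proof -
    show "x \<noteq> - y" "x \<noteq> - x" "y \<noteq> - y" "z \<noteq> x" using xy zZ zZ' ab by auto
    show "z \<noteq> - x" using dZ unfolding Z1 B_def by (auto split: if_splits)
    show "z \<noteq> - z" using c(3) by simp
  qed
  have z0: "x \<noteq> 0" "y \<noteq> 0" using ne by auto
  have nBC: "{fst B, snd B} \<inter> {fst C, snd C} = {}" using ne xy(3) c(4,5) unfolding B_def C_def by auto
  have cr: "crossing (d u) \<noteq> crossing (d v)" if "u \<in> W" "v \<in> W" "u \<in> set L" "v \<in> set L" "u \<noteq> v" "u \<noteq> - v" for u v
  proof
    assume "crossing (d u) = crossing (d v)"
    then have "d u = d v \<or> d u = bar (d v)"
      using gauss_word_same_crossing[OF knot_wordD(1)[OF critical_knot_word[OF w(1)]], of "d u" "d v"] that(3,4) by simp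
    then show False using cd(5)[OF that(1,2)] cd(2)[OF that(2)] cd(5)[OF that(1) cd(1)[OF that(2)]] that(5,6) by auto
  qed
  have tri: "tri (d a, d b) (d (fst B), d (snd B)) (d (fst C), d (snd C))"
    unfolding tri_def
  proof (rule exI[of _ d1], rule exI[of _ d2], rule exI[of _ d3], rule exI[of _ "d x"], rule exI[of _ "d y"],
      rule exI[of _ "d z"], intro conjI)
    show "crossing (d x) \<noteq> crossing (d y)" "crossing (d y) \<noteq> crossing (d z)" "crossing (d x) \<noteq> crossing (d z)"
      using cr[of x y] cr[of y z] cr[of x z] xW xy zZ ne c(4,5) unfolding L by auto
    show "(d1 = fr (d x)) = d2" using cd(3)[OF xW(1)] by (simp add: d2_def)
    show "(d2 = fr (d z)) = d3" using cd(3)[OF xW(3)] c(2) by simp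
    show "(d3 = fr (bar (d y))) = d1" using cd(3)[OF xW(2)] z0(2) by (auto simp: d3_def)
  qed (use cd(2)[OF xW(1)] cd(2)[OF xW(2)] cd(2)[OF xW(3)] in \<open>auto simp: x_def y_def B_def C_def\<close>)
  have o: "over (d a) = over (d b)"
    using over_code[OF d, of a] over_code[OF d, of b] w(2) c(1) unfolding L by simp
  have sw: "\<sigma> a = b" "\<sigma> b = a" "\<sigma> (fst B) = snd B" "\<sigma> (snd B) = fst B" "\<sigma> (fst C) = snd C" "\<sigma> (snd C) = fst C"
  proof -
    have "\<sigma> x = y" unfolding \<sigma>_def by simp
    moreover have "\<sigma> y = x" unfolding \<sigma>_def by simp
    moreover have "\<sigma> (- x) = z" using ne unfolding \<sigma>_def by simp
    moreover have "\<sigma> z = - x" using ne c(3,4,5) unfolding \<sigma>_def by presburger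
    moreover have "\<sigma> (- y) = - z" using ne c(3,4,5) xy(3) unfolding \<sigma>_def by presburger
    moreover have "\<sigma> (- z) = - y" using ne c(3,4,5) xy(3) unfolding \<sigma>_def by presburger
    ultimately show "\<sigma> a = b" "\<sigma> b = a" "\<sigma> (fst B) = snd B" "\<sigma> (snd B) = fst B" "\<sigma> (fst C) = snd C" "\<sigma> (snd C) = fst C"
      unfolding x_def y_def B_def C_def by (cases d1; cases d2; cases d3; simp)+
  qed
  have sid: "map \<sigma> V = V" if "set V \<inter> {a, b, fst B, snd B, fst C, snd C} = {}" for V
  proof -
    have "{a, b, fst B, snd B, fst C, snd C} = {x, y, - x, z, - y, - z}"
      unfolding x_def y_def B_def C_def by (cases d1; cases d2; cases d3; simp add: insert_commute)
    then have V: "set V \<inter> {x, y, - x, z, - y, - z} = {}" using that by simp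
    have "\<sigma> v = v" if "v \<in> set V" for v
    proof -
      have "v \<notin> {x, y, - x, z, - y, - z}" using V that by blast
      then show ?thesis unfolding \<sigma>_def by simp
    qed
    then show ?thesis by (simp add: map_idI)
  qed
  have main: "critical (map d L') \<and> set L' \<subseteq> set L"
    if Z: "Z = A1 @ [p1, p2] @ A2 @ [q1, q2] @ A3"
      and pq: "(p1, p2) = B \<and> (q1, q2) = C \<or> (p1, p2) = C \<and> (q1, q2) = B" for A1 p1 p2 A2 q1 q2 A3
  proof -
    have s: "{a, b, fst B, snd B, fst C, snd C} = set [a, b, p1, p2, q1, q2]"
      using pq by (elim disjE conjE) (auto simp: prod_eq_iff)
    have dd: "distinct (a # b # A1 @ [p1, p2] @ A2 @ [q1, q2] @ A3)" using dL unfolding L Z .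
    have "map \<sigma> A1 = A1" "map \<sigma> A2 = A2" "map \<sigma> A3 = A3" using dd by (intro sid; unfold s; auto)+
    moreover have "\<sigma> p1 = p2" "\<sigma> p2 = p1" "\<sigma> q1 = q2" "\<sigma> q2 = q1" using pq sw by (metis fst_conv snd_conv)+
    ultimately have e: "L' = [b, a] @ A1 @ [p2, p1] @ A2 @ [q2, q1] @ A3" unfolding L'' L Z using sw(1,2) by simp
    have t': "tri (d a, d b) (d p1, d p2) (d q1, d q2) \<or> tri (d a, d b) (d q1, d q2) (d p1, d p2)"
      using tri pq by (metis fst_conv snd_conv)
    have cr0: "critical ([d a, d b] @ map d A1 @ [d p1, d p2] @ map d A2 @ [d q1, d q2] @ map d A3)"
      using w(1) unfolding L Z by simp
    have cr': "critical ([d b, d a] @ map d A1 @ [d p2, d p1] @ map d A2 @ [d q2, d q1] @ map d A3)"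
      by (rule critical_R3[OF cr0 t' o])
    have "set L' \<subseteq> set L" unfolding e L Z set_append list.set by blast
    with cr' show ?thesis unfolding e by simp
  qed
  have "critical (map d L') \<and> set L' \<subseteq> set L"
    using two_adjacent[OF dZ Z1 Z2 nBC]
  proof (elim disjE exE)
    fix A1 A2 A3 assume "Z = A1 @ [fst B, snd B] @ A2 @ [fst C, snd C] @ A3"
    then show ?thesis by (rule main) simp
  next
    fix A1 A2 A3 assume "Z = A1 @ [fst C, snd C] @ A2 @ [fst B, snd B] @ A3"
    then show ?thesis by (rule main) simp
  qed
  then show "critical (map d L')" "set L' \<subseteq> W" using w(2) by auto
qed

lemma r3_moves_code:
  assumes "critical (map d L)" "set L \<subseteq> W" "L' \<in> set (r3_moves L)"
  shows "critical (map d L')" "set L' \<subseteq> W"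
proof -
  obtain M d1 where M: "M \<in> set (rotations L)" "L' \<in> set (r3_head d1 M)"
    using assms(3) unfolding r3_moves_def by auto
  note r = rotations_code[OF d assms(1) M(1)]
  show "critical (map d L')" "set L' \<subseteq> W" using r3_head_code[OF r(1) _ M(2)] r(2) assms(2) by auto
qed

text \<open>A critical word satisfies all necessary conditions and has no bigon at the negative
  crossing, and it stays critical under moves of type three, so every branch in which a word passes
  is closed.\<close>

lemma checked_code:
  assumes w: "critical (map d L)" "set L \<subseteq> W"
  shows "\<not> checked L"
proof
  assume c: "checked L"
  note k = critical_knot_word
  have 1: "even_loops L" using even_loops_code[OF d, of "[]" L] k[OF w(1)] w(2) by simp
  have 2: "reducible L = False" using reducible_code[OF d w] by simp
  have r: "knot_word (map d M)" "set M \<subseteq> W" if "M \<in> set (rotations L)" for M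
    using rotations_code[OF d w(1) that] k w(2) by auto
  have 3: "\<forall>M\<in>set (rotations L). index_head M" "\<forall>M\<in>set (rotations L). cross_head M"
    using index_head_code[OF d r(1) r(2)] cross_head_code[OF d r(1) r(2)] by blast+
  have "checked L = (if \<exists>M\<in>set (r3_moves L). reducible M then True else
      \<exists>M\<in>set (r3_moves L). \<exists>N\<in>set (r3_moves M). reducible N)"
    unfolding checked_def Let_def lazy_all_iff lazy_ex_iff eqTrueI[OF 1] 2 eqTrueI[OF 3(1)] eqTrueI[OF 3(2)] if_True if_False ..
  then obtain M where M: "M \<in> set (r3_moves L)" "reducible M \<or> (\<exists>N\<in>set (r3_moves M). reducible N)"
    using c by (auto split: if_splits)
  note m = r3_moves_code[OF w M(1)]
  from M(2) show False
  proof
    assume "reducible M"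
    with reducible_code[OF d m] show False ..
  next
    assume "\<exists>N\<in>set (r3_moves M). reducible N"
    then obtain N where N: "N \<in> set (r3_moves M)" "reducible N" ..
    from reducible_code[OF d r3_moves_code[OF m N(1)]] N(2) show False ..
  qed
qed

end

section \<open>Numbers of crossings between the blocks\<close>

lemma lk_mset:
  assumes "mset U = mset V"
  shows "lk U A = lk V A"
  unfolding lk_def sum_mset_sum_list[symmetric] mset_map assms ..

definition codes :: "nat \<Rightarrow> nat \<Rightarrow> int list" where
  "codes n m = map int [n..<n + m]"

text \<open>\<open>k\<close> is the block that contains the under passage of the negative crossing,
  \<open>\<alpha>\<close> the number of crossings of \<open>M1\<close> over \<open>M2\<close>, which
  equals that of \<open>M3\<close> over \<open>M2\<close>, and \<open>x1\<close>, \<open>x2\<close>,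
  \<open>x3\<close> count the positive crossings of \<open>X\<close> over the three blocks. Codes
  below 4 are taken by \<open>c\<close>, \<open>i\<close> and \<open>j\<close>.\<close>

definition check_arc :: "nat \<Rightarrow> nat \<Rightarrow> nat \<Rightarrow> nat \<Rightarrow> nat \<Rightarrow> bool" where
  "check_arc k \<alpha> x1 x2 x3 = (let A = codes 4 \<alpha>; B = codes (4 + \<alpha>) \<alpha>; P = codes (4 + 2 * \<alpha>) x1;
     Y = codes (4 + 2 * \<alpha> + x1) x2; Q = codes (4 + 2 * \<alpha> + x1 + x2) x3; m = map uminus in
     check_case (A @ m P @ (if k = 1 then [1] else [])) (m A @ m B @ m Y @ (if k = 2 then [1] else []))
       (B @ m Q @ (if k = 3 then [1] else [])) (P @ Y @ Q @ [- 1]))"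

lemma ex_map_mset:
  assumes "mset M = mset (map d cs)"
  shows "\<exists>m. mset m = mset cs \<and> map d m = M"
  using assms
proof (induction M arbitrary: cs)
  case (Cons v M)
  have "v \<in> set (map d cs)" using arg_cong[OF Cons.prems, of set_mset] by auto
  then obtain x where x: "x \<in> set cs" "v = d x" by auto
  then obtain C1 C2 where C: "cs = C1 @ x # C2" by (auto simp: in_set_conv_decomp)
  have "mset M = mset (map d (C1 @ C2))" using Cons.prems x(2) unfolding C by simp
  from Cons.IH[OF this] obtain m where m: "mset m = mset (C1 @ C2)" "map d m = M" by blast
  show ?case by (rule exI[of _ "x # m"]) (use m x(2) C in simp)
qed simp

context core_arc
begin

text \<open>\<open>AA\<close> and \<open>BB\<close> represent the crossings of \<open>M1\<close> and
  \<open>M3\<close> over \<open>M2\<close>; \<open>PP\<close>, \<open>YY\<close>, \<open>QQ\<close>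
  those of \<open>X\<close> over \<open>M1\<close>, \<open>M2\<close>, \<open>M3\<close>, except for
  \<open>c\<close>. Each is listed by its over passage, and with \<open>c\<close>, \<open>i\<close>
  and \<open>j\<close> these are all crossings.\<close>

definition "AA = filter over M1"
definition "BB = filter over M3"
definition "PP = filter (\<lambda>x. bar x \<in> set M1 \<and> x \<noteq> c) X"
definition "YY = filter (\<lambda>x. bar x \<in> set M2 \<and> x \<noteq> c) X"
definition "QQ = filter (\<lambda>x. bar x \<in> set M3 \<and> x \<noteq> c) X"
definition "cl M = (if bar c \<in> set M then [bar c] else [])"

lemma dis: "distinct M1" "distinct M2" "distinct M3" "distinct X" "set M1 \<inter> set M2 = {}" "set M1 \<inter> set M3 = {}"
  "set M1 \<inter> set X = {}" "set M2 \<inter> set M3 = {}" "set M2 \<inter> set X = {}" "set M3 \<inter> set X = {}"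
  using gauss(2) by auto

lemma c_in: "bar c \<in> set M1 \<or> bar c \<in> set M2 \<or> bar c \<in> set M3"
  using X_bar[OF c(1)] .

lemma mset_M1: "mset M1 = mset (AA @ map bar PP @ cl M1)"
proof -
  have "distinct (AA @ map bar PP @ cl M1)"
    using dis X X[OF c(1)] by (auto simp: AA_def PP_def cl_def distinct_map inj_on_def)
  moreover have "set M1 = set (AA @ map bar PP @ cl M1)"
  proof
    show "set M1 \<subseteq> set (AA @ map bar PP @ cl M1)"
    proof
      fix y assume y: "y \<in> set M1"
      show "y \<in> set (AA @ map bar PP @ cl M1)"
      proof (cases "over y")
        case True
        then show ?thesis using y by (simp add: AA_def)
      next
        case False
        have "bar y \<in> set X" using M1_under[OF y False] .
        then have "bar y \<in> set PP \<or> bar y = c" using y by (auto simp: PP_def)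
        then show ?thesis
        proof
          assume "bar y \<in> set PP"
          then have "bar (bar y) \<in> bar ` set PP" by (rule imageI)
          then show ?thesis by simp
        next
          assume "bar y = c"
          then have "y = bar c" by auto
          then show ?thesis using y by (simp add: cl_def)
        qed
      qed
    qed
    show "set (AA @ map bar PP @ cl M1) \<subseteq> set M1" by (auto simp: AA_def PP_def cl_def)
  qed
  ultimately show ?thesis using set_eq_iff_mset_eq_distinct[OF dis(1)] by blast
qed

lemma mset_M3: "mset M3 = mset (BB @ map bar QQ @ cl M3)"
proof -
  have "distinct (BB @ map bar QQ @ cl M3)"
    using dis X X[OF c(1)] by (auto simp: BB_def QQ_def cl_def distinct_map inj_on_def)
  moreover have "set M3 = set (BB @ map bar QQ @ cl M3)"
  proof
    show "set M3 \<subseteq> set (BB @ map bar QQ @ cl M3)"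
    proof
      fix y assume y: "y \<in> set M3"
      show "y \<in> set (BB @ map bar QQ @ cl M3)"
      proof (cases "over y")
        case True
        then show ?thesis using y by (simp add: BB_def)
      next
        case False
        have "bar y \<in> set X" using M3_under[OF y False] .
        then have "bar y \<in> set QQ \<or> bar y = c" using y by (auto simp: QQ_def)
        then show ?thesis
        proof
          assume "bar y \<in> set QQ"
          then have "bar (bar y) \<in> bar ` set QQ" by (rule imageI)
          then show ?thesis by simp
        next
          assume "bar y = c"
          then have "y = bar c" by auto
          then show ?thesis using y by (simp add: cl_def)
        qed
      qed
    qed
    show "set (BB @ map bar QQ @ cl M3) \<subseteq> set M3" by (auto simp: BB_def QQ_def cl_def)
  qed
  ultimately show ?thesis using set_eq_iff_mset_eq_distinct[OF dis(3)] by blast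
qed

lemma mset_M2: "mset M2 = mset (map bar AA @ map bar BB @ map bar YY @ cl M2)"
proof -
  have "distinct (map bar AA @ map bar BB @ map bar YY @ cl M2)"
    using dis X c by (auto simp: AA_def BB_def YY_def cl_def distinct_map inj_on_def)
  moreover have "set M2 = set (map bar AA @ map bar BB @ map bar YY @ cl M2)"
  proof
    show "set M2 \<subseteq> set (map bar AA @ map bar BB @ map bar YY @ cl M2)"
    proof
      fix y assume y: "y \<in> set M2"
      have "\<not> over y" using M2_under[OF y] .
      then have "bar y \<in> set AA \<or> bar y \<in> set BB \<or> bar y \<in> set YY \<or> bar y = c"
        using M2_bar[OF y] y by (auto simp: AA_def BB_def YY_def)
      then have "bar y \<in> set (AA @ BB @ YY) \<or> y = bar c" by auto
      then show "y \<in> set (map bar AA @ map bar BB @ map bar YY @ cl M2)"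
      proof
        assume "bar y \<in> set (AA @ BB @ YY)"
        then have "bar (bar y) \<in> bar ` set (AA @ BB @ YY)" by (rule imageI)
        then show ?thesis by auto
      next
        assume "y = bar c"
        then show ?thesis using y by (simp add: cl_def)
      qed
    qed
    show "set (map bar AA @ map bar BB @ map bar YY @ cl M2) \<subseteq> set M2"
      using M1_over M3_over by (auto simp: AA_def BB_def YY_def cl_def)
  qed
  ultimately show ?thesis using set_eq_iff_mset_eq_distinct[OF dis(2)] by blast
qed

lemma mset_X: "mset X = mset (PP @ YY @ QQ @ [c])"
proof -
  have "distinct (PP @ YY @ QQ @ [c])"
    using dis by (auto simp: PP_def YY_def QQ_def)
  moreover have "set X = set (PP @ YY @ QQ @ [c])"
    using X_bar c(1) by (auto simp: PP_def YY_def QQ_def)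
  ultimately show ?thesis using set_eq_iff_mset_eq_distinct[OF dis(4)] by blast
qed

lemma eps_X: "x \<in> set X \<Longrightarrow> x \<noteq> c \<Longrightarrow> eps x = 1"
  using positive[of x] X[of x] X[of "bar c"] X[OF c(1)] by (auto simp: eps_def fr_def)

lemma eps_c: "eps c = - 1"
  using X[OF c(1)] c(2) by (simp add: eps_def fr_def)

lemma eps_core: "eps i = - 1" "eps j = 1"
proof -
  have "i \<noteq> bar c" "j \<noteq> bar c" using gauss(2) c(1) by auto
  then show "eps i = - 1" "eps j = 1" using eps_T[of i] eps_T[of j] ij by simp_all
qed

lemma eps_AB: "a \<in> set AA \<Longrightarrow> eps a = 1" "a \<in> set BB \<Longrightarrow> eps a = 1"
proof -
  have "over a \<Longrightarrow> a \<noteq> bar c" using X[OF c(1)] by auto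
  then show "a \<in> set AA \<Longrightarrow> eps a = 1" "a \<in> set BB \<Longrightarrow> eps a = 1"
    using eps_T[of a] by (auto simp: AA_def BB_def)
qed

lemma in_M: "a \<in> set AA \<Longrightarrow> a \<in> set M1" "a \<in> set AA \<Longrightarrow> bar a \<in> set M2"
  "a \<in> set BB \<Longrightarrow> a \<in> set M3" "a \<in> set BB \<Longrightarrow> bar a \<in> set M2"
  "x \<in> set PP \<Longrightarrow> x \<in> set X" "x \<in> set PP \<Longrightarrow> bar x \<in> set M1" "x \<in> set YY \<Longrightarrow> x \<in> set X" "x \<in> set YY \<Longrightarrow> bar x \<in> set M2"
  "x \<in> set QQ \<Longrightarrow> x \<in> set X" "x \<in> set QQ \<Longrightarrow> bar x \<in> set M3"
  "x \<in> set PP \<Longrightarrow> eps x = 1" "x \<in> set YY \<Longrightarrow> eps x = 1" "x \<in> set QQ \<Longrightarrow> eps x = 1"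
  using M1_over M3_over eps_X by (auto simp: AA_def BB_def PP_def YY_def QQ_def)

lemma notin_M: "y \<in> set M1 \<Longrightarrow> y \<notin> set M2 \<and> y \<notin> set M3 \<and> y \<notin> set X \<and> y \<noteq> i \<and> y \<noteq> j \<and> y \<noteq> bar i \<and> y \<noteq> bar j"
  "y \<in> set M2 \<Longrightarrow> y \<notin> set M1 \<and> y \<notin> set M3 \<and> y \<notin> set X \<and> y \<noteq> i \<and> y \<noteq> j \<and> y \<noteq> bar i \<and> y \<noteq> bar j"
  "y \<in> set M3 \<Longrightarrow> y \<notin> set M1 \<and> y \<notin> set M2 \<and> y \<notin> set X \<and> y \<noteq> i \<and> y \<noteq> j \<and> y \<noteq> bar i \<and> y \<noteq> bar j"
  "y \<in> set X \<Longrightarrow> y \<notin> set M1 \<and> y \<notin> set M2 \<and> y \<notin> set M3 \<and> y \<noteq> i \<and> y \<noteq> j \<and> y \<noteq> bar i \<and> y \<noteq> bar j"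
proof -
  have g: "i \<notin> set (M1 @ M2 @ M3 @ X)" "j \<notin> set (M1 @ M2 @ M3 @ X)" "bar i \<notin> set (M1 @ M2 @ M3 @ X)"
    "bar j \<notin> set (M1 @ M2 @ M3 @ X)" using gauss(2) by auto
  show "y \<in> set M1 \<Longrightarrow> y \<notin> set M2 \<and> y \<notin> set M3 \<and> y \<notin> set X \<and> y \<noteq> i \<and> y \<noteq> j \<and> y \<noteq> bar i \<and> y \<noteq> bar j"
    using g dis(5,6,7) by auto
  show "y \<in> set M2 \<Longrightarrow> y \<notin> set M1 \<and> y \<notin> set M3 \<and> y \<notin> set X \<and> y \<noteq> i \<and> y \<noteq> j \<and> y \<noteq> bar i \<and> y \<noteq> bar j"
    using g dis(5,8,9) by auto
  show "y \<in> set M3 \<Longrightarrow> y \<notin> set M1 \<and> y \<notin> set M2 \<and> y \<notin> set X \<and> y \<noteq> i \<and> y \<noteq> j \<and> y \<noteq> bar i \<and> y \<noteq> bar j"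
    using g dis(6,8,10) by auto
  show "y \<in> set X \<Longrightarrow> y \<notin> set M1 \<and> y \<notin> set M2 \<and> y \<notin> set M3 \<and> y \<noteq> i \<and> y \<noteq> j \<and> y \<noteq> bar i \<and> y \<noteq> bar j"
    using g dis(7,9,10) by auto
qed

text \<open>The crossed loops of \<open>i\<close> and \<open>j\<close> share \<open>M2\<close>. Of
  all crossings in their identity only those between \<open>M2\<close> and the other two blocks
  survive, with opposite signs for \<open>M1\<close> and \<open>M3\<close>.\<close>

lemma count_AA_BB: "length AA = length BB"
proof -
  have fr: "fr j \<noteq> fr i" using eps_core by (auto simp: eps_def split: if_splits)
  have "lk (M2 @ M3) (set (M1 @ M2)) = 0" by (rule crossed_loops_index[OF knot fr])
  moreover have "lk M2 (set (M1 @ M2)) = lk (map bar AA) (set (M1 @ M2)) + lk (map bar BB) (set (M1 @ M2)) +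
      lk (map bar YY) (set (M1 @ M2)) + lk (cl M2) (set (M1 @ M2))" using lk_mset[OF mset_M2] by simp
  moreover have "lk M3 (set (M1 @ M2)) = lk BB (set (M1 @ M2)) + lk (map bar QQ) (set (M1 @ M2)) + lk (cl M3) (set (M1 @ M2))"
    using lk_mset[OF mset_M3] by simp
  moreover have "lk (map bar AA) (set (M1 @ M2)) = - 1 * int (length (map bar AA))"
    by (rule lk_const) (auto simp: in_M eps_AB)
  moreover have "lk (map bar BB) (set (M1 @ M2)) = 0" by (rule lk_zero) (auto dest!: in_M(3) notin_M(3))
  moreover have "lk (map bar YY) (set (M1 @ M2)) = 0" by (rule lk_zero) (auto dest!: in_M(7) notin_M(4))
  moreover have "lk (cl M2) (set (M1 @ M2)) = 0" "lk (cl M3) (set (M1 @ M2)) = 0"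
    using notin_M(4)[OF c(1)] by (auto intro!: lk_zero simp: cl_def)
  moreover have "lk BB (set (M1 @ M2)) = 1 * int (length BB)" by (rule lk_const) (auto simp: in_M eps_AB)
  moreover have "lk (map bar QQ) (set (M1 @ M2)) = 0" by (rule lk_zero) (auto dest!: in_M(9) notin_M(4))
  ultimately show ?thesis by simp
qed

text \<open>The index identity of the loop at \<open>i\<close>. On the right, the one comes from the
  crossing of \<open>j\<close>, whose passages lie on either side, and the other terms from
  \<open>c\<close>, the only other crossing counted negatively.\<close>

lemma count_i: "int (length BB) + int (length PP) + int (length YY) = 1 + int (length (cl M1)) + int (length (cl M2))"
proof -
  let ?S = "set (M1 @ j # M2)"
  have "lk (M3 @ bar j # X) ?S = 0" using loop_index[of i "M1 @ j # M2" "M3 @ bar j # X"] knot by simp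
  moreover have "lk M3 ?S = lk BB ?S + lk (map bar QQ) ?S + lk (cl M3) ?S"
    using lk_mset[OF mset_M3] by simp
  moreover have "lk BB ?S = 1 * int (length BB)" by (rule lk_const) (auto simp: in_M eps_AB)
  moreover have "lk (map bar QQ) ?S = 0" by (rule lk_zero) (auto dest!: in_M(9) notin_M(4))
  moreover have "lk (cl M3) ?S = 0"
    using notin_M(4)[OF c(1)] by (auto intro!: lk_zero simp: cl_def)
  moreover have "lk X ?S = lk PP ?S + lk YY ?S + lk QQ ?S + lk [c] ?S" using lk_mset[OF mset_X] by simp
  moreover have "lk PP ?S = 1 * int (length PP)" by (rule lk_const) (auto simp: in_M)
  moreover have "lk YY ?S = 1 * int (length YY)" by (rule lk_const) (auto simp: in_M)
  moreover have "lk QQ ?S = 0" by (rule lk_zero) (auto dest!: in_M(10) notin_M(3))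
  moreover have "lk [c] ?S = - int (length (cl M1)) - int (length (cl M2))"
  proof -
    have "bar c \<noteq> j" using block_bar(2)[of c] c(1) by simp
    moreover have "\<not> (bar c \<in> set M1 \<and> bar c \<in> set M2)" using dis(5) by blast
    ultimately show ?thesis by (cases "bar c \<in> set M1"; cases "bar c \<in> set M2") (simp_all add: lk_Cons cl_def eps_c)
  qed
  moreover have "lk (bar j # X) ?S = - 1 + lk X ?S" using eps_core by (simp add: lk_Cons)
  ultimately show ?thesis by simp
qed

text \<open>The index identity of the loop at \<open>j\<close>, with the one coming from the
  crossing of \<open>i\<close>.\<close>

lemma count_j: "int (length AA) + int (length YY) + int (length QQ) = 1 + int (length (cl M2)) + int (length (cl M3))"
proof -
  let ?S = "set (M2 @ bar i # M3)"
  have "knot_word (j # (M2 @ bar i # M3) @ bar j # (X @ i # M1))"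
    using knot_word_append[of "i # M1" "j # M2 @ bar i # M3 @ bar j # X"] knot by simp
  from loop_index[OF this] have "lk (X @ i # M1) ?S = 0" .
  moreover have "lk M1 ?S = lk AA ?S + lk (map bar PP) ?S + lk (cl M1) ?S"
    using lk_mset[OF mset_M1] by simp
  moreover have "lk AA ?S = 1 * int (length AA)" by (rule lk_const) (auto simp: in_M eps_AB)
  moreover have "lk (map bar PP) ?S = 0" by (rule lk_zero) (auto dest!: in_M(5) notin_M(4))
  moreover have "lk (cl M1) ?S = 0"
    using notin_M(4)[OF c(1)] by (auto intro!: lk_zero simp: cl_def)
  moreover have "lk X ?S = lk PP ?S + lk YY ?S + lk QQ ?S + lk [c] ?S" using lk_mset[OF mset_X] by simp
  moreover have "lk QQ ?S = 1 * int (length QQ)" by (rule lk_const) (auto simp: in_M)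
  moreover have "lk YY ?S = 1 * int (length YY)" by (rule lk_const) (auto simp: in_M)
  moreover have "lk PP ?S = 0" by (rule lk_zero) (auto dest!: in_M(6) notin_M(1))
  moreover have "lk [c] ?S = - int (length (cl M2)) - int (length (cl M3))"
  proof -
    have "bar c \<noteq> bar i" using block_bar(3)[of c] c(1) by simp
    moreover have "\<not> (bar c \<in> set M2 \<and> bar c \<in> set M3)" using dis(8) by blast
    ultimately show ?thesis by (cases "bar c \<in> set M2"; cases "bar c \<in> set M3") (simp_all add: lk_Cons cl_def eps_c)
  qed
  moreover have "lk (i # M1) ?S = - 1 + lk M1 ?S" using eps_core by (simp add: lk_Cons)
  ultimately show ?thesis by simp
qed

end

lemma length_codes [simp]: "length (codes n m) = m" and nth_codes [simp]: "t < m \<Longrightarrow> codes n m ! t = int (n + t)"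
  by (simp_all add: codes_def del: upt_Suc)

lemma in_codes: "x \<in> set (codes n m) \<longleftrightarrow> int n \<le> x \<and> x < int (n + m)"
proof
  assume a: "int n \<le> x \<and> x < int (n + m)"
  then have "x = int (nat x)" "nat x \<in> {n..<n + m}" by auto
  then show "x \<in> set (codes n m)" unfolding codes_def by (metis atLeastLessThan_upt image_eqI set_map)
qed (auto simp: codes_def)

text \<open>Each choice of \<open>k\<close>, \<open>a\<close> and \<open>y\<close> determines
  \<open>p\<close> and \<open>q\<close> by one equation each.\<close>

lemma solutions:
  fixes k a p y q :: nat
  assumes "k = 1 \<or> k = 2 \<or> k = 3" "a + p + y = 1 + (if k = 1 then 1 else 0) + (if k = 2 then 1 else 0)"
    "a + y + q = 1 + (if k = 2 then 1 else 0) + (if k = 3 then 1 else 0)"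
  shows "(k, a, p, y, q) \<in>
    {(1, 0, 1, 1, 0), (1, 0, 2, 0, 1), (1, 1, 1, 0, 0), (2, 0, 0, 2, 0), (2, 0, 1, 1, 1), (2, 0, 2, 0, 2),
     (2, 1, 0, 1, 0), (2, 1, 1, 0, 1), (2, 2, 0, 0, 0), (3, 0, 0, 1, 1), (3, 0, 1, 0, 2), (3, 1, 0, 0, 1)}"
proof -
  \<comment> \<open>At most one of the two optional terms in the first equation is present, so its
    right hand side is at most two.\<close>
  have "a + y \<le> 2" using assms by (auto split: if_splits)
  then have "(a, y) \<in> {(0, 0), (0, 1), (0, 2), (1, 0), (1, 1), (2, 0)}" by auto
  then show ?thesis using assms(1)
    by (elim disjE insertE emptyE) (use assms(2,3) in auto)
qed

context core_arc
begin

text \<open>The passage with \<open>fr\<close> of every crossing, ordered so that the code of a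
  letter in \<open>check_arc\<close> is its position plus one. For the negative crossing and for
  \<open>i\<close> this is the other passage.\<close>

definition "NN = [bar c, bar i, j] @ AA @ BB @ PP @ YY @ QQ"
definition "decode k = (if 0 < k then NN ! (nat k - 1) else bar (NN ! (nat (- k) - 1)))"
definition "WW = {k :: int. k \<noteq> 0 \<and> nat \<bar>k\<bar> \<le> length NN}"

lemma over_lists: "a \<in> set (AA @ BB @ PP @ YY @ QQ) \<Longrightarrow> over a"
  using X by (auto simp: AA_def BB_def PP_def YY_def QQ_def)

lemma NN_eps: "v \<in> set NN \<Longrightarrow> eps v = 1"
  unfolding NN_def using eps_core eps_c eps_AB in_M(11-13) by auto

lemma NN_fr: "v \<in> set NN \<Longrightarrow> fr v"
  using NN_eps[of v] by (simp add: eps_def split: if_splits)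

lemma distinct_NN: "distinct NN"
proof -
  have "distinct (AA @ BB @ PP @ YY @ QQ)"
    using dis by (auto simp: AA_def BB_def PP_def YY_def QQ_def)
  moreover have "bar c \<notin> set (AA @ BB @ PP @ YY @ QQ)" using over_lists[of "bar c"] X[OF c(1)] by auto
  moreover have "bar i \<notin> set (AA @ BB @ PP @ YY @ QQ)" "j \<notin> set (AA @ BB @ PP @ YY @ QQ)"
    using notin_M(1)[of "bar i"] notin_M(3)[of "bar i"] notin_M(4)[of "bar i"]
      notin_M(1)[of j] notin_M(3)[of j] notin_M(4)[of j] by (auto simp: AA_def BB_def PP_def YY_def QQ_def)
  moreover have "bar c \<noteq> bar i" "bar c \<noteq> j" "bar i \<noteq> j"
    using block_bar(2,3)[of c] c(1) gauss(2) by (simp, simp, auto)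
  ultimately show ?thesis unfolding NN_def by simp
qed

lemma NN_positive: "v \<in> set NN \<Longrightarrow> positive v = (v \<noteq> bar c)"
proof (cases "v = bar c")
  case False
  assume v: "v \<in> set NN"
  have "v \<in> set (T @ X)" using v False unfolding NN_def by (auto simp: AA_def BB_def PP_def YY_def QQ_def)
  moreover have "v \<noteq> c"
    using v notin_M(4)[OF c(1)] False unfolding NN_def by (auto simp: AA_def BB_def PP_def YY_def QQ_def)
  ultimately show ?thesis using positive[of v] False by blast
qed (use c in simp)

lemma decode_bar: "k \<noteq> 0 \<Longrightarrow> decode (- k) = bar (decode k)"
  by (auto simp: decode_def)

lemma decode_nth: "k \<in> WW \<Longrightarrow> 0 < k \<Longrightarrow> decode k = NN ! (nat k - 1) \<and> nat k - 1 < length NN"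
  by (auto simp: decode_def WW_def)

lemma decode_pos: "k \<in> WW \<Longrightarrow> 0 < k \<Longrightarrow> decode k \<in> set NN"
  using decode_nth[of k] by auto

lemma coding_decode: "coding decode WW"
proof -
  have fr: "fr (decode k) = (0 < k)" if "k \<in> WW" for k
  proof (cases "0 < k")
    case True
    then show ?thesis using NN_fr[OF decode_pos[OF that True]] by simp
  next
    case False
    then have "- k \<in> WW" "0 < - k" using that by (auto simp: WW_def)
    then have "fr (decode (- k))" by (intro NN_fr decode_pos)
    then show ?thesis using decode_bar[of k] False that by (auto simp: WW_def)
  qed
  have pos: "decode k = decode l \<Longrightarrow> k = l" if kl: "k \<in> WW" "l \<in> WW" "0 < k" "0 < l" for k l
  proof -
    assume "decode k = decode l"
    then have "nat k - 1 = nat l - 1"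
      using decode_nth[OF kl(1,3)] decode_nth[OF kl(2,4)] nth_eq_iff_index_eq[OF distinct_NN, of "nat k - 1" "nat l - 1"] by simp
    then show "k = l" using kl(3,4) by linarith
  qed
  have inj: "inj_on decode WW"
  proof (rule inj_onI)
    fix k l assume kl: "k \<in> WW" "l \<in> WW" "decode k = decode l"
    then have s: "(0 < k) = (0 < l)" using fr by metis
    show "k = l"
    proof (cases "0 < k")
      case True
      then show ?thesis using pos[OF kl(1,2)] s kl(3) by simp
    next
      case False
      then have m: "- k \<in> WW" "- l \<in> WW" "0 < - k" "0 < - l" using kl s by (auto simp: WW_def)
      have "decode (- k) = decode (- l)" using kl decode_bar[of k] decode_bar[of l] by (auto simp: WW_def)
      then show ?thesis using pos[OF m] by simp
    qed
  qed
  have pn: "positive (decode k) = (\<not> neg k)" if k: "k \<in> WW" "0 < k" for k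
  proof -
    have "1 \<in> WW" "decode 1 = bar c" by (simp_all add: WW_def decode_def NN_def)
    then have "decode k = bar c \<longleftrightarrow> k = 1" using inj k by (metis inj_onD)
    then show ?thesis using NN_positive[OF decode_pos[OF k]] k(2) by (auto simp: neg_def)
  qed
  have "positive (decode k) = (\<not> neg k)" if k: "k \<in> WW" for k
  proof (cases "0 < k")
    case False
    then have "- k \<in> WW" "0 < - k" "k \<noteq> 0" using k by (auto simp: WW_def)
    then show ?thesis using pn[of "- k"] decode_bar[of k] by (auto simp: neg_def)
  qed (use pn k in simp)
  moreover have "- k \<in> WW \<and> decode (- k) = bar (decode k)" if "k \<in> WW" for k
    using that decode_bar[of k] by (auto simp: WW_def)
  ultimately show ?thesis unfolding coding_def using inj fr by blast
qed

lemma map_codes: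
  assumes "NN = U @ V @ Z" "n = 1 + length U"
  shows "map decode (codes n (length V)) = V" "map decode (map uminus (codes n (length V))) = map bar V"
proof -
  show 1: "map decode (codes n (length V)) = V"
  proof (rule nth_equalityI)
    fix t assume t: "t < length (map decode (codes n (length V)))"
    then have "map decode (codes n (length V)) ! t = decode (int (n + t))" by simp
    also have "\<dots> = NN ! (length U + t)" by (simp add: decode_def assms(2) nat_add_distrib)
    also have "\<dots> = V ! t" using t by (simp add: assms(1) nth_append)
    finally show "map decode (codes n (length V)) ! t = V ! t" .
  qed simp
  have "map decode (map uminus (codes n (length V))) = map bar (map decode (codes n (length V)))"
    using assms(2) by (auto simp: in_codes decode_bar)
  then show "map decode (map uminus (codes n (length V))) = map bar V" unfolding 1 .
qed

definition "kk = (if bar c \<in> set M1 then 1 else if bar c \<in> set M2 then 2 else 3 :: nat)"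

lemma cl_kk: "cl M1 = (if kk = 1 then [bar c] else [])" "cl M2 = (if kk = 2 then [bar c] else [])"
  "cl M3 = (if kk = 3 then [bar c] else [])"
  using c_in dis(5,6,8) by (auto simp: cl_def kk_def)

text \<open>The blocks agree with the lists in \<open>check_arc\<close> up to order, so the actual
  word is among those enumerated, and it is critical.\<close>

lemma not_check_arc: "\<not> check_arc kk (length AA) (length PP) (length YY) (length QQ)"
proof
  let ?\<alpha> = "length AA" and ?x1 = "length PP" and ?x2 = "length YY" and ?x3 = "length QQ"
  let ?A = "codes 4 ?\<alpha>" and ?B = "codes (4 + ?\<alpha>) ?\<alpha>" and ?P = "codes (4 + 2 * ?\<alpha>) ?x1"
    and ?Y = "codes (4 + 2 * ?\<alpha> + ?x1) ?x2" and ?Q = "codes (4 + 2 * ?\<alpha> + ?x1 + ?x2) ?x3" and ?m = "map uminus"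
  let ?c1 = "?A @ ?m ?P @ (if kk = 1 then [1] else [])" and ?c2 = "?m ?A @ ?m ?B @ ?m ?Y @ (if kk = 2 then [1] else [])"
    and ?c3 = "?B @ ?m ?Q @ (if kk = 3 then [1] else [])" and ?cx = "?P @ ?Y @ ?Q @ [- 1]"
  assume "check_arc kk ?\<alpha> ?x1 ?x2 ?x3"
  then have ch: "check_case ?c1 ?c2 ?c3 ?cx" unfolding check_arc_def Let_def .
  note b = count_AA_BB
  have mA: "map decode ?A = AA" "map decode (?m ?A) = map bar AA"
    by (rule map_codes[of "[bar c, bar i, j]" AA "BB @ PP @ YY @ QQ"]; simp add: NN_def)+
  have mB: "map decode ?B = BB" "map decode (?m ?B) = map bar BB"
    unfolding b by (rule map_codes[of "[bar c, bar i, j] @ AA" BB "PP @ YY @ QQ"]; simp add: NN_def b)+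
  have mP: "map decode ?P = PP" "map decode (?m ?P) = map bar PP"
    by (rule map_codes[of "[bar c, bar i, j] @ AA @ BB" PP "YY @ QQ"]; simp add: NN_def b)+
  have mY: "map decode ?Y = YY" "map decode (?m ?Y) = map bar YY"
    by (rule map_codes[of "[bar c, bar i, j] @ AA @ BB @ PP" YY "QQ"]; simp add: NN_def b)+
  have mQ: "map decode ?Q = QQ" "map decode (?m ?Q) = map bar QQ"
    by (rule map_codes[of "[bar c, bar i, j] @ AA @ BB @ PP @ YY" QQ "[]"]; simp add: NN_def b)+
  have d1: "decode 1 = bar c" "decode (- 1) = c" "decode (- 2) = i" "decode 2 = bar i" "decode 3 = j" "decode (- 3) = bar j"
    by (simp_all add: decode_def NN_def numeral_2_eq_2 numeral_3_eq_3)
  have "mset M1 = mset (map decode ?c1)" using mset_M1 cl_kk(1) mA mP d1(1) by (simp split: if_splits)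
  from ex_map_mset[OF this] obtain m1 where m1: "mset m1 = mset ?c1" "map decode m1 = M1" by blast
  have "mset M2 = mset (map decode ?c2)" using mset_M2 cl_kk(2) mA mB mY d1(1) by (simp split: if_splits)
  from ex_map_mset[OF this] obtain m2 where m2: "mset m2 = mset ?c2" "map decode m2 = M2" by blast
  have "mset M3 = mset (map decode ?c3)" using mset_M3 cl_kk(3) mB mQ d1(1) by (simp split: if_splits)
  from ex_map_mset[OF this] obtain m3 where m3: "mset m3 = mset ?c3" "map decode m3 = M3" by blast
  have "mset X = mset (map decode ?cx)" using mset_X mP mY mQ d1(2) by simp
  from ex_map_mset[OF this] obtain x where x: "mset x = mset ?cx" "map decode x = X" by blast
  let ?L = "- 2 # m1 @ 3 # m2 @ 2 # m3 @ - 3 # x"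
  have "checked ?L"
    using ch mset_perms[OF m1(1)] mset_perms[OF m2(1)] mset_perms[OF m3(1)] mset_perms[OF x(1)]
    unfolding check_case_def lazy_all_iff by blast
  moreover have "critical (map decode ?L)" using critical d1 m1(2) m2(2) m3(2) x(2) by simp
  moreover have "set ?L \<subseteq> WW"
  proof -
    have n: "length NN = 3 + 2 * ?\<alpha> + ?x1 + ?x2 + ?x3" by (simp add: NN_def b)
    have "set ?A \<subseteq> WW" "set ?B \<subseteq> WW" "set ?P \<subseteq> WW" "set ?Y \<subseteq> WW" "set ?Q \<subseteq> WW"
      unfolding WW_def n by (auto simp: in_codes)
    moreover have "uminus ` S \<subseteq> WW" if "S \<subseteq> WW" for S using that by (auto simp: WW_def)
    moreover have "{1, - 1, 2, - 2, 3, - 3} \<subseteq> WW" unfolding WW_def n by auto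
    ultimately have c: "set ?c1 \<subseteq> WW" "set ?c2 \<subseteq> WW" "set ?c3 \<subseteq> WW" "set ?cx \<subseteq> WW" "{- 2, 2, 3, - 3} \<subseteq> WW"
      by (auto split: if_splits)
    have "set m1 = set ?c1" "set m2 = set ?c2" "set m3 = set ?c3" "set x = set ?cx"
      using arg_cong[OF m1(1), of set_mset] arg_cong[OF m2(1), of set_mset] arg_cong[OF m3(1), of set_mset]
        arg_cong[OF x(1), of set_mset] by (simp_all only: set_mset_mset)
    with c have "set m1 \<subseteq> WW" "set m2 \<subseteq> WW" "set m3 \<subseteq> WW" "set x \<subseteq> WW" by (simp_all only:)
    then show ?thesis using c(5) by simp
  qed
  ultimately show False using checked_code[OF coding_decode] by blast
qed

lemma parameters:
  "(kk, length AA, length PP, length YY, length QQ) \<in>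
    {(1, 0, 1, 1, 0), (1, 0, 2, 0, 1), (1, 1, 1, 0, 0), (2, 0, 0, 2, 0), (2, 0, 1, 1, 1), (2, 0, 2, 0, 2),
     (2, 1, 0, 1, 0), (2, 1, 1, 0, 1), (2, 2, 0, 0, 0), (3, 0, 0, 1, 1), (3, 0, 1, 0, 2), (3, 1, 0, 0, 1)}"
proof -
  have k: "kk = 1 \<or> kk = 2 \<or> kk = 3" by (simp add: kk_def)
  have "length AA + length PP + length YY = 1 + (if kk = 1 then 1 else 0) + (if kk = 2 then 1 else 0)"
    using count_i unfolding cl_kk count_AA_BB[symmetric] by (simp split: if_splits)
  moreover have "length AA + length YY + length QQ = 1 + (if kk = 2 then 1 else 0) + (if kk = 3 then 1 else 0)"
    using count_j unfolding cl_kk by (simp split: if_splits)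
  ultimately show ?thesis by (intro solutions[OF k])
qed

end

text \<open>The parameters with \<open>k = 3\<close> below are those with \<open>k = 1\<close> with
  \<open>x1\<close> and \<open>x3\<close> exchanged, as reversing the word exchanges
  \<open>M1\<close> and \<open>M3\<close>.\<close>

lemma check_arc_1:
  "check_arc 1 0 1 1 0" "check_arc 1 0 2 0 1" "check_arc 1 1 1 0 0"
  by code_simp+

lemma check_arc_3:
  "check_arc 3 0 0 1 1" "check_arc 3 0 1 0 2" "check_arc 3 1 0 0 1"
  by code_simp+

lemma check_arc_2a: "check_arc 2 0 0 2 0" "check_arc 2 0 1 1 1" "check_arc 2 1 0 1 0"
  by code_simp+

lemma check_arc_2b: "check_arc 2 1 1 0 1"
  by code_simp

text \<open>This family and the one in \<open>check_arc_2d\<close> are the largest, with 480 words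
  each.\<close>

lemma check_arc_2c: "check_arc 2 0 2 0 2"
  by code_simp

lemma check_arc_2d: "check_arc 2 2 0 0 0"
  by code_simp

lemma no_critical: "\<not> critical w"
proof
  assume "critical w"
  then obtain c i j M1 M2 M3 X where "core_arc c i j M1 M2 M3 X" using critical_core_arc by blast
  then interpret core_arc c i j M1 M2 M3 X .
  show False
    using parameters not_check_arc check_arc_1 check_arc_2a check_arc_2b check_arc_2c check_arc_2d check_arc_3
    by (elim insertE emptyE) simp_all
qed

theorem corollary1p12:
  shows "\<not> (\<exists>K :: knot. almost_positive_knot K \<and> delta_unknotting_number K = 1)"
proof (rule main_reduction)
  fix w assume "knot_word w" "card (negatives w) = 1" "a2 w = 1"
  then show "\<exists>w'. same_knot w w' \<and> negatives w' = {}" using ex_critical no_critical by blast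
qed

end
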